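(* Let $n\in\mathbb{Z}$ and let $Y$ be an indecomposable object of $\mathscr{D}$. Then $$\operatorname{Hom}_{\overline{\mathscr{D}}}(Y,\Sigma\mathsf{E}_n)\cong\begin{cases}k & \text{if } Y\in\mathbb{W}(\Sigma^{n+1}X_0),\\ 0 & \text{if } Y\notin\mathbb{W}(\Sigma^{n+1}X_0),\end{cases}$$ and $$\operatorname{Hom}_{\overline{\mathscr{D}}}(\mathsf{E}_n,\Sigma Y)\cong\begin{cases}k & \text{if } Y\in\mathbb{W}(\Sigma^{n+1}X_0),\\ 0 & \text{if } Y\notin\mathbb{W}(\Sigma^{n+1}X_0).\end{cases}$$
   Context: Let $k$ be an algebraically closed field and let $R=k[T]$ be viewed as a DG algebra with zero differential, with $T$ in cohomological degree $-1$. Let $\mathsf{D}(R)$ be the derived category of right DG $R$-modules, with suspension $\Sigma$ (so $(\Sigma M)^i=M^{i+1}$ on underlying graded modules), and let $\mathscr{D}=\mathsf{D}^f(R)$ be its full subcategory of DG modules whose total cohomology is finite-dimensional over $k$. For $n\in\mathbb{N}_0=\{0,1,2,\dots\}$ the object $X_n$ is defined by a distinguished triangle $\Sigma^{n+1}R\xrightarrow{\cdot T^{n+1}}R\to X_n\to$. Up to isomorphism, the indecomposable objects of $\mathscr{D}$ are the $\Sigma^iX_n$ with $i\in\mathbb{Z}$, $n\in\mathbb{N}_0$, and the space of morphisms $\Sigma^{n-i}X_i\to\Sigma^{n-i-1}X_{i+1}$ is one-dimensional over $k$ for all $n\in\mathbb{Z}$, $i\in\mathbb{N}_0$. For $n\in\mathbb{Z}$,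 $\mathsf{E}_n=\operatorname{hocolim}_i(\Sigma^{n-i}X_i)\in\mathsf{D}(R)$ denotes the homotopy colimit (mapping cone of $\mathrm{id}-\mathrm{shift}$ on $\coprod_i\Sigma^{n-i}X_i$) of the direct system $\Sigma^nX_0\to\Sigma^{n-1}X_1\to\Sigma^{n-2}X_2\to\cdots$ of nonzero (irreducible) morphisms. The category $\overline{\mathscr{D}}=\operatorname{add}\{\Sigma^iX_n,\mathsf{E}_m\mid i,m\in\mathbb{Z},n\in\mathbb{N}_0\}$ is the full subcategory of $\mathsf{D}(R)$ of all direct summands of finite direct sums of these objects. For $n\in\mathbb{Z}$, the wedge based at $\Sigma^nX_0$ is $\mathbb{W}(\Sigma^nX_0)=\{\Sigma^{n-j}X_l : 0\le j\le l\}$ (membership understood up to isomorphism). Isomorphisms are of $k$-vector spaces. *)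

theory Defs
  imports
    "HOL-Library.Function_Algebras"
    "HOL-Library.Nat_Bijection"
    "HOL-Computational_Algebra.Polynomial"
begin

section \<open>The universe of vectors\<close>

text \<open>
  All DG modules live on subspaces of the \<open>k\<close>-vector space of functions \<open>'u \<times> nat \<Rightarrow> k\<close>, where the
  type \<open>'u\<close> is an arbitrary universe parameter. Every \<open>k\<close>-vector space embeds in such a space for a
  suitable \<open>'u\<close>. The factor \<open>nat\<close> makes the universe closed under binary direct sums and countable
  coproducts, through the splitting maps below; it is also closed under semifree resolutions, so
  that roofs inside the universe compute the morphisms of the derived category.
\<close>

type_synonym ('k, 'u) vec = "'u \<times> nat \<Rightarrow> 'k"

definition vscale :: "'k::field \<Rightarrow> ('k, 'u) vec \<Rightarrow> ('k, 'u) vec" where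
  "vscale c v = (\<lambda>x. c * v x)"

global_interpretation vec: vector_space vscale
  by unfold_locales (auto simp: vscale_def fun_eq_iff algebra_simps)

definition pair :: "('k, 'u) vec \<Rightarrow> ('k, 'u) vec \<Rightarrow> ('k, 'u) vec" where
  "pair v w = (\<lambda>(u, m). if even m then v (u, m div 2) else w (u, m div 2))"

definition pfst :: "('k, 'u) vec \<Rightarrow> ('k, 'u) vec" where
  "pfst v = (\<lambda>(u, m). v (u, 2 * m))"

definition psnd :: "('k, 'u) vec \<Rightarrow> ('k, 'u) vec" where
  "psnd v = (\<lambda>(u, m). v (u, 2 * m + 1))"

definition tuple :: "(nat \<Rightarrow> ('k, 'u) vec) \<Rightarrow> ('k, 'u) vec" where
  "tuple F = (\<lambda>(u, m). case prod_decode m of (j, l) \<Rightarrow> F j (u, l))"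

definition slot :: "nat \<Rightarrow> ('k, 'u) vec \<Rightarrow> ('k, 'u) vec" where
  "slot j v = (\<lambda>(u, l). v (u, prod_encode (j, l)))"

definition klinear_on :: "('k::field, 'u) vec set \<Rightarrow> (('k, 'u) vec \<Rightarrow> ('k, 'u) vec) \<Rightarrow> bool" where
  "klinear_on S f \<longleftrightarrow>
     (\<forall>x\<in>S. \<forall>y\<in>S. f (x + y) = f x + f y) \<and> (\<forall>c. \<forall>x\<in>S. f (vscale c x) = vscale c (f x))"


section \<open>Right DG modules over \<open>R = k[T]\<close>\<close>

text \<open>The degree \<open>j\<close> part of the graded algebra \<open>R\<close>, with \<open>T\<close> in cohomological degree \<open>-1\<close>.\<close>

definition Rgr :: "int \<Rightarrow> 'k::field poly set" where
  "Rgr j = (if j \<le> 0 then range (\<lambda>c. monom c (nat (- j))) else {0})"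

text \<open>
  \<open>gr M i\<close> is \<open>M\<^sup>i\<close>, \<open>dif M i\<close> is the differential on \<open>M\<^sup>i\<close>, and \<open>act M i x r\<close> is \<open>x r\<close> for \<open>x \<in> M\<^sup>i\<close>
  and homogeneous \<open>r\<close>. Different \<open>M\<^sup>i\<close> may overlap as subspaces of the universe, so everything is
  indexed by the degree; values outside \<open>M\<^sup>i\<close> do not matter.
\<close>

record (overloaded) ('k::zero, 'u) dgm =
  gr :: "int \<Rightarrow> ('k, 'u) vec set"
  dif :: "int \<Rightarrow> ('k, 'u) vec \<Rightarrow> ('k, 'u) vec"
  act :: "int \<Rightarrow> ('k, 'u) vec \<Rightarrow> 'k poly \<Rightarrow> ('k, 'u) vec"

text \<open>
  In the last clause the Leibniz rule \<open>d(x r) = d(x) r + (-1)\<^sup>i x d(r)\<close> has lost its second summand, as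
  \<open>R\<close> has zero differential.
\<close>

definition dg_module :: "('k::field, 'u) dgm \<Rightarrow> bool" where
  "dg_module M \<longleftrightarrow>
     (\<forall>i. vec.subspace (gr M i)) \<and>
     (\<forall>i. klinear_on (gr M i) (dif M i)) \<and>
     (\<forall>i. \<forall>x\<in>gr M i. dif M i x \<in> gr M (i + 1) \<and> dif M (i + 1) (dif M i x) = 0) \<and>
     (\<forall>i j. \<forall>x\<in>gr M i. \<forall>r\<in>Rgr j. act M i x r \<in> gr M (i + j)) \<and>
     (\<forall>i j. \<forall>r\<in>Rgr j. klinear_on (gr M i) (\<lambda>x. act M i x r)) \<and>
     (\<forall>i j. \<forall>x\<in>gr M i. \<forall>r\<in>Rgr j. \<forall>s\<in>Rgr j. act M i x (r + s) = act M i x r + act M i x s) \<and>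
     (\<forall>i j c. \<forall>x\<in>gr M i. \<forall>r\<in>Rgr j. act M i x (smult c r) = vscale c (act M i x r)) \<and>
     (\<forall>i. \<forall>x\<in>gr M i. act M i x 1 = x) \<and>
     (\<forall>i j l. \<forall>x\<in>gr M i. \<forall>r\<in>Rgr j. \<forall>s\<in>Rgr l. act M i x (r * s) = act M (i + j) (act M i x r) s) \<and>
     (\<forall>i j. \<forall>x\<in>gr M i. \<forall>r\<in>Rgr j. dif M (i + j) (act M i x r) = act M (i + 1) (dif M i x) r)"

type_synonym ('k, 'u) gmap = "int \<Rightarrow> ('k, 'u) vec \<Rightarrow> ('k, 'u) vec"

definition dg_hom :: "('k::field, 'u) dgm \<Rightarrow> ('k, 'u) dgm \<Rightarrow> ('k, 'u) gmap \<Rightarrow> bool" where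
  "dg_hom M N f \<longleftrightarrow>
     (\<forall>i. klinear_on (gr M i) (f i)) \<and>
     (\<forall>i. \<forall>x\<in>gr M i. f i x \<in> gr N i) \<and>
     (\<forall>i j. \<forall>x\<in>gr M i. \<forall>r\<in>Rgr j. f (i + j) (act M i x r) = act N i (f i x) r) \<and>
     (\<forall>i. \<forall>x\<in>gr M i. f (i + 1) (dif M i x) = dif N i (f i x))"

definition gid :: "('k, 'u) gmap" where
  "gid = (\<lambda>i x. x)"

definition gcomp :: "('k, 'u) gmap \<Rightarrow> ('k, 'u) gmap \<Rightarrow> ('k, 'u) gmap" where
  "gcomp g f = (\<lambda>i x. g i (f i x))"

definition homotopic ::
  "('k::field, 'u) dgm \<Rightarrow> ('k, 'u) dgm \<Rightarrow> ('k, 'u) gmap \<Rightarrow> ('k, 'u) gmap \<Rightarrow> bool" where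
  "homotopic M N f g \<longleftrightarrow> (\<exists>h :: ('k, 'u) gmap.
     (\<forall>i. klinear_on (gr M i) (h i)) \<and>
     (\<forall>i. \<forall>x\<in>gr M i. h i x \<in> gr N (i - 1)) \<and>
     (\<forall>i j. \<forall>x\<in>gr M i. \<forall>r\<in>Rgr j. h (i + j) (act M i x r) = act N (i - 1) (h i x) r) \<and>
     (\<forall>i. \<forall>x\<in>gr M i. f i x - g i x = dif N (i - 1) (h i x) + h (i + 1) (dif M i x)))"

definition cocycles :: "('k::field, 'u) dgm \<Rightarrow> int \<Rightarrow> ('k, 'u) vec set" where
  "cocycles M i = {x \<in> gr M i. dif M i x = 0}"

definition coboundaries :: "('k::field, 'u) dgm \<Rightarrow> int \<Rightarrow> ('k, 'u) vec set" where
  "coboundaries M i = dif M (i - 1) ` gr M (i - 1)"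

text \<open>Injectivity and surjectivity of all \<open>H\<^sup>i(f)\<close>, where \<open>H\<^sup>i\<close> is cocycles modulo coboundaries.\<close>

definition quasi_iso :: "('k::field, 'u) dgm \<Rightarrow> ('k, 'u) dgm \<Rightarrow> ('k, 'u) gmap \<Rightarrow> bool" where
  "quasi_iso M N f \<longleftrightarrow> dg_hom M N f \<and>
     (\<forall>i. \<forall>x\<in>cocycles M i. f i x \<in> coboundaries N i \<longrightarrow> x \<in> coboundaries M i) \<and>
     (\<forall>i. \<forall>y\<in>cocycles N i. \<exists>x\<in>cocycles M i. f i x - y \<in> coboundaries N i)"

definition finite_total_cohomology :: "('k::field, 'u) dgm \<Rightarrow> bool" where
  "finite_total_cohomology M \<longleftrightarrow>
     finite {i. cocycles M i \<noteq> coboundaries M i} \<and>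
     (\<forall>i. \<exists>S. finite S \<and> S \<subseteq> cocycles M i \<and>
        (\<forall>x\<in>cocycles M i. \<exists>s\<in>vec.span S. x - s \<in> coboundaries M i))"

definition zero_dgm :: "('k::field, 'u) dgm" where
  "zero_dgm = \<lparr> gr = (\<lambda>i. {0}), dif = (\<lambda>i x. 0), act = (\<lambda>i x r. 0) \<rparr>"

text \<open>
  \<open>\<Sigma>\<^sup>a M\<close>. Suspension changes the sign of the differential; on right modules it does not affect the
  action.
\<close>

definition susp :: "int \<Rightarrow> ('k::field, 'u) dgm \<Rightarrow> ('k, 'u) dgm" where
  "susp a M =
     \<lparr> gr = (\<lambda>i. gr M (i + a)),
       dif = (\<lambda>i x. if even a then dif M (i + a) x else - dif M (i + a) x),
       act = (\<lambda>i. act M (i + a)) \<rparr>"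

definition dsum :: "('k::field, 'u) dgm \<Rightarrow> ('k, 'u) dgm \<Rightarrow> ('k, 'u) dgm" where
  "dsum M N =
     \<lparr> gr = (\<lambda>i. {pair x y | x y. x \<in> gr M i \<and> y \<in> gr N i}),
       dif = (\<lambda>i v. pair (dif M i (pfst v)) (dif N i (psnd v))),
       act = (\<lambda>i v r. pair (act M i (pfst v) r) (act N i (psnd v) r)) \<rparr>"

definition dsum_list :: "('k::field, 'u) dgm list \<Rightarrow> ('k, 'u) dgm" where
  "dsum_list Ms = foldr dsum Ms zero_dgm"

definition coprod :: "(nat \<Rightarrow> ('k::field, 'u) dgm) \<Rightarrow> ('k, 'u) dgm" where
  "coprod A =
     \<lparr> gr = (\<lambda>i. {v. (\<forall>j. slot j v \<in> gr (A j) i) \<and> finite {j. slot j v \<noteq> 0}}),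
       dif = (\<lambda>i v. tuple (\<lambda>j. dif (A j) i (slot j v))),
       act = (\<lambda>i v r. tuple (\<lambda>j. act (A j) i (slot j v) r)) \<rparr>"

text \<open>The mapping cone \<open>\<Sigma>M \<oplus> N\<close> of \<open>f : M \<rightarrow> N\<close>, with differential \<open>(x, y) \<mapsto> (- dx, f x + dy)\<close>.\<close>

definition cone ::
  "('k::field, 'u) dgm \<Rightarrow> ('k, 'u) dgm \<Rightarrow> ('k, 'u) gmap \<Rightarrow> ('k, 'u) dgm" where
  "cone M N f =
     \<lparr> gr = (\<lambda>i. {pair x y | x y. x \<in> gr M (i + 1) \<and> y \<in> gr N i}),
       dif = (\<lambda>i v. pair (- dif M (i + 1) (pfst v)) (f (i + 1) (pfst v) + dif N i (psnd v))),
       act = (\<lambda>i v r. pair (act M (i + 1) (pfst v) r) (act N i (psnd v) r)) \<rparr>"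

text \<open>
  For a direct system \<open>A\<^sub>0 \<rightarrow> A\<^sub>1 \<rightarrow> \<dots>\<close> with maps \<open>\<mu> j : A\<^sub>j \<rightarrow> A\<^sub>j\<^sub>+\<^sub>1\<close>, the map \<open>id - shift\<close> on the coproduct.
\<close>

definition id_minus_shift :: "(nat \<Rightarrow> ('k::field, 'u) gmap) \<Rightarrow> ('k, 'u) gmap" where
  "id_minus_shift \<mu> =
     (\<lambda>i v. v - tuple (\<lambda>j. case j of 0 \<Rightarrow> 0 | Suc l \<Rightarrow> \<mu> l i (slot l v)))"

definition hocolim ::
  "(nat \<Rightarrow> ('k::field, 'u) dgm) \<Rightarrow> (nat \<Rightarrow> ('k, 'u) gmap) \<Rightarrow> ('k, 'u) dgm" where
  "hocolim A \<mu> = cone (coprod A) (coprod A) (id_minus_shift \<mu>)"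

text \<open>
  \<open>R\<close> as a right DG module over itself: a polynomial \<open>p\<close> is placed in the universe as its coefficient
  function (constant in the argument of type \<open>'u\<close>), and \<open>conv\<close> is multiplication by a polynomial.
\<close>

definition emb :: "'k::field poly \<Rightarrow> ('k, 'u) vec" where
  "emb p = (\<lambda>(u, m). coeff p m)"

definition conv :: "('k::field, 'u) vec \<Rightarrow> 'k poly \<Rightarrow> ('k, 'u) vec" where
  "conv v r = (\<lambda>(u, m). \<Sum>l\<le>m. v (u, l) * coeff r (m - l))"

definition R_dgm :: "('k::field, 'u) dgm" where
  "R_dgm = \<lparr> gr = (\<lambda>i. emb ` Rgr i), dif = (\<lambda>i x. 0), act = (\<lambda>i. conv) \<rparr>"

text \<open>\<open>X\<^sub>n\<close> is the cone of multiplication by \<open>T\<^sup>n\<^sup>+\<^sup>1\<close> as a map \<open>\<Sigma>\<^sup>n\<^sup>+\<^sup>1 R \<rightarrow> R\<close>.\<close>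

definition X :: "nat \<Rightarrow> ('k::field, 'u) dgm" where
  "X n = cone (susp (int n + 1) R_dgm) R_dgm (\<lambda>i x. conv x (monom 1 (n + 1)))"


section \<open>Linear categories\<close>

record ('k, 'a) kspace =
  kcarrier :: "'a set"
  kadd :: "'a \<Rightarrow> 'a \<Rightarrow> 'a"
  ksmult :: "'k \<Rightarrow> 'a \<Rightarrow> 'a"

definition k_line :: "('k::field, 'k) kspace" where
  "k_line = \<lparr> kcarrier = UNIV, kadd = (+), ksmult = (*) \<rparr>"

definition k_zero :: "('k::field, 'k) kspace" where
  "k_zero = \<lparr> kcarrier = {0}, kadd = (+), ksmult = (*) \<rparr>"

definition kspace_iso :: "('k, 'a) kspace \<Rightarrow> ('k, 'b) kspace \<Rightarrow> bool" where
  "kspace_iso V W \<longleftrightarrow> (\<exists>\<phi>. bij_betw \<phi> (kcarrier V) (kcarrier W) \<and>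
     (\<forall>x\<in>kcarrier V. \<forall>y\<in>kcarrier V. \<phi> (kadd V x y) = kadd W (\<phi> x) (\<phi> y)) \<and>
     (\<forall>c. \<forall>x\<in>kcarrier V. \<phi> (ksmult V c x) = ksmult W c (\<phi> x)))"

record ('o, 'k, 'm) lincat =
  Obj :: "'o set"
  Hom :: "'o \<Rightarrow> 'o \<Rightarrow> ('k, 'm) kspace"
  Comp :: "'o \<Rightarrow> 'o \<Rightarrow> 'o \<Rightarrow> 'm \<Rightarrow> 'm \<Rightarrow> 'm"  \<comment> \<open>\<open>Comp C A B D g f\<close> is \<open>g \<circ> f : A \<rightarrow> B \<rightarrow> D\<close>\<close>
  Ident :: "'o \<Rightarrow> 'm"

definition full_subcategory :: "('o, 'k, 'm) lincat \<Rightarrow> ('o \<Rightarrow> bool) \<Rightarrow> ('o, 'k, 'm) lincat" where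
  "full_subcategory C P = C \<lparr> Obj := {A \<in> Obj C. P A} \<rparr>"

definition isomorphic_in :: "('o, 'k, 'm) lincat \<Rightarrow> 'o \<Rightarrow> 'o \<Rightarrow> bool" where
  "isomorphic_in C A B \<longleftrightarrow> A \<in> Obj C \<and> B \<in> Obj C \<and>
     (\<exists>f \<in> kcarrier (Hom C A B). \<exists>g \<in> kcarrier (Hom C B A).
        Comp C A B A g f = Ident C A \<and> Comp C B A B f g = Ident C B)"


section \<open>The derived category\<close>

text \<open>
  \<open>D(R)\<close> is the localization of the homotopy category at the quasi-isomorphisms, by the calculus of
  fractions: the triple \<open>(P, s, f)\<close> is the roof \<open>M \<leftarrow> P \<rightarrow> N\<close> with \<open>s : P \<rightarrow> M\<close> a quasi-isomorphism,
  representing \<open>f s\<^sup>-\<^sup>1\<close>. Homotopic maps are identified by \<open>roof_eq\<close>.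
\<close>

type_synonym ('k, 'u) roof = "('k, 'u) dgm \<times> ('k, 'u) gmap \<times> ('k, 'u) gmap"

definition is_roof :: "('k::field, 'u) dgm \<Rightarrow> ('k, 'u) dgm \<Rightarrow> ('k, 'u) roof \<Rightarrow> bool" where
  "is_roof M N = (\<lambda>(P, s, f). dg_module P \<and> quasi_iso P M s \<and> dg_hom P N f)"

definition roof_eq ::
  "('k::field, 'u) dgm \<Rightarrow> ('k, 'u) dgm \<Rightarrow> ('k, 'u) roof \<Rightarrow> ('k, 'u) roof \<Rightarrow> bool" where
  "roof_eq M N = (\<lambda>(P, s, f) (P', s', f'). \<exists>Q u u'.
     dg_module Q \<and> dg_hom Q P u \<and> dg_hom Q P' u' \<and>
     quasi_iso Q M (gcomp s u) \<and>
     homotopic Q M (gcomp s u) (gcomp s' u') \<and>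
     homotopic Q N (gcomp f u) (gcomp f' u'))"

definition roof_class ::
  "('k::field, 'u) dgm \<Rightarrow> ('k, 'u) dgm \<Rightarrow> ('k, 'u) roof \<Rightarrow> ('k, 'u) roof set" where
  "roof_class M N \<rho> = {\<sigma>. is_roof M N \<sigma> \<and> roof_eq M N \<rho> \<sigma>}"

text \<open>
  The operations on classes are given as unions, over all suitable representatives, of the class of
  the result, which does not depend on the representatives.
\<close>

definition DHom ::
  "('k::field, 'u) dgm \<Rightarrow> ('k, 'u) dgm \<Rightarrow> ('k, ('k, 'u) roof set) kspace" where
  "DHom M N =
     \<lparr> kcarrier = roof_class M N ` {\<rho>. is_roof M N \<rho>},
       kadd = (\<lambda>F G. \<Union> {roof_class M N (P, s, \<lambda>i x. f i x + g i x) | P s f g.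
                 (P, s, f) \<in> F \<and> (P, s, g) \<in> G}),
       ksmult = (\<lambda>c F. \<Union> {roof_class M N (P, s, \<lambda>i x. vscale c (f i x)) | P s f. (P, s, f) \<in> F}) \<rparr>"

definition DComp ::
  "('k::field, 'u) dgm \<Rightarrow> ('k, 'u) dgm \<Rightarrow> ('k, 'u) dgm \<Rightarrow>
   ('k, 'u) roof set \<Rightarrow> ('k, 'u) roof set \<Rightarrow> ('k, 'u) roof set" where
  "DComp L M N G F = \<Union> {roof_class L N (W, gcomp s w, gcomp g w') | P s f Q t g W w w'.
     (P, s, f) \<in> F \<and> (Q, t, g) \<in> G \<and>
     dg_module W \<and> quasi_iso W P w \<and> dg_hom W Q w' \<and> homotopic W M (gcomp f w) (gcomp t w')}"

text \<open>The morphism of \<open>D(R)\<close> given by a homomorphism of DG modules.\<close>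

definition DMor ::
  "('k::field, 'u) dgm \<Rightarrow> ('k, 'u) dgm \<Rightarrow> ('k, 'u) gmap \<Rightarrow> ('k, 'u) roof set" where
  "DMor M N f = roof_class M N (M, gid, f)"

definition DR :: "(('k::field, 'u) dgm, 'k, ('k, 'u) roof set) lincat" where
  "DR = \<lparr> Obj = {M. dg_module M}, Hom = DHom, Comp = DComp, Ident = (\<lambda>M. DMor M M gid) \<rparr>"

definition Df :: "(('k::field, 'u) dgm, 'k, ('k, 'u) roof set) lincat" where
  "Df = full_subcategory DR finite_total_cohomology"

definition indecomposable_in ::
  "(('k::field, 'u) dgm, 'k, ('k, 'u) roof set) lincat \<Rightarrow> ('k, 'u) dgm \<Rightarrow> bool" where
  "indecomposable_in C Y \<longleftrightarrow> Y \<in> Obj C \<and> \<not> isomorphic_in C Y zero_dgm \<and>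
     (\<forall>A\<in>Obj C. \<forall>B\<in>Obj C. isomorphic_in C Y (dsum A B) \<longrightarrow>
        isomorphic_in C A zero_dgm \<or> isomorphic_in C B zero_dgm)"

text \<open>
  \<open>is_E n E\<close>: \<open>E\<close> is the homotopy colimit of a direct system \<open>\<Sigma>\<^sup>n X\<^sub>0 \<rightarrow> \<Sigma>\<^sup>n\<^sup>-\<^sup>1 X\<^sub>1 \<rightarrow> \<dots>\<close> of morphisms that
  are nonzero in \<open>D(R)\<close>. The \<open>X\<^sub>i\<close> are homotopically projective, so every morphism of \<open>D(R)\<close> between
  their suspensions is given by a homomorphism \<open>\<mu> i\<close> of DG modules; all choices of the system are
  allowed.
\<close>

definition is_E :: "int \<Rightarrow> ('k::field, 'u) dgm \<Rightarrow> bool" where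
  "is_E n E \<longleftrightarrow> (\<exists>\<mu>.
     (\<forall>i. dg_hom (susp (n - int i) (X i)) (susp (n - int i - 1) (X (i + 1))) (\<mu> i) \<and>
          DMor (susp (n - int i) (X i)) (susp (n - int i - 1) (X (i + 1))) (\<mu> i) \<noteq>
          DMor (susp (n - int i) (X i)) (susp (n - int i - 1) (X (i + 1))) (\<lambda>j x. 0)) \<and>
     E = hocolim (\<lambda>i. susp (n - int i) (X i)) \<mu>)"

definition Dbar_generators :: "('k::field, 'u) dgm set" where
  "Dbar_generators = {susp i (X n) | i n. True} \<union> {E. \<exists>m. is_E m E}"

definition Dbar :: "(('k::field, 'u) dgm, 'k, ('k, 'u) roof set) lincat" where
  "Dbar = full_subcategory DR (\<lambda>M. \<exists>N Gs. dg_module N \<and> set Gs \<subseteq> Dbar_generators \<and>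
     isomorphic_in DR (dsum M N) (dsum_list Gs))"

text \<open>The wedge based at \<open>\<Sigma>\<^sup>n X\<^sub>0\<close>, closed under isomorphism.\<close>

definition wedge :: "int \<Rightarrow> ('k::field, 'u) dgm set" where
  "wedge n = {Y. \<exists>j l. j \<le> l \<and> isomorphic_in DR Y (susp (n - int j) (X l))}"

end

theory Submission
  imports Defs
begin

text \<open>
  Morphisms of \<open>D(R)\<close> out of an h-projective module \<open>Z\<close> are homotopy classes of maps, so both Hom spaces can
  be computed with explicit models. All \<open>\<Sigma>\<^sup>a X\<^sub>l\<close> and all \<open>E\<^sub>n\<close> are isomorphic to semifree modules; moreover
  \<open>\<Sigma>\<^sup>a X\<^sub>l\<close> is quasi-isomorphic to the module with zero differential that is \<open>k\<close> in the degrees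
  \<open>-a-l, \<dots>, -a\<close>, and \<open>E\<^sub>n\<close> to the one that is \<open>k\<close> in all degrees \<open>\<ge> -n\<close>. Maps from a semifree module
  to such an interval module are given by scalars on the generators, and they span at most a line up to
  homotopy. An indecomposable \<open>Y\<close> is some \<open>\<Sigma>\<^sup>a X\<^sub>l\<close>, as a cohomology class of top degree generates a direct
  summand of \<open>Y\<close>. Both Hom spaces are nonzero exactly if \<open>a \<le> n + 1 \<le> a + l\<close>, which is the condition for \<open>Y\<close> to
  have cohomology in degree \<open>-n-1\<close>, that is, to lie in the wedge.
\<close>

section \<open>Maps of DG modules\<close>

text \<open>Roofs are compared only up to refinement, so that composites make sense has to come from
  both Ore conditions, and these from covers by shifted cones. Only then can an isomorphism in
  \<open>Df\<close> be used to recognise \<open>Y\<close>. The model of \<open>E\<close> has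
  infinitely many generators, but they fall into three levels, since each \<open>X j\<close> has two
  generators and the cone of id - shift doubles them; this makes it h-projective. The delicate half
  is Hom out of \<open>E\<close>. The generators \<open>Gr j\<close> of the model all lie in degree
  -n-2, and the values of a map to an interval module at \<open>Gr j\<close> and
  \<open>Gr (Suc j)\<close> differ by its value at \<open>Fe j\<close>, a generator of degree j-n-1.
  The interval is bounded above, so these values become constant, and the constant is the scalar
  that classifies the map; no limit over the system enters. For Hom into \<open>E\<close> the target
  is a half-line instead, and it is its being unbounded above that supplies the homotopies. The two
  conditions agree: the half-line of the suspended \<open>E\<close> starts at -n-1 and must start at
  most at -a but above -a-l-1, while the interval of the suspended \<open>Y\<close> is -a-l-1, ...,
  -a-1 and must contain -n-2.\<close>

lemma klinear_onD:
  assumes "klinear_on S f" "vec.subspace S"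
  shows "x \<in> S \<Longrightarrow> y \<in> S \<Longrightarrow> f (x + y) = f x + f y"
    and "x \<in> S \<Longrightarrow> f (vscale c x) = vscale c (f x)"
    and "f 0 = 0"
    and "x \<in> S \<Longrightarrow> f (- x) = - f x"
    and "x \<in> S \<Longrightarrow> y \<in> S \<Longrightarrow> f (x - y) = f x - f y"
proof -
  show add: "x \<in> S \<Longrightarrow> y \<in> S \<Longrightarrow> f (x + y) = f x + f y" for x y
    using assms by (simp add: klinear_on_def)
  show sc: "x \<in> S \<Longrightarrow> f (vscale c x) = vscale c (f x)" for x c
    using assms by (simp add: klinear_on_def)
  show "f 0 = 0"
    using sc[of 0 0] assms(2) by (simp add: vec.subspace_0)
  show neg: "x \<in> S \<Longrightarrow> f (- x) = - f x" for x
    using sc[of x "-1"] by simp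
  show "x \<in> S \<Longrightarrow> y \<in> S \<Longrightarrow> f (x - y) = f x - f y"
    using add[of x "- y"] neg[of y] vec.subspace_neg[OF assms(2), of y] by simp
qed

lemma klinear_on_sum:
  assumes "klinear_on S f" "vec.subspace S" "\<And>a. a \<in> A \<Longrightarrow> g a \<in> S"
  shows "f (\<Sum>a\<in>A. g a) = (\<Sum>a\<in>A. f (g a))"
  using assms(3)
proof (induction A rule: infinite_finite_induct)
  case (insert a A)
  have "f (\<Sum>a\<in>insert a A. g a) = f (g a + (\<Sum>a\<in>A. g a))"
    by (subst sum.insert[OF insert.hyps]) (rule refl)
  also have "\<dots> = f (g a) + f (\<Sum>a\<in>A. g a)"
    by (intro klinear_onD(1)[OF assms(1,2)] vec.subspace_sum[OF assms(2)]) (auto intro: insert.prems)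
  also have "f (\<Sum>a\<in>A. g a) = (\<Sum>a\<in>A. f (g a))"
    by (rule insert.IH) (auto intro: insert.prems)
  finally show ?case
    by (subst (2) sum.insert[OF insert.hyps])
qed (simp_all add: klinear_onD[OF assms(1,2)])

lemma monom_in_Rgr [simp, intro]: "monom c m \<in> Rgr (- int m)"
  by (simp add: Rgr_def)

lemma zero_in_Rgr [simp]: "0 \<in> Rgr j"
  by (auto simp: Rgr_def image_iff intro: exI[of _ 0])

lemma one_in_Rgr [simp]: "1 \<in> Rgr 0"
  using monom_in_Rgr[of 1 0] by (simp add: monom_0 one_pCons)

lemma RgrE:
  assumes "r \<in> Rgr j"
  obtains c m where "r = monom c m" "j = - int m" | "r = 0" "j > 0"
  using assms by (fastforce simp: Rgr_def split: if_splits)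

lemma dg_moduleD:
  assumes "dg_module M"
  shows gr_subspace: "vec.subspace (gr M i)"
    and dif_klinear: "klinear_on (gr M i) (dif M i)"
    and dif_in: "x \<in> gr M i \<Longrightarrow> dif M i x \<in> gr M (i + 1)"
    and dif_dif: "x \<in> gr M i \<Longrightarrow> dif M (i + 1) (dif M i x) = 0"
    and act_in: "x \<in> gr M i \<Longrightarrow> r \<in> Rgr j \<Longrightarrow> act M i x r \<in> gr M (i + j)"
    and act_klinear: "r \<in> Rgr j \<Longrightarrow> klinear_on (gr M i) (\<lambda>x. act M i x r)"
    and act_radd: "x \<in> gr M i \<Longrightarrow> r \<in> Rgr j \<Longrightarrow> s \<in> Rgr j \<Longrightarrow> act M i x (r + s) = act M i x r + act M i x s"
    and act_smult: "x \<in> gr M i \<Longrightarrow> r \<in> Rgr j \<Longrightarrow> act M i x (smult c r) = vscale c (act M i x r)"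
    and act_one: "x \<in> gr M i \<Longrightarrow> act M i x 1 = x"
    and act_mult: "x \<in> gr M i \<Longrightarrow> r \<in> Rgr j \<Longrightarrow> s \<in> Rgr l \<Longrightarrow> act M i x (r * s) = act M (i + j) (act M i x r) s"
    and dif_act: "x \<in> gr M i \<Longrightarrow> r \<in> Rgr j \<Longrightarrow> dif M (i + j) (act M i x r) = act M (i + 1) (dif M i x) r"
  using assms unfolding dg_module_def by simp_all

lemma act_monom:
  assumes "dg_module M" "x \<in> gr M i"
  shows "act M i x (monom c m) = vscale c (act M i x (monom 1 m))"
  using act_smult[OF assms monom_in_Rgr, of c 1 m] by (simp add: smult_monom)

lemma act_zero:
  assumes "dg_module M" "x \<in> gr M i"
  shows "act M i x 0 = 0"
  using act_smult[OF assms zero_in_Rgr, of 0] by simp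

lemma gr_closed [simp, intro]:
  assumes "dg_module M"
  shows "0 \<in> gr M i"
    and "x \<in> gr M i \<Longrightarrow> y \<in> gr M i \<Longrightarrow> x + y \<in> gr M i"
    and "x \<in> gr M i \<Longrightarrow> y \<in> gr M i \<Longrightarrow> x - y \<in> gr M i"
    and "x \<in> gr M i \<Longrightarrow> - x \<in> gr M i"
    and "x \<in> gr M i \<Longrightarrow> vscale c x \<in> gr M i"
  using gr_subspace[OF assms, of i]
  by (auto intro: vec.subspace_0 vec.subspace_add vec.subspace_diff vec.subspace_neg vec.subspace_scale)

lemma dif_in':
  assumes "dg_module M" "x \<in> gr M i" "j = i + 1"
  shows "dif M i x \<in> gr M j"
  using dif_in[OF assms(1,2)] assms(3) by simp

lemma dif_in_pred: "dg_module M \<Longrightarrow> x \<in> gr M (i - 1) \<Longrightarrow> dif M (i - 1) x \<in> gr M i"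
  by (rule dif_in') simp_all

lemma dif_dif':
  assumes "dg_module M" "x \<in> gr M i" "j = i + 1"
  shows "dif M j (dif M i x) = 0"
  using dif_dif[OF assms(1,2)] assms(3) by simp

lemma act_in':
  assumes "dg_module M" "x \<in> gr M i" "r \<in> Rgr j" "l = i + j"
  shows "act M i x r \<in> gr M l"
  using act_in[OF assms(1-3)] assms(4) by simp

lemmas dif_simps = klinear_onD[OF dif_klinear gr_subspace]
lemmas act_simps = klinear_onD[OF act_klinear gr_subspace]

text \<open>One notion of \<open>R\<close>-linear map covers DG homomorphisms (degree 0), homotopies
  (degree -1) and the differential itself (degree 1). No signs enter, because \<open>R\<close> acts
  on the right.\<close>

definition ghom :: "int \<Rightarrow> ('k::field, 'u) dgm \<Rightarrow> ('k, 'u) dgm \<Rightarrow> ('k, 'u) gmap \<Rightarrow> bool" where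
  "ghom s M N f \<longleftrightarrow>
     (\<forall>i. klinear_on (gr M i) (f i)) \<and>
     (\<forall>i. \<forall>x\<in>gr M i. f i x \<in> gr N (i + s)) \<and>
     (\<forall>i j. \<forall>x\<in>gr M i. \<forall>r\<in>Rgr j. f (i + j) (act M i x r) = act N (i + s) (f i x) r)"

lemma ghomD:
  assumes "ghom s M N f"
  shows ghom_klinear: "klinear_on (gr M i) (f i)"
    and ghom_in: "x \<in> gr M i \<Longrightarrow> f i x \<in> gr N (i + s)"
    and ghom_act: "x \<in> gr M i \<Longrightarrow> r \<in> Rgr j \<Longrightarrow> f (i + j) (act M i x r) = act N (i + s) (f i x) r"
  using assms unfolding ghom_def by blast+

lemmas ghom_simps = klinear_onD[OF ghom_klinear gr_subspace]

text \<open>Every homogeneous element of \<open>R\<close> is a scalar multiple of a power of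
  \<open>T\<close>, and linearity takes care of the scalar.\<close>

lemma ghomI:
  assumes M: "dg_module M" and N: "dg_module N"
    and lin: "\<And>i. klinear_on (gr M i) (f i)"
    and deg: "\<And>i x. x \<in> gr M i \<Longrightarrow> f i x \<in> gr N (i + s)"
    and act: "\<And>i m x. x \<in> gr M i \<Longrightarrow> f (i - int m) (act M i x (monom 1 m)) = act N (i + s) (f i x) (monom 1 m)"
  shows "ghom s M N f"
  unfolding ghom_def
proof (intro conjI allI ballI lin)
  show "f i x \<in> gr N (i + s)" if "x \<in> gr M i" for i x
    using deg that .
  show "f (i + j) (act M i x r) = act N (i + s) (f i x) r" if x: "x \<in> gr M i" and r: "r \<in> Rgr j" for i j x r
    using r
  proof (cases rule: RgrE)
    case (1 c m)
    have "act M i x (monom 1 m) \<in> gr M (i - int m)"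
      using act_in[OF M x monom_in_Rgr[of 1 m]] by simp
    then show ?thesis
      using 1 x act by (simp add: act_monom[OF M x, of c] act_monom[OF N deg, of _ _ c]
          klinear_onD[OF lin gr_subspace[OF M]])
  next
    case 2
    then show ?thesis
      using x by (simp add: act_zero[OF M] act_zero[OF N] deg klinear_onD[OF lin gr_subspace[OF M]])
  qed
qed

lemma dg_hom_iff_ghom:
  "dg_hom M N f \<longleftrightarrow> ghom 0 M N f \<and> (\<forall>i. \<forall>x\<in>gr M i. f (i + 1) (dif M i x) = dif N i (f i x))"
  unfolding dg_hom_def ghom_def by simp

lemma homotopic_iff_ghom:
  "homotopic M N f g \<longleftrightarrow> (\<exists>h. ghom (- 1) M N h \<and>
     (\<forall>i. \<forall>x\<in>gr M i. f i x - g i x = dif N (i - 1) (h i x) + h (i + 1) (dif M i x)))"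
  unfolding homotopic_def ghom_def by (simp add: conj_assoc)

lemma dg_homD:
  assumes "dg_hom M N f"
  shows dg_hom_ghom: "ghom 0 M N f"
    and dg_hom_klinear: "klinear_on (gr M i) (f i)"
    and dg_hom_in: "x \<in> gr M i \<Longrightarrow> f i x \<in> gr N i"
    and dg_hom_act: "x \<in> gr M i \<Longrightarrow> r \<in> Rgr j \<Longrightarrow> f (i + j) (act M i x r) = act N i (f i x) r"
    and dg_hom_dif: "x \<in> gr M i \<Longrightarrow> f (i + 1) (dif M i x) = dif N i (f i x)"
  using assms unfolding dg_hom_iff_ghom ghom_def by auto

lemmas dg_hom_simps = klinear_onD[OF dg_hom_klinear gr_subspace]

lemma dg_hom_dif_pred:
  assumes "dg_hom M N f" "x \<in> gr M (i - 1)"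
  shows "f i (dif M (i - 1) x) = dif N (i - 1) (f (i - 1) x)"
  using dg_hom_dif[OF assms] by simp

lemma klinear_on_comp:
  assumes "klinear_on S f" "klinear_on S' g" "\<And>x. x \<in> S \<Longrightarrow> f x \<in> S'"
  shows "klinear_on S (\<lambda>x. g (f x))"
  using assms unfolding klinear_on_def by simp

lemma klinear_on_add:
  "klinear_on S f \<Longrightarrow> klinear_on S g \<Longrightarrow> klinear_on S (\<lambda>x. f x + g x)"
  unfolding klinear_on_def by (simp add: vec.scale_right_distrib)

lemma klinear_on_scale:
  "klinear_on S f \<Longrightarrow> klinear_on S (\<lambda>x. vscale c (f x))"
  unfolding klinear_on_def by (simp add: vec.scale_right_distrib vec.scale_left_commute)

lemma klinear_on_zero: "klinear_on S (\<lambda>x. 0)"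
  unfolding klinear_on_def by simp

lemma ghom_comp:
  assumes "ghom s M N f" "ghom t N K g"
  shows "ghom (s + t) M K (\<lambda>i x. g (i + s) (f i x))"
  unfolding ghom_def
proof (intro conjI allI ballI)
  show "klinear_on (gr M i) (\<lambda>x. g (i + s) (f i x))" for i
    by (rule klinear_on_comp[OF ghom_klinear[OF assms(1)] ghom_klinear[OF assms(2)] ghom_in[OF assms(1)]])
  show "g (i + s) (f i x) \<in> gr K (i + (s + t))" if "x \<in> gr M i" for i x
    using ghom_in[OF assms(2) ghom_in[OF assms(1) that]] by (simp add: add.assoc)
  show "g (i + j + s) (f (i + j) (act M i x r)) = act K (i + (s + t)) (g (i + s) (f i x)) r"
    if "x \<in> gr M i" "r \<in> Rgr j" for i j x r
  proof -
    have "g (i + j + s) (f (i + j) (act M i x r)) = g (i + s + j) (act N (i + s) (f i x) r)"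
      by (simp only: ghom_act[OF assms(1) that] add.assoc add.commute[of j s])
    also have "\<dots> = act K (i + s + t) (g (i + s) (f i x)) r"
      by (rule ghom_act[OF assms(2) ghom_in[OF assms(1) that(1)] that(2)])
    finally show ?thesis
      by (simp only: add.assoc)
  qed
qed

lemma ghom_add:
  assumes "dg_module N" "ghom s M N f" "ghom s M N g"
  shows "ghom s M N (\<lambda>i x. f i x + g i x)"
  using assms unfolding ghom_def
  by (auto simp: klinear_on_add act_simps)

lemma ghom_scale:
  assumes "dg_module N" "ghom s M N f"
  shows "ghom s M N (\<lambda>i x. vscale c (f i x))"
  using assms unfolding ghom_def
  by (auto simp: klinear_on_scale act_simps)

lemma ghom_zero:
  assumes "dg_module N"
  shows "ghom s M N (\<lambda>i x. 0)"
  using assms unfolding ghom_def by (auto simp: klinear_on_zero act_simps)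

lemma ghom_uminus:
  assumes "dg_module N" "ghom s M N f"
  shows "ghom s M N (\<lambda>i x. - f i x)"
  using ghom_scale[OF assms, of "-1"] by simp

lemma ghom_diff:
  assumes "dg_module N" "ghom s M N f" "ghom s M N g"
  shows "ghom s M N (\<lambda>i x. f i x - g i x)"
  using ghom_add[OF assms(1,2) ghom_uminus[OF assms(1,3)]] by simp

lemma dg_hom_comp:
  assumes "dg_hom M N f" "dg_hom N K g"
  shows "dg_hom M K (gcomp g f)"
  using assms ghom_comp[of 0 M N f 0 K g] unfolding dg_hom_iff_ghom gcomp_def
  by (simp add: dg_hom_in[OF assms(1)])

lemma dg_hom_id: "dg_hom M M gid"
  by (simp add: dg_hom_def gid_def klinear_on_def)

lemma dg_hom_add:
  assumes "dg_module M" "dg_module N" "dg_hom M N f" "dg_hom M N g"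
  shows "dg_hom M N (\<lambda>i x. f i x + g i x)"
  using assms unfolding dg_hom_iff_ghom
  by (auto simp: ghom_add dif_simps ghomD[of 0, simplified])

lemma dg_hom_scale:
  assumes "dg_module M" "dg_module N" "dg_hom M N f"
  shows "dg_hom M N (\<lambda>i x. vscale c (f i x))"
  using assms unfolding dg_hom_iff_ghom
  by (auto simp: ghom_scale dif_simps ghomD[of 0, simplified])

lemma dg_hom_zero:
  assumes "dg_module N"
  shows "dg_hom M N (\<lambda>i x. 0)"
  using assms unfolding dg_hom_iff_ghom by (auto simp: ghom_zero dif_simps)

lemma dg_hom_diff:
  assumes "dg_module M" "dg_module N" "dg_hom M N f" "dg_hom M N g"
  shows "dg_hom M N (\<lambda>i x. f i x - g i x)"
  using dg_hom_add[OF assms(1-3) dg_hom_scale[OF assms(1,2,4), of "-1"]] by simp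

lemma gcomp_id [simp]: "gcomp f gid = f" "gcomp gid f = f"
  by (simp_all add: gcomp_def gid_def)

lemma gcomp_assoc: "gcomp (gcomp h g) f = gcomp h (gcomp g f)"
  by (simp add: gcomp_def)


section \<open>Homotopy\<close>

lemma homotopicI:
  assumes "ghom (- 1) M N h"
    and "\<And>i x. x \<in> gr M i \<Longrightarrow> f i x - g i x = dif N (i - 1) (h i x) + h (i + 1) (dif M i x)"
  shows "homotopic M N f g"
  using assms homotopic_iff_ghom by blast

lemma homotopicE:
  assumes "homotopic M N f g"
  obtains h where "ghom (- 1) M N h"
    and "\<And>i x. x \<in> gr M i \<Longrightarrow> f i x - g i x = dif N (i - 1) (h i x) + h (i + 1) (dif M i x)"
  using assms homotopic_iff_ghom by blast

lemma homotopic_refl: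
  assumes "dg_module N"
  shows "homotopic M N f f"
  by (rule homotopicI[OF ghom_zero[OF assms]]) (simp add: dif_simps[OF assms assms])

text \<open>Maps are total functions whose values outside the graded pieces are arbitrary. Two
  functions for the same DG map are therefore related by the zero homotopy rather than by
  equality.\<close>

lemma homotopic_cong:
  assumes "dg_module N" "\<And>i x. x \<in> gr M i \<Longrightarrow> f i x = g i x"
  shows "homotopic M N f g"
  by (rule homotopicI[OF ghom_zero[OF assms(1)]])
    (simp add: dif_simps[OF assms(1) assms(1)] assms(2))

lemma homotopic_add:
  assumes M: "dg_module M" and N: "dg_module N"
    and "homotopic M N f g" "homotopic M N f' g'"
  shows "homotopic M N (\<lambda>i x. f i x + f' i x) (\<lambda>i x. g i x + g' i x)"
proof -
  obtain h where h: "ghom (- 1) M N h"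
    "\<And>i x. x \<in> gr M i \<Longrightarrow> f i x - g i x = dif N (i - 1) (h i x) + h (i + 1) (dif M i x)"
    using assms(3) by (rule homotopicE) blast
  obtain h' where h': "ghom (- 1) M N h'"
    "\<And>i x. x \<in> gr M i \<Longrightarrow> f' i x - g' i x = dif N (i - 1) (h' i x) + h' (i + 1) (dif M i x)"
    using assms(4) by (rule homotopicE) blast
  show ?thesis
  proof (rule homotopicI[OF ghom_add[OF N h(1) h'(1)]])
    fix i x assume x: "x \<in> gr M i"
    then have "h i x \<in> gr N (i - 1)" "h' i x \<in> gr N (i - 1)"
      using ghom_in[OF h(1) x] ghom_in[OF h'(1) x] by simp_all
    then show "f i x + f' i x - (g i x + g' i x) =
      dif N (i - 1) (h i x + h' i x) + (h (i + 1) (dif M i x) + h' (i + 1) (dif M i x))"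
      using h(2)[OF x] h'(2)[OF x] by (simp add: dif_simps[OF N N] algebra_simps)
  qed
qed

lemma homotopic_scale:
  assumes M: "dg_module M" and N: "dg_module N" and "homotopic M N f g"
  shows "homotopic M N (\<lambda>i x. vscale c (f i x)) (\<lambda>i x. vscale c (g i x))"
proof -
  obtain h where h: "ghom (- 1) M N h"
    "\<And>i x. x \<in> gr M i \<Longrightarrow> f i x - g i x = dif N (i - 1) (h i x) + h (i + 1) (dif M i x)"
    using assms(3) by (rule homotopicE) blast
  show ?thesis
  proof (rule homotopicI[OF ghom_scale[OF N h(1)]])
    fix i x assume x: "x \<in> gr M i"
    then have "h i x \<in> gr N (i - 1)"
      using ghom_in[OF h(1) x] by simp
    then show "vscale c (f i x) - vscale c (g i x) =
      dif N (i - 1) (vscale c (h i x)) + vscale c (h (i + 1) (dif M i x))"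
      using h(2)[OF x] by (simp add: dif_simps[OF N N] flip: vec.scale_right_distrib vec.scale_right_diff_distrib)
  qed
qed

text \<open>Homotopy depends only on the difference of the maps, so symmetry and transitivity reduce
  to scaling and adding homotopies.\<close>

lemma homotopic_diff_zero_iff:
  assumes "dg_module M" "dg_module N"
  shows "homotopic M N (\<lambda>i x. f i x - g i x) (\<lambda>i x. 0) \<longleftrightarrow> homotopic M N f g"
  unfolding homotopic_iff_ghom by simp

lemma homotopic_sym:
  assumes "dg_module M" "dg_module N" "homotopic M N f g"
  shows "homotopic M N g f"
  using homotopic_scale[OF assms(1,2) homotopic_diff_zero_iff[THEN iffD2, OF assms], of "-1"]
    homotopic_diff_zero_iff[OF assms(1,2), of g f] by (simp add: algebra_simps)

lemma homotopic_trans: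
  assumes "dg_module M" "dg_module N" "homotopic M N f g" "homotopic M N g h"
  shows "homotopic M N f h"
  using homotopic_add[OF assms(1,2) homotopic_diff_zero_iff[THEN iffD2, OF assms(1-3)]
      homotopic_diff_zero_iff[THEN iffD2, OF assms(1,2,4)]]
    homotopic_diff_zero_iff[OF assms(1,2), of f h] by simp

lemma homotopic_comp_right:
  assumes "homotopic N K f g" "dg_hom M N u"
  shows "homotopic M K (gcomp f u) (gcomp g u)"
proof -
  obtain h where h: "ghom (- 1) N K h"
    "\<And>i x. x \<in> gr N i \<Longrightarrow> f i x - g i x = dif K (i - 1) (h i x) + h (i + 1) (dif N i x)"
    using assms(1) by (rule homotopicE) blast
  have "ghom (- 1) M K (\<lambda>i x. h i (u i x))"
    using ghom_comp[OF dg_hom_ghom[OF assms(2)] h(1)] by simp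
  then show ?thesis
    by (rule homotopicI) (simp add: gcomp_def h(2) dg_homD[OF assms(2)])
qed

text \<open>The map \<open>v\<close> is linear only on the pieces of \<open>N\<close>; the
  assumptions on \<open>f\<close> and \<open>g\<close> place their values there, so that
  \<open>v\<close> can be distributed over the homotopy identity.\<close>

lemma homotopic_comp_left:
  assumes N: "dg_module N" and M: "dg_module M"
    and "homotopic M N f g" "dg_hom M N f" "dg_hom M N g" "dg_hom N K v"
  shows "homotopic M K (gcomp v f) (gcomp v g)"
proof -
  obtain h where h: "ghom (- 1) M N h"
    "\<And>i x. x \<in> gr M i \<Longrightarrow> f i x - g i x = dif N (i - 1) (h i x) + h (i + 1) (dif M i x)"
    using assms(3) by (rule homotopicE) blast
  have "ghom (- 1) M K (\<lambda>i x. v (i - 1) (h i x))"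
    using ghom_comp[OF h(1) dg_hom_ghom[OF assms(6)]] by simp
  then show ?thesis
  proof (rule homotopicI)
    fix i x assume x: "x \<in> gr M i"
    have hx: "h i x \<in> gr N (i - 1)" "h (i + 1) (dif M i x) \<in> gr N i"
      using ghom_in[OF h(1) x] ghom_in[OF h(1) dif_in[OF M x]] by simp_all
    have "v i (f i x) - v i (g i x) = v i (f i x - g i x)"
      using dg_hom_in[OF assms(4) x] dg_hom_in[OF assms(5) x] by (simp add: dg_hom_simps[OF assms(6) N])
    also have "\<dots> = v i (dif N (i - 1) (h i x)) + v i (h (i + 1) (dif M i x))"
      using hx dif_in_pred[OF N hx(1)] by (simp add: h(2)[OF x] dg_hom_simps[OF assms(6) N])
    also have "v i (dif N (i - 1) (h i x)) = dif K (i - 1) (v (i - 1) (h i x))"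
      by (rule dg_hom_dif_pred[OF assms(6) hx(1)])
    finally show "gcomp v f i x - gcomp v g i x =
      dif K (i - 1) (v (i - 1) (h i x)) + v (i + 1 - 1) (h (i + 1) (dif M i x))"
      by (simp only: gcomp_def add_diff_cancel_right')
  qed
qed


section \<open>Cohomology and quasi-isomorphisms\<close>

lemma subspace_cocycles: "dg_module M \<Longrightarrow> vec.subspace (cocycles M i)"
  unfolding vec.subspace_def cocycles_def by (auto simp: dif_simps)

lemma subspace_coboundaries:
  assumes "dg_module M"
  shows "vec.subspace (coboundaries M i)"
  unfolding coboundaries_def
proof (rule vec.subspaceI)
  show "0 \<in> dif M (i - 1) ` gr M (i - 1)"
    using assms by (intro image_eqI[of _ _ 0]) (simp_all add: dif_simps)
  show "x + y \<in> dif M (i - 1) ` gr M (i - 1)"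
    if xy: "x \<in> dif M (i - 1) ` gr M (i - 1)" "y \<in> dif M (i - 1) ` gr M (i - 1)" for x y
  proof -
    obtain a b where "a \<in> gr M (i - 1)" "b \<in> gr M (i - 1)" "x = dif M (i - 1) a" "y = dif M (i - 1) b"
      using xy by blast
    then show ?thesis
      using assms by (intro image_eqI[of _ _ "a + b"]) (simp_all add: dif_simps[OF assms assms])
  qed
  show "vscale c x \<in> dif M (i - 1) ` gr M (i - 1)" if x: "x \<in> dif M (i - 1) ` gr M (i - 1)" for c x
  proof -
    obtain a where "a \<in> gr M (i - 1)" "x = dif M (i - 1) a"
      using x by blast
    then show ?thesis
      using assms by (intro image_eqI[of _ _ "vscale c a"]) (simp_all add: dif_simps[OF assms assms])
  qed
qed

lemma coboundariesI: "x \<in> gr M (i - 1) \<Longrightarrow> y = dif M (i - 1) x \<Longrightarrow> y \<in> coboundaries M i"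
  unfolding coboundaries_def by blast

lemma coboundaries_cocycles:
  assumes "dg_module M"
  shows "coboundaries M i \<subseteq> cocycles M i"
  using assms by (auto simp: coboundaries_def cocycles_def dif_in_pred dif_dif')

lemmas cob_simps = vec.subspace_0[OF subspace_coboundaries] vec.subspace_add[OF subspace_coboundaries]
  vec.subspace_diff[OF subspace_coboundaries] vec.subspace_neg[OF subspace_coboundaries]
  vec.subspace_scale[OF subspace_coboundaries]

lemmas coc_simps = vec.subspace_0[OF subspace_cocycles] vec.subspace_add[OF subspace_cocycles]
  vec.subspace_diff[OF subspace_cocycles] vec.subspace_neg[OF subspace_cocycles]
  vec.subspace_scale[OF subspace_cocycles]

lemma coc_in_gr: "x \<in> cocycles M i \<Longrightarrow> x \<in> gr M i"
  by (simp add: cocycles_def)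

lemma dg_hom_cocycle:
  assumes "dg_module M" "dg_module N" "dg_hom M N f" "x \<in> cocycles M i"
  shows "f i x \<in> cocycles N i"
  using assms dg_hom_dif[OF assms(3), of x i]
  by (auto simp: cocycles_def dg_hom_in dg_hom_simps[OF assms(3,1)])

lemma dg_hom_coboundary:
  assumes "dg_hom M N f" "x \<in> coboundaries M i"
  shows "f i x \<in> coboundaries N i"
  using assms by (auto simp: coboundaries_def dg_hom_dif_pred dg_hom_in)

lemma homotopic_cohomologous:
  assumes "dg_module M" "homotopic M N f g" "x \<in> cocycles M i"
  shows "f i x - g i x \<in> coboundaries N i"
proof -
  obtain h where h: "ghom (- 1) M N h"
    "\<And>i x. x \<in> gr M i \<Longrightarrow> f i x - g i x = dif N (i - 1) (h i x) + h (i + 1) (dif M i x)"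
    using assms(2) by (rule homotopicE) blast
  have x: "x \<in> gr M i" "dif M i x = 0"
    using assms(3) by (simp_all add: cocycles_def)
  have "f i x - g i x = dif N (i - 1) (h i x)"
    using h(2)[OF x(1)] x(2) ghom_simps(3)[OF h(1) assms(1)] by simp
  moreover have "h i x \<in> gr N (i - 1)"
    using ghom_in[OF h(1) x(1)] by simp
  ultimately show ?thesis
    by (auto simp: coboundaries_def)
qed

lemma quasi_isoD:
  assumes "quasi_iso M N f"
  shows quasi_iso_dg_hom: "dg_hom M N f"
    and quasi_iso_inj: "x \<in> cocycles M i \<Longrightarrow> f i x \<in> coboundaries N i \<Longrightarrow> x \<in> coboundaries M i"
    and quasi_iso_surj: "y \<in> cocycles N i \<Longrightarrow> \<exists>x\<in>cocycles M i. f i x - y \<in> coboundaries N i"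
  using assms unfolding quasi_iso_def by blast+

text \<open>On cocycles the two maps differ by coboundaries, so they agree on cohomology.\<close>

lemma quasi_iso_homotopic:
  assumes M: "dg_module M" and N: "dg_module N"
    and "quasi_iso M N f" "homotopic M N f g" "dg_hom M N g"
  shows "quasi_iso M N g"
proof -
  have fg: "f i x - g i x \<in> coboundaries N i" if "x \<in> cocycles M i" for i x
    using homotopic_cohomologous[OF M assms(4) that] .
  show ?thesis
    unfolding quasi_iso_def
  proof (intro conjI allI ballI impI assms(5))
    fix i x assume x: "x \<in> cocycles M i" "g i x \<in> coboundaries N i"
    have "f i x \<in> coboundaries N i"
      using cob_simps(2)[OF N fg[OF x(1)] x(2)] by simp
    then show "x \<in> coboundaries M i"
      using quasi_iso_inj[OF assms(3) x(1)] by blast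
  next
    fix i y assume "y \<in> cocycles N i"
    then obtain x where x: "x \<in> cocycles M i" "f i x - y \<in> coboundaries N i"
      using quasi_iso_surj[OF assms(3)] by blast
    have "g i x - y \<in> coboundaries N i"
      using cob_simps(3)[OF N x(2) fg[OF x(1)]] by simp
    then show "\<exists>x\<in>cocycles M i. g i x - y \<in> coboundaries N i"
      using x by blast
  qed
qed

lemma quasi_iso_comp:
  assumes M: "dg_module M" and N: "dg_module N" and K: "dg_module K"
    and f: "quasi_iso M N f" and g: "quasi_iso N K g"
  shows "quasi_iso M K (gcomp g f)"
  unfolding quasi_iso_def
proof (intro conjI allI ballI impI)
  note fd = quasi_iso_dg_hom[OF f] and gd = quasi_iso_dg_hom[OF g]
  show "dg_hom M K (gcomp g f)"
    using dg_hom_comp[OF fd gd] .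
  show "x \<in> coboundaries M i" if "x \<in> cocycles M i" "gcomp g f i x \<in> coboundaries K i" for i x
    using that quasi_iso_inj[OF f, of x i] quasi_iso_inj[OF g, of "f i x" i] dg_hom_cocycle[OF M N fd]
    by (simp add: gcomp_def)
  fix i y assume "y \<in> cocycles K i"
  then obtain z where z: "z \<in> cocycles N i" "g i z - y \<in> coboundaries K i"
    using quasi_iso_surj[OF g] by blast
  obtain x where x: "x \<in> cocycles M i" "f i x - z \<in> coboundaries N i"
    using quasi_iso_surj[OF f z(1)] by blast
  have "g i (f i x - z) \<in> coboundaries K i"
    by (rule dg_hom_coboundary[OF gd x(2)])
  then have "g i (f i x) - g i z \<in> coboundaries K i"
    using x z by (simp add: dg_hom_simps[OF gd N] coc_in_gr dg_hom_in[OF fd])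
  then have "g i (f i x) - y \<in> coboundaries K i"
    using cob_simps(2)[OF K _ z(2)] by fastforce
  then show "\<exists>x\<in>cocycles M i. gcomp g f i x - y \<in> coboundaries K i"
    using x by (auto simp: gcomp_def)
qed

text \<open>A case of two-out-of-three. It shows that a refinement of a roof is joined to the apex
  of that roof by a quasi-isomorphism, as the Ore squares require.\<close>

lemma quasi_iso_cancel_left:
  assumes M: "dg_module M" and N: "dg_module N" and K: "dg_module K"
    and f: "dg_hom M N f" and g: "quasi_iso N K g" and gf: "quasi_iso M K (gcomp g f)"
  shows "quasi_iso M N f"
  unfolding quasi_iso_def
proof (intro conjI allI ballI impI f)
  note gd = quasi_iso_dg_hom[OF g]
  show "x \<in> coboundaries M i" if "x \<in> cocycles M i" "f i x \<in> coboundaries N i" for i x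
    using that quasi_iso_inj[OF gf, of x i] dg_hom_coboundary[OF gd]
    by (simp add: gcomp_def)
  fix i y assume y: "y \<in> cocycles N i"
  then have "g i y \<in> cocycles K i"
    by (rule dg_hom_cocycle[OF N K gd])
  then obtain x where x: "x \<in> cocycles M i" "g i (f i x) - g i y \<in> coboundaries K i"
    using quasi_iso_surj[OF gf] by (auto simp: gcomp_def)
  have fx: "f i x \<in> cocycles N i"
    by (rule dg_hom_cocycle[OF M N f x(1)])
  have "g i (f i x - y) \<in> coboundaries K i"
    using x y fx by (simp add: dg_hom_simps[OF gd N] coc_in_gr)
  then have "f i x - y \<in> coboundaries N i"
    using quasi_iso_inj[OF g] coc_simps(3)[OF N fx y] by blast
  then show "\<exists>x\<in>cocycles M i. f i x - y \<in> coboundaries N i"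
    using x by blast
qed

lemma quasi_iso_id: "dg_module M \<Longrightarrow> quasi_iso M M gid"
  unfolding quasi_iso_def using dg_hom_id[of M]
  by (metis gid_def cob_simps(1) diff_self)

lemma quasi_isoI_bij:
  assumes M: "dg_module M" and f: "dg_hom M N f"
    and bij: "\<And>i. bij_betw (f i) (gr M i) (gr N i)"
    and N: "dg_module N"
  shows "quasi_iso M N f"
  unfolding quasi_iso_def
proof (intro conjI allI ballI impI f)
  have inj: "inj_on (f i) (gr M i)" and im: "f i ` gr M i = gr N i" for i
    using bij by (simp_all add: bij_betw_def)
  fix i x assume x: "x \<in> cocycles M i" "f i x \<in> coboundaries N i"
  then obtain w where w: "w \<in> gr N (i - 1)" "f i x = dif N (i - 1) w"
    by (auto simp: coboundaries_def)
  then obtain v where v: "v \<in> gr M (i - 1)" "w = f (i - 1) v"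
    using im by blast
  have "f i x = f i (dif M (i - 1) v)"
    using w v dg_hom_dif_pred[OF f v(1)] by simp
  then have "x = dif M (i - 1) v"
    using inj_onD[OF inj] coc_in_gr[OF x(1)] dif_in_pred[OF M v(1)] by blast
  then show "x \<in> coboundaries M i"
    using v by (auto simp: coboundaries_def)
next
  have inj: "inj_on (f i) (gr M i)" and im: "f i ` gr M i = gr N i" for i
    using bij by (simp_all add: bij_betw_def)
  fix i y assume y: "y \<in> cocycles N i"
  then obtain x where x: "x \<in> gr M i" "y = f i x"
    using im coc_in_gr by blast
  have "f (i + 1) (dif M i x) = f (i + 1) 0"
    using y x dg_hom_dif[OF f x(1)] by (simp add: cocycles_def dg_hom_simps[OF f M])
  then have "dif M i x = 0"
    using inj_onD[OF inj] dif_in[OF M x(1)] gr_closed(1)[OF M] by blast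
  then show "\<exists>x\<in>cocycles M i. f i x - y \<in> coboundaries N i"
    using x N by (intro bexI[of _ x]) (auto simp: cocycles_def cob_simps)
qed

section \<open>Cones and suspensions\<close>

lemma pair_sel [simp]: "pfst (pair v w) = v" "psnd (pair v w) = w"
  by (simp_all add: pair_def pfst_def psnd_def fun_eq_iff)

lemma pair_collapse [simp]: "pair (pfst v) (psnd v) = v"
  by (auto simp: pair_def pfst_def psnd_def fun_eq_iff)

lemma pair_eq_iff [simp]: "pair v w = pair v' w' \<longleftrightarrow> v = v' \<and> w = w'"
  by (metis pair_sel)

lemma pair_arith:
  "pair v w + pair v' w' = pair (v + v') (w + w')"
  "pair v w - pair v' w' = pair (v - v') (w - w')"
  "- pair v w = pair (- v) (- w)"
  "vscale c (pair v w) = pair (vscale c v) (vscale c w)"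
  "pair 0 0 = 0"
  by (auto simp: pair_def vscale_def fun_eq_iff)

lemma pair_eq_zero_iff [simp]: "pair v w = 0 \<longleftrightarrow> v = 0 \<and> w = 0"
  by (metis pair_arith(5) pair_eq_iff)

lemma proj_arith:
  "pfst (v + w) = pfst v + pfst w" "psnd (v + w) = psnd v + psnd w"
  "pfst (v - w) = pfst v - pfst w" "psnd (v - w) = psnd v - psnd w"
  "pfst (- v) = - pfst v" "psnd (- v) = - psnd v"
  "pfst (vscale c v) = vscale c (pfst v)" "psnd (vscale c v) = vscale c (psnd v)"
  "pfst 0 = 0" "psnd 0 = 0"
  by (auto simp: pfst_def psnd_def vscale_def fun_eq_iff)

lemma vec_eq_pairI: "pfst v = pfst w \<Longrightarrow> psnd v = psnd w \<Longrightarrow> v = w"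
  by (metis pair_collapse)

section \<open>Suspensions, cones and direct sums as DG modules\<close>

lemma susp_sel:
  "gr (susp a M) i = gr M (i + a)"
  "dif (susp a M) i x = (if even a then dif M (i + a) x else - dif M (i + a) x)"
  "act (susp a M) i = act M (i + a)"
  by (simp_all add: susp_def)

lemma cone_sel:
  "v \<in> gr (cone M N f) i \<longleftrightarrow> pfst v \<in> gr M (i + 1) \<and> psnd v \<in> gr N i"
  "dif (cone M N f) i v = pair (- dif M (i + 1) (pfst v)) (f (i + 1) (pfst v) + dif N i (psnd v))"
  "act (cone M N f) i v r = pair (act M (i + 1) (pfst v) r) (act N i (psnd v) r)"
  by (auto simp: cone_def) (metis pair_collapse)

lemma dsum_sel:
  "v \<in> gr (dsum M N) i \<longleftrightarrow> pfst v \<in> gr M i \<and> psnd v \<in> gr N i"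
  "dif (dsum M N) i v = pair (dif M i (pfst v)) (dif N i (psnd v))"
  "act (dsum M N) i v r = pair (act M i (pfst v) r) (act N i (psnd v) r)"
  by (auto simp: dsum_def) (metis pair_collapse)

lemma dg_module_susp:
  assumes M: "dg_module M"
  shows "dg_module (susp a M)"
  unfolding dg_module_def
proof (intro conjI allI ballI)
  have sh: "i + 1 + a = (i + a) + 1" "i + j + a = (i + a) + j" for i j :: int
    by simp_all
  show "vec.subspace (gr (susp a M) i)" for i
    unfolding susp_sel by (rule gr_subspace[OF M])
  show "klinear_on (gr (susp a M) i) (dif (susp a M) i)" for i
    unfolding klinear_on_def by (auto simp: susp_sel dif_simps[OF M M])
  show "dif (susp a M) i x \<in> gr (susp a M) (i + 1)" if "x \<in> gr (susp a M) i" for i x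
    using that dif_in[OF M, of x "i + a"] by (auto simp: susp_sel sh M)
  show "dif (susp a M) (i + 1) (dif (susp a M) i x) = 0" if "x \<in> gr (susp a M) i" for i x
    using that dif_in[OF M, of x "i + a"] dif_dif[OF M, of x "i + a"]
    by (simp add: susp_sel sh dif_simps[OF M M])
  show "act (susp a M) i x r \<in> gr (susp a M) (i + j)" if "x \<in> gr (susp a M) i" "r \<in> Rgr j" for i j x r
    using that unfolding sh susp_sel by (rule act_in[OF M])
  show "klinear_on (gr (susp a M) i) (\<lambda>x. act (susp a M) i x r)" if "r \<in> Rgr j" for i j r
    unfolding susp_sel using act_klinear[OF M that] .
  show "act (susp a M) i x (r + s) = act (susp a M) i x r + act (susp a M) i x s"
    if "x \<in> gr (susp a M) i" "r \<in> Rgr j" "s \<in> Rgr j" for i j x r s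
    using that unfolding susp_sel by (rule act_radd[OF M])
  show "act (susp a M) i x (smult c r) = vscale c (act (susp a M) i x r)"
    if "x \<in> gr (susp a M) i" "r \<in> Rgr j" for i j c x r
    using that unfolding susp_sel by (rule act_smult[OF M])
  show "act (susp a M) i x 1 = x" if "x \<in> gr (susp a M) i" for i x
    using that unfolding susp_sel by (rule act_one[OF M])
  show "act (susp a M) i x (r * s) = act (susp a M) (i + j) (act (susp a M) i x r) s"
    if "x \<in> gr (susp a M) i" "r \<in> Rgr j" "s \<in> Rgr l" for i j l x r s
    using that unfolding sh susp_sel by (rule act_mult[OF M])
  show "dif (susp a M) (i + j) (act (susp a M) i x r) = act (susp a M) (i + 1) (dif (susp a M) i x) r"
    if "x \<in> gr (susp a M) i" "r \<in> Rgr j" for i j x r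
    using that dif_act[OF M, of x "i + a" r j] act_simps(4)[OF M that(2) M, of "dif M (i + a) x"]
      dif_in[OF M, of x "i + a"]
    by (simp add: sh susp_sel)
qed

lemma dg_module_cone:
  assumes M: "dg_module M" and N: "dg_module N" and f: "dg_hom M N f"
  shows "dg_module (cone M N f)"
  unfolding dg_module_def
proof (intro conjI allI ballI)
  have sh: "i + j + 1 = i + 1 + j" for i j :: int
    by simp
  show "vec.subspace (gr (cone M N f) i)" for i
    by (rule vec.subspaceI) (auto simp: cone_sel proj_arith M N)
  show "klinear_on (gr (cone M N f) i) (dif (cone M N f) i)" for i
    unfolding klinear_on_def
    by (auto simp: cone_sel proj_arith pair_arith dif_simps[OF M M] dif_simps[OF N N]
        dg_hom_simps[OF f M] vec.scale_right_distrib)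
  show "dif (cone M N f) i x \<in> gr (cone M N f) (i + 1)" if "x \<in> gr (cone M N f) i" for i x
    using that by (auto simp: cone_sel M N dif_in' dg_hom_in[OF f])
  show "dif (cone M N f) (i + 1) (dif (cone M N f) i x) = 0" if x: "x \<in> gr (cone M N f) i" for i x
  proof -
    have x1: "pfst x \<in> gr M (i + 1)" and x2: "psnd x \<in> gr N i"
      using x by (simp_all add: cone_sel)
    show ?thesis
      using dg_hom_dif[OF f x1] dif_in[OF M x1] dif_in[OF N x2] dg_hom_in[OF f x1]
      by (simp add: cone_sel dif_simps[OF M M] dif_simps[OF N N] dg_hom_simps[OF f M]
          dif_dif'[OF M x1] dif_dif'[OF N x2])
  qed
  show "act (cone M N f) i x r \<in> gr (cone M N f) (i + j)" if "x \<in> gr (cone M N f) i" "r \<in> Rgr j" for i j x r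
    using that act_in[OF M, of "pfst x" "i + 1" r j] act_in[OF N, of "psnd x" i r j]
    by (simp add: cone_sel sh)
  show "klinear_on (gr (cone M N f) i) (\<lambda>x. act (cone M N f) i x r)" if "r \<in> Rgr j" for i j r
    unfolding klinear_on_def
    by (auto simp: cone_sel proj_arith pair_arith act_simps[OF M that M] act_simps[OF N that N])
  show "act (cone M N f) i x (r + s) = act (cone M N f) i x r + act (cone M N f) i x s"
    if "x \<in> gr (cone M N f) i" "r \<in> Rgr j" "s \<in> Rgr j" for i j x r s
    using that by (auto simp: cone_sel pair_arith act_radd[OF M] act_radd[OF N])
  show "act (cone M N f) i x (smult c r) = vscale c (act (cone M N f) i x r)"
    if "x \<in> gr (cone M N f) i" "r \<in> Rgr j" for i j c x r
    using that by (auto simp: cone_sel pair_arith act_smult[OF M] act_smult[OF N])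
  show "act (cone M N f) i x 1 = x" if "x \<in> gr (cone M N f) i" for i x
    using that by (simp add: cone_sel act_one[OF M] act_one[OF N])
  show "act (cone M N f) i x (r * s) = act (cone M N f) (i + j) (act (cone M N f) i x r) s"
    if "x \<in> gr (cone M N f) i" "r \<in> Rgr j" "s \<in> Rgr l" for i j l x r s
    using that act_mult[OF M, of "pfst x" "i + 1" r j s l] act_mult[OF N, of "psnd x" i r j s l]
    by (simp add: cone_sel sh)
  show "dif (cone M N f) (i + j) (act (cone M N f) i x r) = act (cone M N f) (i + 1) (dif (cone M N f) i x) r"
    if x: "x \<in> gr (cone M N f) i" and r: "r \<in> Rgr j" for i j x r
  proof -
    have x1: "pfst x \<in> gr M (i + 1)" and x2: "psnd x \<in> gr N i"
      using x by (simp_all add: cone_sel)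
    show ?thesis
      using dg_hom_act[OF f x1 r] dif_act[OF M x1 r] dif_act[OF N x2 r]
        dif_in[OF M x1] dif_in[OF N x2] dg_hom_in[OF f x1]
      by (simp add: cone_sel add.commute[of j 1] add.assoc act_simps[OF M r M] act_simps[OF N r N])
  qed
qed

lemma dg_module_dsum:
  assumes M: "dg_module M" and N: "dg_module N"
  shows "dg_module (dsum M N)"
  unfolding dg_module_def
proof (intro conjI allI ballI)
  show "vec.subspace (gr (dsum M N) i)" for i
    by (rule vec.subspaceI) (auto simp: dsum_sel proj_arith M N)
  show "klinear_on (gr (dsum M N) i) (dif (dsum M N) i)" for i
    unfolding klinear_on_def
    by (auto simp: dsum_sel proj_arith pair_arith dif_simps[OF M M] dif_simps[OF N N])
  show "klinear_on (gr (dsum M N) i) (\<lambda>x. act (dsum M N) i x r)" if "r \<in> Rgr j" for i j r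
    unfolding klinear_on_def
    by (auto simp: dsum_sel proj_arith pair_arith act_simps[OF M that M] act_simps[OF N that N])
  show "act (dsum M N) i x (r + s) = act (dsum M N) i x r + act (dsum M N) i x s"
    if "x \<in> gr (dsum M N) i" "r \<in> Rgr j" "s \<in> Rgr j" for i j x r s
    using that by (auto simp: dsum_sel pair_arith act_radd[OF M] act_radd[OF N])
  show "act (dsum M N) i x (smult c r) = vscale c (act (dsum M N) i x r)"
    if "x \<in> gr (dsum M N) i" "r \<in> Rgr j" for i j c x r
    using that by (auto simp: dsum_sel pair_arith act_smult[OF M] act_smult[OF N])
  show "act (dsum M N) i x (r * s) = act (dsum M N) (i + j) (act (dsum M N) i x r) s"
    if "x \<in> gr (dsum M N) i" "r \<in> Rgr j" "s \<in> Rgr l" for i j l x r s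
    using that act_mult[OF M, of "pfst x" i r j s l] act_mult[OF N, of "psnd x" i r j s l]
    by (simp add: dsum_sel)
  show "dif (dsum M N) (i + j) (act (dsum M N) i x r) = act (dsum M N) (i + 1) (dif (dsum M N) i x) r"
    if "x \<in> gr (dsum M N) i" "r \<in> Rgr j" for i j x r
    using that dif_act[OF M, of "pfst x" i r j] dif_act[OF N, of "psnd x" i r j]
    by (simp add: dsum_sel)
qed (simp_all add: dsum_sel M N dif_in dif_dif act_in act_one)

lemma dg_module_zero: "dg_module zero_dgm"
  by (auto simp: dg_module_def zero_dgm_def klinear_on_def vec.subspace_def)

lemma cocycles_susp: "cocycles (susp a M) i = cocycles M (i + a)"
  by (auto simp: cocycles_def susp_sel)

text \<open>The sign of the suspended differential is absorbed, because coboundaries are closed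
  under negation.\<close>

lemma coboundaries_susp:
  assumes M: "dg_module M"
  shows "coboundaries (susp a M) i = coboundaries M (i + a)"
proof -
  have sh: "i - 1 + a = i + a - 1"
    by simp
  have "coboundaries (susp a M) i = (\<lambda>x. if even a then x else - x) ` coboundaries M (i + a)"
    by (auto simp: coboundaries_def susp_sel sh image_image)
  also have "\<dots> = coboundaries M (i + a)"
    using cob_simps(4)[OF M, of _ "i + a"] by (force simp: image_iff)
  finally show ?thesis .
qed

lemma dg_hom_susp:
  assumes M: "dg_module M" and N: "dg_module N" and f: "dg_hom M N f"
  shows "dg_hom (susp a M) (susp a N) (\<lambda>i. f (i + a))"
proof -
  have sh: "i + 1 + a = i + a + 1" "i + j + a = i + a + j" for i j :: int
    by simp_all
  show ?thesis
    unfolding dg_hom_def susp_sel sh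
    using f by (auto simp: dg_homD dif_in[OF M] dg_hom_simps[OF f M])
qed

lemma quasi_iso_susp:
  assumes M: "dg_module M" and N: "dg_module N" and f: "quasi_iso M N f"
  shows "quasi_iso (susp a M) (susp a N) (\<lambda>i. f (i + a))"
  using f unfolding quasi_iso_def cocycles_susp coboundaries_susp[OF M] coboundaries_susp[OF N]
  by (blast intro: dg_hom_susp[OF M N])

section \<open>Acyclic modules, covers and the two Ore conditions\<close>

definition acyclic_dgm :: "('k::field, 'u) dgm \<Rightarrow> bool" where
  "acyclic_dgm C \<longleftrightarrow> (\<forall>i. cocycles C i \<subseteq> coboundaries C i)"

lemma acyclic_dgmD:
  assumes "acyclic_dgm C" "x \<in> gr C i" "dif C i x = 0"
  obtains y where "y \<in> gr C (i - 1)" "x = dif C (i - 1) y"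
  using assms by (auto simp: acyclic_dgm_def cocycles_def coboundaries_def)

lemma acyclic_susp: "dg_module C \<Longrightarrow> acyclic_dgm C \<Longrightarrow> acyclic_dgm (susp a C)"
  by (simp add: acyclic_dgm_def cocycles_susp coboundaries_susp)

text \<open>For a cocycle \<open>(x, y)\<close>, injectivity of \<open>f\<close> on cohomology makes
  \<open>x\<close> a coboundary \<open>d x'\<close>. Then \<open>f x' + y\<close> is a cocycle, and
  surjectivity writes it as \<open>f z\<close> up to a coboundary; \<open>z\<close> corrects
  \<open>x'\<close>.\<close>

lemma acyclic_cone:
  assumes M: "dg_module M" and N: "dg_module N" and f: "quasi_iso M N f"
  shows "acyclic_dgm (cone M N f)"
  unfolding acyclic_dgm_def
proof (intro allI subsetI)
  note fd = quasi_iso_dg_hom[OF f]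
  fix i v assume "v \<in> cocycles (cone M N f) i"
  then have v: "pfst v \<in> gr M (i + 1)" "psnd v \<in> gr N i"
    "dif M (i + 1) (pfst v) = 0" "f (i + 1) (pfst v) + dif N i (psnd v) = 0"
    by (auto simp: cocycles_def cone_sel)
  define x y where "x = pfst v" and "y = psnd v"
  note v = v[folded x_def y_def]
  have "f (i + 1) x = dif N i (- y)"
    using v by (simp add: dif_simps[OF N N] eq_neg_iff_add_eq_0)
  then have "x \<in> coboundaries M (i + 1)"
    using v N by (intro quasi_iso_inj[OF f]) (auto simp: cocycles_def intro!: coboundariesI[of "- y"])
  then obtain x' where x': "x' \<in> gr M i" "x = dif M i x'"
    by (auto simp: coboundaries_def)
  have "f i x' + y \<in> cocycles N i"
    using v x' dg_hom_dif[OF fd x'(1)] dg_hom_in[OF fd x'(1)] by (simp add: cocycles_def N dif_simps[OF N N])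
  then obtain z where z: "z \<in> cocycles M i" "f i z - (f i x' + y) \<in> coboundaries N i"
    using quasi_iso_surj[OF f] by blast
  then obtain w where w: "w \<in> gr N (i - 1)" "f i z - (f i x' + y) = dif N (i - 1) w"
    by (auto simp: coboundaries_def)
  have zg: "z \<in> gr M i" "dif M i z = 0"
    using z(1) by (simp_all add: cocycles_def)
  have "f i z - f i x' = y + dif N (i - 1) w"
    using w(2) by (simp add: algebra_simps)
  then have "v = dif (cone M N f) (i - 1) (pair (z - x') (- w))"
    using w(1) zg x' by - (rule vec_eq_pairI,
      simp_all add: cone_sel dif_simps[OF M M] dif_simps[OF N N] dg_hom_simps[OF fd M] x_def[symmetric] y_def[symmetric])
  then show "v \<in> coboundaries (cone M N f) i"
    using w(1) zg x' by (intro coboundariesI[of "pair (z - x') (- w)"]) (simp_all add: cone_sel M N)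
qed

text \<open>The cover is the shifted cone of \<open>f\<close>.\<close>

lemma acyclic_cover:
  assumes P: "dg_module P" and C: "dg_module C" and f: "dg_hom P C f" and ac: "acyclic_dgm C"
  obtains W w where "dg_module W" "quasi_iso W P w" "homotopic W C (gcomp f w) (\<lambda>i x. 0)"
proof
  let ?W = "susp (- 1) (cone P C f)"
  let ?w = "\<lambda>i::int. pfst"
  have W_gr: "v \<in> gr ?W i \<longleftrightarrow> pfst v \<in> gr P i \<and> psnd v \<in> gr C (i - 1)" for v i
    by (simp add: susp_sel cone_sel)
  have W_dif: "dif ?W i v = pair (dif P i (pfst v)) (- f i (pfst v) - dif C (i - 1) (psnd v))" for i v
    by (simp add: susp_sel cone_sel pair_arith)
  have W_act: "act ?W i v r = pair (act P i (pfst v) r) (act C (i - 1) (psnd v) r)" for i v r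
    by (simp add: susp_sel cone_sel)
  show W: "dg_module ?W"
    by (intro dg_module_susp dg_module_cone P C f)
  have wd: "dg_hom ?W P ?w"
    unfolding dg_hom_def by (auto simp: klinear_on_def W_gr W_dif W_act proj_arith)
  show "quasi_iso ?W P ?w"
    unfolding quasi_iso_def
  proof (intro conjI allI ballI impI wd)
    fix i v assume v: "v \<in> cocycles ?W i" "pfst v \<in> coboundaries P i"
    then obtain x' where x': "x' \<in> gr P (i - 1)" "pfst v = dif P (i - 1) x'"
      by (auto simp: coboundaries_def)
    have v': "pfst v \<in> gr P i" "psnd v \<in> gr C (i - 1)" "- f i (pfst v) - dif C (i - 1) (psnd v) = 0"
      using v(1) by (auto simp: cocycles_def W_gr W_dif)
    \<comment> \<open>Once \<open>pfst v\<close> is bounded by \<open>x'\<close>, what is left of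
      \<open>v\<close> is a cocycle of \<open>C\<close> and is bounded because \<open>C\<close> is
      acyclic.\<close>
    have "dif C (i - 1) (f (i - 1) x' + psnd v) = 0"
      using v' x' dg_hom_dif_pred[OF f x'(1)] dg_hom_in[OF f x'(1)]
      by (simp add: dif_simps[OF C C] algebra_simps neg_eq_iff_add_eq_0)
    then obtain u where u: "u \<in> gr C (i - 1 - 1)" "f (i - 1) x' + psnd v = dif C (i - 1 - 1) u"
      using v' x' dg_hom_in[OF f x'(1)] C by (elim acyclic_dgmD[OF ac, rotated]) auto
    have "psnd v = - f (i - 1) x' + dif C (i - 1 - 1) u"
      using add_diff_cancel_left'[of "f (i - 1) x'" "psnd v"] unfolding u(2) by (simp add: algebra_simps)
    then have "v = dif ?W (i - 1) (pair x' (- u))"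
      using u(1) x' by - (rule vec_eq_pairI, simp_all add: W_dif dif_simps[OF C C])
    then show "v \<in> coboundaries ?W i"
      using u(1) x' C by (intro coboundariesI[of "pair x' (- u)"]) (simp_all add: W_gr)
  next
    fix i x assume x: "x \<in> cocycles P i"
    then have "f i x \<in> gr C i" "dif C i (f i x) = 0"
      using dg_hom_cocycle[OF P C f] by (auto simp: cocycles_def)
    then obtain y where y: "y \<in> gr C (i - 1)" "f i x = dif C (i - 1) y"
      by (rule acyclic_dgmD[OF ac])
    have "pair x (- y) \<in> cocycles ?W i"
      using x y C by (auto simp: cocycles_def W_gr W_dif dif_simps[OF C C])
    then show "\<exists>v\<in>cocycles ?W i. pfst v - x \<in> coboundaries P i"
      by (rule bexI[rotated]) (simp add: cob_simps P)
  qed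
  \<comment> \<open>The second component of the differential of \<open>?W\<close> is
    \<open>- f (pfst v) - d (psnd v)\<close>, so minus the second projection contracts
    \<open>f\<close> after the cover.\<close>
  have "ghom (- 1) ?W C (\<lambda>i v. - psnd v)"
    by (rule ghomI[OF W C]) (auto simp: W_gr W_act C klinear_on_def proj_arith act_simps(4)[OF C monom_in_Rgr C])
  then show "homotopic ?W C (gcomp f ?w) (\<lambda>i x. 0)"
    by (rule homotopicI) (simp add: gcomp_def W_gr W_dif dif_simps[OF C C])
qed

text \<open>A contraction of \<open>(0, q)\<close> has two components. The first is a chain map to
  \<open>N\<close>, and the second is a homotopy between \<open>q\<close> and \<open>t\<close>
  composed with that map.\<close>

lemma cone_lift:
  assumes Z: "dg_module Z" and N: "dg_module N" and N': "dg_module N'"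
    and t: "dg_hom N N' t" and q: "dg_hom Z N' q"
    and null: "homotopic Z (cone N N' t) (\<lambda>i x. pair 0 (q i x)) (\<lambda>i x. 0)"
  obtains g where "dg_hom Z N g" "homotopic Z N' (gcomp t g) q"
proof -
  let ?C = "cone N N' t"
  obtain h where h: "ghom (- 1) Z ?C h" and hq: "\<And>i x. x \<in> gr Z i \<Longrightarrow>
      pair 0 (q i x) - 0 = dif ?C (i - 1) (h i x) + h (i + 1) (dif Z i x)"
    using null by (rule homotopicE) blast
  have h_in: "pfst (h i x) \<in> gr N i" "psnd (h i x) \<in> gr N' (i - 1)" if "x \<in> gr Z i" for i x
    using ghom_in[OF h that] by (simp_all add: cone_sel)
  have h_act: "h (i + j) (act Z i x r) = pair (act N i (pfst (h i x)) r) (act N' (i - 1) (psnd (h i x)) r)"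
    if "x \<in> gr Z i" "r \<in> Rgr j" for i j x r
    using ghom_act[OF h that] by (simp add: cone_sel)
  have hq1: "pfst (h (i + 1) (dif Z i x)) = dif N i (pfst (h i x))"
    and hq2: "q i x = t i (pfst (h i x)) + dif N' (i - 1) (psnd (h i x)) + psnd (h (i + 1) (dif Z i x))"
    if "x \<in> gr Z i" for i x
    using arg_cong[OF hq[OF that], of pfst] arg_cong[OF hq[OF that], of psnd]
    by (simp_all add: proj_arith cone_sel)
  have lin: "klinear_on (gr Z i) (h i)" for i
    by (rule ghom_klinear[OF h])
  have g: "dg_hom Z N (\<lambda>i x. pfst (h i x))"
    unfolding dg_hom_def
    using lin by (auto simp: klinear_on_def proj_arith h_in h_act hq1)
  have k: "ghom (- 1) Z N' (\<lambda>i x. psnd (h i x))"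
    unfolding ghom_def
    using lin by (auto simp: klinear_on_def proj_arith h_in h_act)
  have "homotopic Z N' q (gcomp t (\<lambda>i x. pfst (h i x)))"
    by (rule homotopicI[OF k]) (simp add: gcomp_def hq2)
  then show thesis
    using that[OF g] homotopic_sym[OF Z N'] by blast
qed

lemma dg_hom_to_cone:
  assumes N: "dg_module N" and q: "dg_hom Z N' q" and t: "dg_hom N N' t"
  shows "dg_hom Z (cone N N' t) (\<lambda>i x. pair 0 (q i x))"
  using q unfolding dg_hom_def
  by (auto simp: cone_sel N klinear_on_def pair_arith dif_simps[OF N N] dg_hom_simps[OF t N] act_simps[OF N _ N])

text \<open>The cone shifted back by one is the homotopy fiber of \<open>t\<close>: a map into it is
  a map to \<open>N\<close> together with a contraction of its composite with
  \<open>t\<close>.\<close>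

lemma dg_hom_to_fiber:
  assumes N': "dg_module N'" and k: "ghom (- 1) Z N' k" and g: "dg_hom Z N g"
    and eq: "\<And>i x. x \<in> gr Z i \<Longrightarrow> gcomp t g i x - 0 = dif N' (i - 1) (k i x) + k (i + 1) (dif Z i x)"
  shows "dg_hom Z (susp (- 1) (cone N N' t)) (\<lambda>i x. pair (g i x) (- k i x))"
  unfolding dg_hom_def
proof (intro conjI allI ballI)
  show "klinear_on (gr Z i) (\<lambda>x. pair (g i x) (- k i x))" for i
    using dg_hom_klinear[OF g, of i] ghom_klinear[OF k, of i]
    by (auto simp: klinear_on_def pair_arith)
  fix i x assume x: "x \<in> gr Z i"
  have gx: "g i x \<in> gr N i" and kx: "k i x \<in> gr N' (i - 1)"
    using dg_hom_in[OF g x] ghom_in[OF k x] by simp_all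
  show "pair (g i x) (- k i x) \<in> gr (susp (- 1) (cone N N' t)) i"
    using gx kx N' by (simp add: susp_sel cone_sel)
  show "pair (g (i + 1) (dif Z i x)) (- k (i + 1) (dif Z i x)) =
      dif (susp (- 1) (cone N N' t)) i (pair (g i x) (- k i x))"
    using eq[OF x] kx dg_hom_dif[OF g x]
    by (simp add: susp_sel cone_sel pair_arith dif_simps[OF N' N'] gcomp_def)
  show "pair (g (i + j) (act Z i x r)) (- k (i + j) (act Z i x r)) =
      act (susp (- 1) (cone N N' t)) i (pair (g i x) (- k i x)) r" if r: "r \<in> Rgr j" for j r
    using kx dg_hom_act[OF g x r] ghom_act[OF k x r]
    by (simp add: susp_sel cone_sel act_simps[OF N' r N'])
qed

text \<open>The projection of the fiber to \<open>N\<close> commutes with the differentials, so a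
  contraction can be projected.\<close>

lemma fiber_null:
  assumes g: "dg_hom Z N g"
    and null: "homotopic Z (susp (- 1) (cone N N' t)) (\<lambda>i x. pair (g i x) (k i x)) (\<lambda>i x. 0)"
  shows "homotopic Z N g (\<lambda>i x. 0)"
proof -
  let ?C = "susp (- 1) (cone N N' t)"
  obtain h where h: "ghom (- 1) Z ?C h" and hq: "\<And>i x. x \<in> gr Z i \<Longrightarrow>
      pair (g i x) (k i x) - 0 = dif ?C (i - 1) (h i x) + h (i + 1) (dif Z i x)"
    using null by (rule homotopicE) blast
  have "ghom (- 1) Z N (\<lambda>i x. pfst (h i x))"
    unfolding ghom_def
  proof (intro conjI allI ballI)
    show "klinear_on (gr Z i) (\<lambda>x. pfst (h i x))" for i
      using ghom_klinear[OF h, of i] by (simp add: klinear_on_def proj_arith)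
    show "pfst (h i x) \<in> gr N (i + - 1)" if "x \<in> gr Z i" for i x
      using ghom_in[OF h that] by (simp add: susp_sel cone_sel)
    show "pfst (h (i + j) (act Z i x r)) = act N (i + - 1) (pfst (h i x)) r"
      if "x \<in> gr Z i" "r \<in> Rgr j" for i j x r
      using ghom_act[OF h that] by (simp add: susp_sel cone_sel)
  qed
  moreover have "g i x - 0 = dif N (i - 1) (pfst (h i x)) + pfst (h (i + 1) (dif Z i x))"
    if "x \<in> gr Z i" for i x
    using arg_cong[OF hq[OF that], of pfst] by (simp add: proj_arith susp_sel cone_sel pair_arith)
  ultimately show ?thesis
    by (rule homotopicI)
qed

text \<open>The obstruction to lifting \<open>q\<close> through \<open>t\<close> is the map
  \<open>(0, q)\<close> into the cone of \<open>t\<close>. The cone is acyclic, so the obstruction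
  dies on a cover of \<open>P\<close>.\<close>

lemma ore_square:
  assumes P: "dg_module P" and N: "dg_module N" and N': "dg_module N'"
    and t: "quasi_iso N N' t" and q: "dg_hom P N' q"
  obtains W w g where "dg_module W" "quasi_iso W P w" "dg_hom W N g"
    "homotopic W N' (gcomp t g) (gcomp q w)"
proof -
  note td = quasi_iso_dg_hom[OF t]
  obtain W w where W: "dg_module W" and w: "quasi_iso W P w"
    and null: "homotopic W (cone N N' t) (gcomp (\<lambda>i x. pair 0 (q i x)) w) (\<lambda>i x. 0)"
    using acyclic_cover[OF P dg_module_cone[OF N N' td] dg_hom_to_cone[OF N q td] acyclic_cone[OF N N' t]]
    by blast
  have null': "homotopic W (cone N N' t) (\<lambda>i x. pair 0 (gcomp q w i x)) (\<lambda>i x. 0)"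
    using null by (simp add: gcomp_def)
  obtain g where "dg_hom W N g" "homotopic W N' (gcomp t g) (gcomp q w)"
    by (rule cone_lift[OF W N N' td dg_hom_comp[OF quasi_iso_dg_hom[OF w] q] null'])
  then show thesis
    using that W w by blast
qed

text \<open>The given homotopy turns the difference of the two maps into a map to the homotopy fiber
  of \<open>t\<close>. The fiber is acyclic, so this map dies on a cover, and its first component
  with it.\<close>

lemma ore_cancel:
  assumes P: "dg_module P" and N: "dg_module N" and N': "dg_module N'"
    and t: "quasi_iso N N' t" and g: "dg_hom P N g" and g': "dg_hom P N g'"
    and eq: "homotopic P N' (gcomp t g) (gcomp t g')"
  obtains W w where "dg_module W" "quasi_iso W P w" "homotopic W N (gcomp g w) (gcomp g' w)"
proof -
  note td = quasi_iso_dg_hom[OF t]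
  let ?g = "\<lambda>i x. g i x - g' i x"
  have gd: "dg_hom P N ?g"
    by (rule dg_hom_diff[OF P N g g'])
  obtain k where k: "ghom (- 1) P N' k" "\<And>i x. x \<in> gr P i \<Longrightarrow>
     gcomp t g i x - gcomp t g' i x = dif N' (i - 1) (k i x) + k (i + 1) (dif P i x)"
    using eq by (rule homotopicE) blast
  have k': "gcomp t ?g i x - 0 = dif N' (i - 1) (k i x) + k (i + 1) (dif P i x)"
    if "x \<in> gr P i" for i x
    using k(2)[OF that] dg_hom_in[OF g that] dg_hom_in[OF g' that]
    by (simp add: gcomp_def dg_hom_simps[OF td N])
  obtain W w where W: "dg_module W" and w: "quasi_iso W P w"
    and null: "homotopic W (susp (- 1) (cone N N' t)) (gcomp (\<lambda>i x. pair (?g i x) (- k i x)) w) (\<lambda>i x. 0)"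
    using acyclic_cover[OF P dg_module_susp[OF dg_module_cone[OF N N' td]] dg_hom_to_fiber[OF N' k(1) gd k']
        acyclic_susp[OF dg_module_cone[OF N N' td] acyclic_cone[OF N N' t]]]
    by blast
  have null': "homotopic W (susp (- 1) (cone N N' t)) (\<lambda>i x. pair (gcomp ?g w i x) (- k i (w i x))) (\<lambda>i x. 0)"
    using null unfolding gcomp_def .
  have "homotopic W N (gcomp ?g w) (\<lambda>i x. 0)"
    by (rule fiber_null[OF dg_hom_comp[OF quasi_iso_dg_hom[OF w] gd] null'])
  then have "homotopic W N (gcomp g w) (gcomp g' w)"
    unfolding gcomp_def by (rule homotopic_diff_zero_iff[OF W N, THEN iffD1])
  then show thesis
    using that W w by blast
qed

section \<open>Homotopically projective modules\<close>

definition h_projective :: "('k::field, 'u) dgm \<Rightarrow> bool" where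
  "h_projective Z \<longleftrightarrow> dg_module Z \<and> (\<forall>C f. dg_module C \<longrightarrow> acyclic_dgm (C :: ('k, 'u) dgm) \<longrightarrow> dg_hom Z C f \<longrightarrow>
     homotopic Z C f (\<lambda>i x. 0))"

text \<open>The obstruction of \<open>ore_square\<close> already vanishes on \<open>Z\<close>. The
  cone of \<open>t\<close> is built inside the same universe, to which the quantifier in
  \<open>h_projective\<close> is restricted.\<close>

lemma h_projective_lift:
  assumes Z: "h_projective Z" and N: "dg_module N" and N': "dg_module N'"
    and t: "quasi_iso N N' t" and q: "dg_hom Z N' q"
  obtains g where "dg_hom Z N g" "homotopic Z N' (gcomp t g) q"
proof -
  note td = quasi_iso_dg_hom[OF t]
  have "homotopic Z (cone N N' t) (\<lambda>i x. pair 0 (q i x)) (\<lambda>i x. 0)"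
    using Z dg_module_cone[OF N N' td] acyclic_cone[OF N N' t] dg_hom_to_cone[OF N q td]
    unfolding h_projective_def by blast
  then show thesis
    using Z cone_lift[OF _ N N' td q] that unfolding h_projective_def by blast
qed

text \<open>The fiber argument of \<open>ore_cancel\<close> on \<open>Z\<close> itself; it yields
  uniqueness of lifts up to homotopy.\<close>

lemma h_projective_cancel:
  assumes Z: "h_projective Z" and N: "dg_module N" and N': "dg_module N'"
    and t: "quasi_iso N N' t" and g: "dg_hom Z N g" and null: "homotopic Z N' (gcomp t g) (\<lambda>i x. 0)"
  shows "homotopic Z N g (\<lambda>i x. 0)"
proof -
  note td = quasi_iso_dg_hom[OF t]
  obtain k where k: "ghom (- 1) Z N' k" "\<And>i x. x \<in> gr Z i \<Longrightarrow>
     gcomp t g i x - 0 = dif N' (i - 1) (k i x) + k (i + 1) (dif Z i x)"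
    using null by (rule homotopicE) blast
  have "homotopic Z (susp (- 1) (cone N N' t)) (\<lambda>i x. pair (g i x) (- k i x)) (\<lambda>i x. 0)"
    using Z dg_module_susp[OF dg_module_cone[OF N N' td]] dg_hom_to_fiber[OF N' k(1) g k(2)]
      acyclic_susp[OF dg_module_cone[OF N N' td] acyclic_cone[OF N N' t]]
    unfolding h_projective_def by blast
  then show ?thesis
    by (rule fiber_null[OF g])
qed

section \<open>The calculus of fractions\<close>

lemma is_roof_simps: "is_roof M N (P, s, f) \<longleftrightarrow> dg_module P \<and> quasi_iso P M s \<and> dg_hom P N f"
  by (simp add: is_roof_def)

lemma roof_eqI:
  assumes "dg_module Q" "dg_hom Q P u" "dg_hom Q P' u'" "quasi_iso Q M (gcomp s u)"
    "homotopic Q M (gcomp s u) (gcomp s' u')" "homotopic Q N (gcomp f u) (gcomp f' u')"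
  shows "roof_eq M N (P, s, f) (P', s', f')"
  using assms unfolding roof_eq_def by blast

lemma roof_eqE:
  assumes "roof_eq M N (P, s, f) (P', s', f')"
  obtains Q u u' where "dg_module Q" "dg_hom Q P u" "dg_hom Q P' u'" "quasi_iso Q M (gcomp s u)"
    "homotopic Q M (gcomp s u) (gcomp s' u')" "homotopic Q N (gcomp f u) (gcomp f' u')"
  using assms unfolding roof_eq_def by blast

lemma roof_eq_refl:
  assumes "dg_module M" "dg_module N" "is_roof M N \<rho>"
  shows "roof_eq M N \<rho> \<rho>"
proof (cases \<rho>)
  case (fields P s f)
  then show ?thesis
    using assms by (auto simp: is_roof_simps intro!: roof_eqI[of P P gid P gid] dg_hom_id homotopic_refl)
qed

text \<open>\<open>roof_eq\<close> asks only that the leg through the first roof be a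
  quasi-isomorphism. The leg through the second roof is homotopic to it, hence one as well.\<close>

lemma roof_eq_sym:
  assumes M: "dg_module M" and N: "dg_module N" and "is_roof M N \<rho>" "is_roof M N \<sigma>" "roof_eq M N \<rho> \<sigma>"
  shows "roof_eq M N \<sigma> \<rho>"
proof -
  obtain P s f P' s' f' where \<rho>: "\<rho> = (P, s, f)" and \<sigma>: "\<sigma> = (P', s', f')"
    by (metis prod_cases3)
  obtain Q u u' where Q: "dg_module Q" "dg_hom Q P u" "dg_hom Q P' u'" "quasi_iso Q M (gcomp s u)"
    "homotopic Q M (gcomp s u) (gcomp s' u')" "homotopic Q N (gcomp f u) (gcomp f' u')"
    using assms(5) unfolding \<rho> \<sigma> by (rule roof_eqE)
  have "dg_hom P' M s'"
    using assms(4) unfolding \<sigma> is_roof_simps by (simp add: quasi_iso_dg_hom)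
  then have "quasi_iso Q M (gcomp s' u')"
    using quasi_iso_homotopic[OF Q(1) M Q(4,5)] dg_hom_comp[OF Q(3)] by blast
  then show ?thesis
    unfolding \<rho> \<sigma> using Q homotopic_sym[OF Q(1) M Q(5)] homotopic_sym[OF Q(1) N Q(6)]
    by (intro roof_eqI[of Q _ u' _ u])
qed

lemma roof_eq_quasi_iso:
  assumes M: "dg_module M" and P: "dg_module P" and s: "quasi_iso P M s"
    and Q: "dg_module Q" "dg_hom Q P u" "quasi_iso Q M (gcomp s u)"
  shows "quasi_iso Q P u"
  using quasi_iso_cancel_left[OF Q(1) P M Q(2) s Q(3)] .

text \<open>The refinements \<open>U\<close> and \<open>V\<close> are joined by an Ore square over
  the apex \<open>P2\<close> of the middle roof.\<close>

lemma roof_eq_trans: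
  assumes M: "dg_module M" and N: "dg_module N"
    and "is_roof M N \<rho>" "is_roof M N \<sigma>" "is_roof M N \<tau>"
    and "roof_eq M N \<rho> \<sigma>" "roof_eq M N \<sigma> \<tau>"
  shows "roof_eq M N \<rho> \<tau>"
proof -
  obtain P1 s1 f1 P2 s2 f2 P3 s3 f3 where
    eqs: "\<rho> = (P1, s1, f1)" "\<sigma> = (P2, s2, f2)" "\<tau> = (P3, s3, f3)"
    by (metis prod_cases3)
  have P: "dg_module P1" "dg_module P2" "dg_module P3"
    and s: "quasi_iso P1 M s1" "quasi_iso P2 M s2" "quasi_iso P3 M s3"
    and f: "dg_hom P1 N f1" "dg_hom P2 N f2" "dg_hom P3 N f3"
    using assms(3-5) by (simp_all add: eqs is_roof_simps)
  note sd = s[THEN quasi_iso_dg_hom]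
  obtain U u1 u2 where U: "dg_module U" "dg_hom U P1 u1" "dg_hom U P2 u2" "quasi_iso U M (gcomp s1 u1)"
    "homotopic U M (gcomp s1 u1) (gcomp s2 u2)" "homotopic U N (gcomp f1 u1) (gcomp f2 u2)"
    using assms(6) unfolding eqs by (rule roof_eqE)
  obtain V v2 v3 where V: "dg_module V" "dg_hom V P2 v2" "dg_hom V P3 v3" "quasi_iso V M (gcomp s2 v2)"
    "homotopic V M (gcomp s2 v2) (gcomp s3 v3)" "homotopic V N (gcomp f2 v2) (gcomp f3 v3)"
    using assms(7) unfolding eqs by (rule roof_eqE)
  have v2: "quasi_iso V P2 v2"
    by (rule roof_eq_quasi_iso[OF M P(2) s(2) V(1,2,4)])
  obtain W w x where W: "dg_module W" and w: "quasi_iso W U w" and x: "dg_hom W V x"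
    and sq: "homotopic W P2 (gcomp v2 x) (gcomp u2 w)"
    by (rule ore_square[OF U(1) V(1) P(2) v2 U(3)])
  note wd = quasi_iso_dg_hom[OF w]
  have sq': "homotopic W P2 (gcomp u2 w) (gcomp v2 x)"
    by (rule homotopic_sym[OF W P(2) sq])
  note hl = homotopic_comp_left[OF P(2) W sq' dg_hom_comp[OF wd U(3)] dg_hom_comp[OF x V(2)]]
  have 1: "homotopic W M (gcomp s1 (gcomp u1 w)) (gcomp s3 (gcomp v3 x))"
  proof -
    note [trans] = homotopic_trans[OF W M]
    have "homotopic W M (gcomp s1 (gcomp u1 w)) (gcomp s2 (gcomp u2 w))"
      using homotopic_comp_right[OF U(5) wd] by (simp add: gcomp_assoc)
    also have "homotopic W M \<dots> (gcomp s2 (gcomp v2 x))"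
      by (rule hl[OF sd(2)])
    also have "homotopic W M \<dots> (gcomp s3 (gcomp v3 x))"
      using homotopic_comp_right[OF V(5) x] by (simp add: gcomp_assoc)
    finally show ?thesis .
  qed
  have 2: "homotopic W N (gcomp f1 (gcomp u1 w)) (gcomp f3 (gcomp v3 x))"
  proof -
    note [trans] = homotopic_trans[OF W N]
    have "homotopic W N (gcomp f1 (gcomp u1 w)) (gcomp f2 (gcomp u2 w))"
      using homotopic_comp_right[OF U(6) wd] by (simp add: gcomp_assoc)
    also have "homotopic W N \<dots> (gcomp f2 (gcomp v2 x))"
      by (rule hl[OF f(2)])
    also have "homotopic W N \<dots> (gcomp f3 (gcomp v3 x))"
      using homotopic_comp_right[OF V(6) x] by (simp add: gcomp_assoc)
    finally show ?thesis .
  qed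
  have "quasi_iso W M (gcomp s1 (gcomp u1 w))"
    using quasi_iso_comp[OF W U(1) M w U(4)] by (simp add: gcomp_assoc)
  then show ?thesis
    unfolding eqs using W 1 2 dg_hom_comp[OF wd U(2)] dg_hom_comp[OF x V(3)]
    by (intro roof_eqI)
qed

lemma roof_class_self:
  assumes "dg_module M" "dg_module N" "is_roof M N \<rho>"
  shows "\<rho> \<in> roof_class M N \<rho>"
  using assms by (simp add: roof_class_def roof_eq_refl)

lemma roof_class_eqI:
  assumes M: "dg_module M" and N: "dg_module N" and "is_roof M N \<rho>" "is_roof M N \<sigma>" "roof_eq M N \<rho> \<sigma>"
  shows "roof_class M N \<rho> = roof_class M N \<sigma>"
  using roof_eq_trans[OF M N] roof_eq_sym[OF M N assms(3,4,5)] assms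
  unfolding roof_class_def by blast

text \<open>The composite must be independent of both representatives and of the chosen Ore squares.
  A common refinement is built in four stages: \<open>X1\<close> joins \<open>W1\<close> to
  \<open>U\<close> over \<open>P1\<close>, \<open>X2\<close> joins the result to \<open>W2\<close>
  over \<open>P2\<close>, and \<open>X3\<close> joins it to \<open>V\<close> over \<open>Q1\<close>.
  The two maps from \<open>X3\<close> to \<open>Q2\<close> are homotopic only after composition with
  \<open>t2\<close>, and \<open>X4\<close> cancels \<open>t2\<close>.\<close>

lemma roof_composite_unique:
  assumes L: "dg_module L" and M: "dg_module M" and N: "dg_module N"
    and r1: "is_roof L M (P1, s1, f1)" and r2: "is_roof L M (P2, s2, f2)"
    and F: "roof_eq L M (P1, s1, f1) (P2, s2, f2)"
    and q1: "is_roof M N (Q1, t1, g1)" and q2: "is_roof M N (Q2, t2, g2)"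
    and G: "roof_eq M N (Q1, t1, g1) (Q2, t2, g2)"
    and W1: "dg_module W1" "quasi_iso W1 P1 w1" "dg_hom W1 Q1 w1'"
      "homotopic W1 M (gcomp f1 w1) (gcomp t1 w1')"
    and W2: "dg_module W2" "quasi_iso W2 P2 w2" "dg_hom W2 Q2 w2'"
      "homotopic W2 M (gcomp f2 w2) (gcomp t2 w2')"
  shows "roof_eq L N (W1, gcomp s1 w1, gcomp g1 w1') (W2, gcomp s2 w2, gcomp g2 w2')"
proof -
  have P: "dg_module P1" "dg_module P2" "dg_module Q1" "dg_module Q2"
    and s: "quasi_iso P1 L s1" "quasi_iso P2 L s2" and t: "quasi_iso Q1 M t1" "quasi_iso Q2 M t2"
    and f: "dg_hom P1 M f1" "dg_hom P2 M f2" and g: "dg_hom Q1 N g1" "dg_hom Q2 N g2"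
    using r1 r2 q1 q2 by (simp_all add: is_roof_simps)
  note sd = s[THEN quasi_iso_dg_hom] and td = t[THEN quasi_iso_dg_hom]
    and w1d = quasi_iso_dg_hom[OF W1(2)] and w2d = quasi_iso_dg_hom[OF W2(2)]
  obtain U u1 u2 where U: "dg_module U" "dg_hom U P1 u1" "dg_hom U P2 u2" "quasi_iso U L (gcomp s1 u1)"
    "homotopic U L (gcomp s1 u1) (gcomp s2 u2)" "homotopic U M (gcomp f1 u1) (gcomp f2 u2)"
    using F by (rule roof_eqE)
  have u1: "quasi_iso U P1 u1"
    by (rule roof_eq_quasi_iso[OF L P(1) s(1) U(1,2,4)])
  obtain V v1 v2 where V: "dg_module V" "dg_hom V Q1 v1" "dg_hom V Q2 v2" "quasi_iso V M (gcomp t1 v1)"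
    "homotopic V M (gcomp t1 v1) (gcomp t2 v2)" "homotopic V N (gcomp g1 v1) (gcomp g2 v2)"
    using G by (rule roof_eqE)
  have v1: "quasi_iso V Q1 v1"
    by (rule roof_eq_quasi_iso[OF M P(3) t(1) V(1,2,4)])
  obtain X1 a b where X1: "dg_module X1" and a: "quasi_iso X1 W1 a" and b: "dg_hom X1 U b"
    and sq1: "homotopic X1 P1 (gcomp u1 b) (gcomp w1 a)"
    by (rule ore_square[OF W1(1) U(1) P(1) u1 w1d])
  obtain X2 e c where X2: "dg_module X2" and e: "quasi_iso X2 X1 e" and c: "dg_hom X2 W2 c"
    and sq2: "homotopic X2 P2 (gcomp w2 c) (gcomp (gcomp u2 b) e)"
    by (rule ore_square[OF X1 W2(1) P(2) W2(2) dg_hom_comp[OF b U(3)]])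
  have ae: "quasi_iso X2 W1 (gcomp a e)"
    by (rule quasi_iso_comp[OF X2 X1 W1(1) e a])
  obtain X3 k x where X3: "dg_module X3" and k: "quasi_iso X3 X2 k" and x: "dg_hom X3 V x"
    and sq3: "homotopic X3 Q1 (gcomp v1 x) (gcomp (gcomp w1' (gcomp a e)) k)"
    by (rule ore_square[OF X2 V(1) P(3) v1 dg_hom_comp[OF quasi_iso_dg_hom[OF ae] W1(3)]])
  note ed = quasi_iso_dg_hom[OF e] and kd = quasi_iso_dg_hom[OF k]
  define A B C where "A = gcomp (gcomp a e) k" and "B = gcomp (gcomp b e) k" and "C = gcomp c k"
  have A: "quasi_iso X3 W1 A"
    unfolding A_def by (rule quasi_iso_comp[OF X3 X2 W1(1) k ae])
  note Ad = quasi_iso_dg_hom[OF A]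
  have B: "dg_hom X3 U B" and C: "dg_hom X3 W2 C"
    unfolding B_def C_def by (rule dg_hom_comp[OF kd dg_hom_comp[OF ed b]], rule dg_hom_comp[OF kd c])
  have AB: "homotopic X3 P1 (gcomp w1 A) (gcomp u1 B)"
    using homotopic_sym[OF X3 P(1) homotopic_comp_right[OF homotopic_comp_right[OF sq1 ed] kd]]
    by (simp add: A_def B_def gcomp_assoc)
  have BC: "homotopic X3 P2 (gcomp u2 B) (gcomp w2 C)"
    using homotopic_sym[OF X3 P(2) homotopic_comp_right[OF sq2 kd]]
    by (simp add: B_def C_def gcomp_assoc)
  have xA: "homotopic X3 Q1 (gcomp v1 x) (gcomp w1' A)"
    using sq3 by (simp add: A_def gcomp_assoc)
  have Ax: "homotopic X3 Q1 (gcomp w1' A) (gcomp v1 x)"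
    by (rule homotopic_sym[OF X3 P(3) xA])
  note AB' = homotopic_comp_left[OF P(1) X3 AB dg_hom_comp[OF Ad w1d] dg_hom_comp[OF B U(2)]]
  note BC' = homotopic_comp_left[OF P(2) X3 BC dg_hom_comp[OF B U(3)] dg_hom_comp[OF C w2d]]
  \<comment> \<open>The chain passes from \<open>Q2\<close> to \<open>Q1\<close> through
    \<open>V\<close>, over the square of \<open>W1\<close> to \<open>P1\<close>, through
    \<open>U\<close> to \<open>P2\<close>, and back over the square of \<open>W2\<close>.\<close>
  have "homotopic X3 M (gcomp t2 (gcomp v2 x)) (gcomp t2 (gcomp w2' C))"
  proof -
    note [trans] = homotopic_trans[OF X3 M]
    have "homotopic X3 M (gcomp t2 (gcomp v2 x)) (gcomp t1 (gcomp v1 x))"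
      using homotopic_sym[OF X3 M homotopic_comp_right[OF V(5) x]] by (simp add: gcomp_assoc)
    also have "homotopic X3 M \<dots> (gcomp t1 (gcomp w1' A))"
      by (rule homotopic_comp_left[OF P(3) X3 xA dg_hom_comp[OF x V(2)] dg_hom_comp[OF Ad W1(3)] td(1)])
    also have "homotopic X3 M \<dots> (gcomp f1 (gcomp w1 A))"
      using homotopic_sym[OF X3 M homotopic_comp_right[OF W1(4) Ad]] by (simp add: gcomp_assoc)
    also have "homotopic X3 M \<dots> (gcomp f1 (gcomp u1 B))"
      by (rule AB'[OF f(1)])
    also have "homotopic X3 M \<dots> (gcomp f2 (gcomp u2 B))"
      using homotopic_comp_right[OF U(6) B] by (simp add: gcomp_assoc)
    also have "homotopic X3 M \<dots> (gcomp f2 (gcomp w2 C))"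
      by (rule BC'[OF f(2)])
    also have "homotopic X3 M \<dots> (gcomp t2 (gcomp w2' C))"
      using homotopic_comp_right[OF W2(4) C] by (simp add: gcomp_assoc)
    finally show ?thesis .
  qed
  then obtain X4 z where X4: "dg_module X4" and z: "quasi_iso X4 X3 z"
    and sq4: "homotopic X4 Q2 (gcomp (gcomp v2 x) z) (gcomp (gcomp w2' C) z)"
    by (rule ore_cancel[OF X3 P(4) M t(2) dg_hom_comp[OF x V(3)] dg_hom_comp[OF C W2(3)]])
  note zd = quasi_iso_dg_hom[OF z]
  have 1: "homotopic X4 L (gcomp (gcomp s1 w1) (gcomp A z)) (gcomp (gcomp s2 w2) (gcomp C z))"
  proof -
    note [trans] = homotopic_trans[OF X3 L]
    have "homotopic X3 L (gcomp s1 (gcomp w1 A)) (gcomp s1 (gcomp u1 B))"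
      by (rule AB'[OF sd(1)])
    also have "homotopic X3 L \<dots> (gcomp s2 (gcomp u2 B))"
      using homotopic_comp_right[OF U(5) B] by (simp add: gcomp_assoc)
    also have "homotopic X3 L \<dots> (gcomp s2 (gcomp w2 C))"
      by (rule BC'[OF sd(2)])
    finally show ?thesis
      using homotopic_comp_right[OF _ zd] by (fastforce simp: gcomp_assoc)
  qed
  have 2: "homotopic X4 N (gcomp (gcomp g1 w1') (gcomp A z)) (gcomp (gcomp g2 w2') (gcomp C z))"
  proof -
    note [trans] = homotopic_trans[OF X4 N]
    have "homotopic X3 N (gcomp g1 (gcomp w1' A)) (gcomp g1 (gcomp v1 x))"
      by (rule homotopic_comp_left[OF P(3) X3 Ax dg_hom_comp[OF Ad W1(3)] dg_hom_comp[OF x V(2)] g(1)])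
    from homotopic_comp_right[OF this zd]
    have "homotopic X4 N (gcomp (gcomp g1 w1') (gcomp A z)) (gcomp g1 (gcomp v1 (gcomp x z)))"
      by (simp add: gcomp_assoc)
    also have "homotopic X4 N \<dots> (gcomp g2 (gcomp v2 (gcomp x z)))"
      using homotopic_comp_right[OF homotopic_comp_right[OF V(6) x] zd] by (simp add: gcomp_assoc)
    also have "homotopic X4 N \<dots> (gcomp (gcomp g2 w2') (gcomp C z))"
      using homotopic_comp_left[OF P(4) X4 sq4 dg_hom_comp[OF zd dg_hom_comp[OF x V(3)]]
          dg_hom_comp[OF zd dg_hom_comp[OF C W2(3)]] g(2)]
      by (simp add: gcomp_assoc)
    finally show ?thesis .
  qed
  have "quasi_iso X4 L (gcomp (gcomp s1 w1) (gcomp A z))"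
    by (rule quasi_iso_comp[OF X4 W1(1) L quasi_iso_comp[OF X4 X3 W1(1) z A] quasi_iso_comp[OF W1(1) P(1) L W1(2) s(1)]])
  then show ?thesis
    using X4 dg_hom_comp[OF zd Ad] dg_hom_comp[OF zd C] 1 2 by (intro roof_eqI)
qed

lemma is_roof_comp:
  assumes "dg_module L" "is_roof L M (P, s, f)" "is_roof M N (Q, t, g)"
    "dg_module W" "quasi_iso W P w" "dg_hom W Q w'"
  shows "is_roof L N (W, gcomp s w, gcomp g w')"
  using assms by (auto simp: is_roof_simps intro: quasi_iso_comp dg_hom_comp)

text \<open>All members of the union that defines the composite are the same class, so a single Ore
  square computes it.\<close>

lemma DComp_roof_class:
  assumes L: "dg_module L" and M: "dg_module M" and N: "dg_module N"
    and r: "is_roof L M (P, s, f)" and q: "is_roof M N (Q, t, g)"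
    and W: "dg_module W" "quasi_iso W P w" "dg_hom W Q w'" "homotopic W M (gcomp f w) (gcomp t w')"
  shows "DComp L M N (roof_class M N (Q, t, g)) (roof_class L M (P, s, f)) =
    roof_class L N (W, gcomp s w, gcomp g w')"
proof
  show "DComp L M N (roof_class M N (Q, t, g)) (roof_class L M (P, s, f)) \<subseteq>
    roof_class L N (W, gcomp s w, gcomp g w')"
    unfolding DComp_def
  proof (rule Union_least, clarify)
    fix P' s' f' Q' t' g' W' w1 w2 a aa b
    assume P': "(P', s', f') \<in> roof_class L M (P, s, f)" and Q': "(Q', t', g') \<in> roof_class M N (Q, t, g)"
      and W': "dg_module W'" "quasi_iso W' P' w1" "dg_hom W' Q' w2" "homotopic W' M (gcomp f' w1) (gcomp t' w2)"
      and mem: "(a, aa, b) \<in> roof_class L N (W', gcomp s' w1, gcomp g' w2)"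
    have r': "is_roof L M (P', s', f')" "roof_eq L M (P, s, f) (P', s', f')"
      and q': "is_roof M N (Q', t', g')" "roof_eq M N (Q, t, g) (Q', t', g')"
      using P' Q' by (auto simp: roof_class_def)
    have "roof_class L N (W, gcomp s w, gcomp g w') = roof_class L N (W', gcomp s' w1, gcomp g' w2)"
      using roof_composite_unique[OF L M N r r' q q' W W'] is_roof_comp[OF L r q W(1-3)]
        is_roof_comp[OF L r'(1) q'(1) W'(1-3)]
      by (intro roof_class_eqI[OF L N])
    then show "(a, aa, b) \<in> roof_class L N (W, gcomp s w, gcomp g w')"
      using mem by simp
  qed
  show "roof_class L N (W, gcomp s w, gcomp g w') \<subseteq>
    DComp L M N (roof_class M N (Q, t, g)) (roof_class L M (P, s, f))"
    unfolding DComp_def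
    using roof_class_self[OF L M r] roof_class_self[OF M N q] W
    by (intro Union_upper) blast
qed

section \<open>Isomorphisms of the derived category\<close>

definition derived_iso :: "('k::field, 'u) dgm \<Rightarrow> ('k, 'u) dgm \<Rightarrow> bool" where
  "derived_iso A B \<longleftrightarrow> (\<exists>f \<in> kcarrier (DHom A B). \<exists>g \<in> kcarrier (DHom B A).
     DComp A B A g f = DMor A A gid \<and> DComp B A B f g = DMor B B gid)"

lemma isomorphic_in_DR_iff:
  "isomorphic_in DR A B \<longleftrightarrow> dg_module A \<and> dg_module B \<and> derived_iso A B"
  by (simp add: isomorphic_in_def derived_iso_def DR_def)

lemma isomorphic_in_Df_iff:
  "isomorphic_in Df A B \<longleftrightarrow> dg_module A \<and> finite_total_cohomology A \<and>
     dg_module B \<and> finite_total_cohomology B \<and> derived_iso A B"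
  by (auto simp: isomorphic_in_def derived_iso_def Df_def full_subcategory_def DR_def)

lemma derived_iso_sym: "derived_iso A B \<Longrightarrow> derived_iso B A"
  unfolding derived_iso_def by blast

text \<open>The roof and its reversal are mutually inverse. Both composites are computed with the
  identity square on \<open>P\<close> and become identities after refinement along a leg.\<close>

lemma derived_iso_roof:
  assumes M: "dg_module M" and N: "dg_module N" and P: "dg_module P"
    and s: "quasi_iso P M s" and t: "quasi_iso P N t"
  shows "derived_iso M N"
proof -
  note sd = quasi_iso_dg_hom[OF s] and td = quasi_iso_dg_hom[OF t]
  have inv: "DComp M N M (roof_class N M (P, t, s)) (roof_class M N (P, s, t)) = DMor M M gid"
    if M: "dg_module M" and N: "dg_module N" and s: "quasi_iso P M s" and t: "quasi_iso P N t"
    for M N :: "('a, 'b) dgm" and s t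
  proof -
    note sd = quasi_iso_dg_hom[OF s] and td = quasi_iso_dg_hom[OF t]
    have "DComp M N M (roof_class N M (P, t, s)) (roof_class M N (P, s, t)) =
      roof_class M M (P, gcomp s gid, gcomp s gid)"
      by (rule DComp_roof_class[OF M N M])
        (simp_all add: is_roof_simps P s t sd td quasi_iso_id dg_hom_id homotopic_refl N)
    also have "\<dots> = DMor M M gid"
      unfolding DMor_def
    proof (rule roof_class_eqI[OF M M])
      show "roof_eq M M (P, gcomp s gid, gcomp s gid) (M, gid, gid)"
        using P s sd by (intro roof_eqI[of P _ gid _ s]) (simp_all add: dg_hom_id homotopic_refl M)
    qed (simp_all add: is_roof_simps P s sd M quasi_iso_id dg_hom_id)
    finally show ?thesis .
  qed
  have "roof_class M N (P, s, t) \<in> kcarrier (DHom M N)" "roof_class N M (P, t, s) \<in> kcarrier (DHom N M)"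
    using P s t sd td by (auto simp: DHom_def is_roof_simps intro!: imageI)
  then show ?thesis
    unfolding derived_iso_def using inv[OF M N s t] inv[OF N M t s] by blast
qed

text \<open>Only vanishing of cohomology in one degree is transported, so a cohomology functor on
  \<open>D(R)\<close> is never constructed. Up to a coboundary, a cocycle of \<open>L\<close> is the
  image of one under a map that passes through \<open>Q\<close>, and the cohomology of
  \<open>Q\<close> in degree \<open>i\<close> vanishes with that of \<open>M\<close>.\<close>

lemma derived_iso_exact:
  assumes L: "dg_module L" and M: "dg_module M" and iso: "derived_iso L M"
    and ex: "cocycles M i \<subseteq> coboundaries M i"
  shows "cocycles L i \<subseteq> coboundaries L i"
proof
  fix x assume x: "x \<in> cocycles L i"
  obtain P s f Q t g where r: "is_roof L M (P, s, f)" and q: "is_roof M L (Q, t, g)"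
    and id: "DComp L M L (roof_class M L (Q, t, g)) (roof_class L M (P, s, f)) = DMor L L gid"
    using iso by (auto simp: derived_iso_def DHom_def)
  have P: "dg_module P" "quasi_iso P L s" "dg_hom P M f" and Q: "dg_module Q" "quasi_iso Q M t" "dg_hom Q L g"
    using r q by (simp_all add: is_roof_simps)
  note td = quasi_iso_dg_hom[OF Q(2)]
  obtain W w w' where W: "dg_module W" "quasi_iso W P w" "dg_hom W Q w'"
    and sq: "homotopic W M (gcomp t w') (gcomp f w)"
    by (rule ore_square[OF P(1) Q(1) M Q(2) P(3)])
  note wd = quasi_iso_dg_hom[OF W(2)]
  have "roof_class L L (W, gcomp s w, gcomp g w') = roof_class L L (L, gid, gid)"
    using DComp_roof_class[OF L M L r q W homotopic_sym[OF W(1) M sq]] id by (simp add: DMor_def)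
  then have "roof_eq L L (L, gid, gid) (W, gcomp s w, gcomp g w')"
    using roof_class_self[OF L L is_roof_comp[OF L r q W]] by (simp add: roof_class_def)
  then obtain U u u' where U: "dg_module U" "dg_hom U L u" "dg_hom U W u'" "quasi_iso U L (gcomp gid u)"
    "homotopic U L (gcomp gid u) (gcomp (gcomp g w') u')"
    by (elim roof_eqE) blast
  obtain z where z: "z \<in> cocycles U i" "u i z - x \<in> coboundaries L i"
    using quasi_iso_surj[OF U(4) x] by (auto simp: gcomp_def gid_def)
  have z': "u' i z \<in> cocycles W i"
    by (rule dg_hom_cocycle[OF U(1) W(1) U(3) z(1)])
  have wz: "w' i (u' i z) \<in> cocycles Q i"
    by (rule dg_hom_cocycle[OF W(1) Q(1) W(3) z'])
  have "t i (w' i (u' i z)) \<in> coboundaries M i"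
    using dg_hom_cocycle[OF Q(1) M td wz] ex by blast
  then have "w' i (u' i z) \<in> coboundaries Q i"
    by (rule quasi_iso_inj[OF Q(2) wz])
  then have "g i (w' i (u' i z)) \<in> coboundaries L i"
    by (rule dg_hom_coboundary[OF Q(3)])
  moreover have "u i z - g i (w' i (u' i z)) \<in> coboundaries L i"
    using homotopic_cohomologous[OF U(1) U(5) z(1)] by (simp add: gcomp_def gid_def)
  ultimately have "u i z \<in> coboundaries L i"
    using cob_simps(2)[OF L] by fastforce
  then show "x \<in> coboundaries L i"
    using cob_simps(3)[OF L _ z(2)] by fastforce
qed

section \<open>Morphisms out of h-projective modules\<close>

lemma h_projective_unique:
  assumes Z: "h_projective Z" and N: "dg_module N" and N': "dg_module N'"
    and t: "quasi_iso N N' t" and g: "dg_hom Z N g" and g': "dg_hom Z N g'"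
    and eq: "homotopic Z N' (gcomp t g) (gcomp t g')"
  shows "homotopic Z N g g'"
proof -
  have ZM: "dg_module Z"
    using Z by (simp add: h_projective_def)
  have td: "dg_hom N N' t"
    by (rule quasi_iso_dg_hom[OF t])
  have "homotopic Z N' (\<lambda>i x. gcomp t g i x - gcomp t g' i x) (\<lambda>i x. 0)"
    by (rule homotopic_diff_zero_iff[OF ZM N', THEN iffD2, OF eq])
  moreover have "homotopic Z N' (gcomp t (\<lambda>i x. g i x - g' i x)) (\<lambda>i x. gcomp t g i x - gcomp t g' i x)"
    by (rule homotopic_cong[OF N'])
      (simp add: gcomp_def dg_hom_simps[OF td N] dg_hom_in[OF g] dg_hom_in[OF g'])
  ultimately have "homotopic Z N' (gcomp t (\<lambda>i x. g i x - g' i x)) (\<lambda>i x. 0)"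
    using homotopic_trans[OF ZM N'] by blast
  then have "homotopic Z N (\<lambda>i x. g i x - g' i x) (\<lambda>i x. 0)"
    by (rule h_projective_cancel[OF Z N N' t dg_hom_diff[OF ZM N g g']])
  then show ?thesis
    by (rule homotopic_diff_zero_iff[OF ZM N, THEN iffD1])
qed

text \<open>The roofs \<open>M \<leftarrow> P \<rightarrow> N\<close> are classified by the scalar \<open>c\<close> such that the lift of \<open>q\<close> to \<open>P\<close> followed
  by \<open>P \<rightarrow> N\<close> is homotopic to \<open>c g0\<close>.\<close>

locale hom_generator =
  fixes Z M N :: "('k::field, 'u) dgm" and q g0 :: "('k, 'u) gmap"
  assumes Z: "h_projective Z" and M: "dg_module M" and N: "dg_module N"
    and q: "quasi_iso Z M q" and g0: "dg_hom Z N g0"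
    and gen: "\<And>g. dg_hom Z N g \<Longrightarrow> \<exists>c. homotopic Z N g (\<lambda>i x. vscale c (g0 i x))"
begin

text \<open>A relation and not a function, since the scalar is unique only when \<open>g0\<close> is
  not null-homotopic.\<close>

definition val :: "('k, 'u) roof \<Rightarrow> 'k \<Rightarrow> bool" where
  "val = (\<lambda>(P, s, f) c. \<exists>g. dg_hom Z P g \<and> homotopic Z M (gcomp s g) q \<and>
     homotopic Z N (gcomp f g) (\<lambda>i x. vscale c (g0 i x)))"

lemma ZM: "dg_module Z"
  using Z by (simp add: h_projective_def)

lemma val_exists:
  assumes "is_roof M N (P, s, f)"
  shows "\<exists>c. val (P, s, f) c"
proof -
  have P: "dg_module P" "quasi_iso P M s" "dg_hom P N f"
    using assms by (simp_all add: is_roof_simps)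
  obtain g where g: "dg_hom Z P g" "homotopic Z M (gcomp s g) q"
    by (rule h_projective_lift[OF Z P(1) M P(2) quasi_iso_dg_hom[OF q]])
  obtain c where "homotopic Z N (gcomp f g) (\<lambda>i x. vscale c (g0 i x))"
    using gen[OF dg_hom_comp[OF g(1) P(3)]] by blast
  then show ?thesis
    unfolding val_def using g by blast
qed

text \<open>Lifts of \<open>q\<close> through the quasi-isomorphism \<open>s\<close> are unique up
  to homotopy, so the choice made in \<open>val\<close> does not matter.\<close>

lemma val_any_lift:
  assumes "is_roof M N (P, s, f)" "val (P, s, f) c" "dg_hom Z P g" "homotopic Z M (gcomp s g) q"
  shows "homotopic Z N (gcomp f g) (\<lambda>i x. vscale c (g0 i x))"
proof -
  have P: "dg_module P" "quasi_iso P M s" "dg_hom P N f"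
    using assms by (simp_all add: is_roof_simps)
  obtain g' where g': "dg_hom Z P g'" "homotopic Z M (gcomp s g') q"
      "homotopic Z N (gcomp f g') (\<lambda>i x. vscale c (g0 i x))"
    using assms(2) unfolding val_def by blast
  have "homotopic Z M (gcomp s g) (gcomp s g')"
    by (rule homotopic_trans[OF ZM M assms(4) homotopic_sym[OF ZM M g'(2)]])
  then have "homotopic Z P g g'"
    by (rule h_projective_unique[OF Z P(1) M P(2) assms(3) g'(1)])
  then have "homotopic Z N (gcomp f g) (gcomp f g')"
    by (rule homotopic_comp_left[OF P(1) ZM _ assms(3) g'(1) P(3)])
  then show ?thesis
    using homotopic_trans[OF ZM N _ g'(3)] by blast
qed

text \<open>A lift of \<open>q\<close> to the common refinement induces lifts to both roofs, with
  homotopic composites to \<open>N\<close>.\<close>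

lemma val_roof_eq:
  assumes r: "is_roof M N (P, s, f)" and r': "is_roof M N (P', s', f')"
    and eq: "roof_eq M N (P, s, f) (P', s', f')" and v: "val (P, s, f) c"
  shows "val (P', s', f') c"
proof -
  obtain Q u u' where Q: "dg_module Q" "dg_hom Q P u" "dg_hom Q P' u'" "quasi_iso Q M (gcomp s u)"
    "homotopic Q M (gcomp s u) (gcomp s' u')" "homotopic Q N (gcomp f u) (gcomp f' u')"
    using eq by (rule roof_eqE)
  obtain z where z: "dg_hom Z Q z" "homotopic Z M (gcomp (gcomp s u) z) q"
    by (rule h_projective_lift[OF Z Q(1) M Q(4) quasi_iso_dg_hom[OF q]])
  have 1: "homotopic Z N (gcomp f (gcomp u z)) (\<lambda>i x. vscale c (g0 i x))"
    using z(2) by (intro val_any_lift[OF r v dg_hom_comp[OF z(1) Q(2)]]) (simp add: gcomp_assoc)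
  have "homotopic Z M (gcomp s' (gcomp u' z)) q"
    using homotopic_trans[OF ZM M homotopic_sym[OF ZM M homotopic_comp_right[OF Q(5) z(1)]] z(2)]
    by (simp add: gcomp_assoc)
  moreover have "homotopic Z N (gcomp f' (gcomp u' z)) (\<lambda>i x. vscale c (g0 i x))"
    using homotopic_trans[OF ZM N homotopic_sym[OF ZM N homotopic_comp_right[OF Q(6) z(1)]]] 1
    by (simp add: gcomp_assoc)
  ultimately show ?thesis
    unfolding val_def using dg_hom_comp[OF z(1) Q(3)] by blast
qed

text \<open>\<open>Z\<close> with the two lifts is itself a common refinement.\<close>

lemma roof_eq_if_val:
  assumes r: "is_roof M N (P, s, f)" and r': "is_roof M N (P', s', f')"
    and v: "val (P, s, f) c" and v': "val (P', s', f') c"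
  shows "roof_eq M N (P, s, f) (P', s', f')"
proof -
  obtain g where g: "dg_hom Z P g" "homotopic Z M (gcomp s g) q"
      "homotopic Z N (gcomp f g) (\<lambda>i x. vscale c (g0 i x))"
    using v unfolding val_def by blast
  obtain g' where g': "dg_hom Z P' g'" "homotopic Z M (gcomp s' g') q"
      "homotopic Z N (gcomp f' g') (\<lambda>i x. vscale c (g0 i x))"
    using v' unfolding val_def by blast
  have "dg_hom P M s"
    using r by (simp add: is_roof_simps quasi_iso_dg_hom)
  then have "quasi_iso Z M (gcomp s g)"
    by (intro quasi_iso_homotopic[OF ZM M q homotopic_sym[OF ZM M g(2)]] dg_hom_comp[OF g(1)])
  moreover have "homotopic Z M (gcomp s g) (gcomp s' g')"
    by (rule homotopic_trans[OF ZM M g(2) homotopic_sym[OF ZM M g'(2)]])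
  moreover have "homotopic Z N (gcomp f g) (gcomp f' g')"
    by (rule homotopic_trans[OF ZM N g(3) homotopic_sym[OF ZM N g'(3)]])
  ultimately show ?thesis
    using ZM g(1) g'(1) by (intro roof_eqI)
qed

definition T :: "'k \<Rightarrow> ('k, 'u) roof set" where
  "T c = roof_class M N (Z, q, \<lambda>i x. vscale c (g0 i x))"

lemma std_roof: "is_roof M N (Z, q, \<lambda>i x. vscale c (g0 i x))"
  using ZM q dg_hom_scale[OF ZM N g0] by (simp add: is_roof_simps)

lemma val_std: "val (Z, q, \<lambda>i x. vscale c (g0 i x)) c"
  unfolding val_def using dg_hom_id[of Z] homotopic_refl[OF M, of Z q]
    homotopic_refl[OF N, of Z "\<lambda>i x. vscale c (g0 i x)"]
  by (auto intro!: exI[of _ gid])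

lemma mem_T_iff: "(P, s, f) \<in> T c \<longleftrightarrow> is_roof M N (P, s, f) \<and> val (P, s, f) c"
  unfolding T_def roof_class_def
  using val_roof_eq[OF std_roof _ _ val_std] roof_eq_if_val[OF std_roof _ val_std] by auto

lemma T_eq:
  assumes "is_roof M N (P, s, f)" "val (P, s, f) c"
  shows "roof_class M N (P, s, f) = T c"
  unfolding T_def
  by (intro roof_class_eqI[OF M N] roof_eq_if_val[OF _ _ assms(2) val_std] assms(1) std_roof)

lemma kcarrier_DHom: "kcarrier (DHom M N) = range T"
proof
  show "kcarrier (DHom M N) \<subseteq> range T"
  proof
    fix F assume "F \<in> kcarrier (DHom M N)"
    then obtain P s f where F: "F = roof_class M N (P, s, f)" and r: "is_roof M N (P, s, f)"
      by (auto simp: DHom_def)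
    obtain c where "val (P, s, f) c"
      using val_exists[OF r] by blast
    then show "F \<in> range T"
      using T_eq[OF r] F by blast
  qed
  show "range T \<subseteq> kcarrier (DHom M N)"
    using std_roof by (auto simp: DHom_def T_def)
qed

lemma kadd_DHom: "kadd (DHom M N) (T a) (T b) = T (a + b)"
proof -
  have eq: "roof_class M N (P, s, \<lambda>i x. f i x + g i x) = T (a + b)"
    if f: "(P, s, f) \<in> T a" and g: "(P, s, g) \<in> T b" for P s f g
  proof -
    have r: "is_roof M N (P, s, f)" "is_roof M N (P, s, g)" and v: "val (P, s, f) a" "val (P, s, g) b"
      using f g by (simp_all add: mem_T_iff)
    have P: "dg_module P" "dg_hom P N f" "dg_hom P N g"
      using r by (simp_all add: is_roof_simps)
    obtain z where z: "dg_hom Z P z" "homotopic Z M (gcomp s z) q"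
      using v(1) unfolding val_def by blast
    have "homotopic Z N (\<lambda>i x. gcomp f z i x + gcomp g z i x) (\<lambda>i x. vscale a (g0 i x) + vscale b (g0 i x))"
      by (rule homotopic_add[OF ZM N val_any_lift[OF r(1) v(1) z] val_any_lift[OF r(2) v(2) z]])
    then have "homotopic Z N (gcomp (\<lambda>i x. f i x + g i x) z) (\<lambda>i x. vscale (a + b) (g0 i x))"
      unfolding gcomp_def vec.scale_left_distrib .
    then have "val (P, s, \<lambda>i x. f i x + g i x) (a + b)"
      unfolding val_def using z by blast
    then show ?thesis
      using r dg_hom_add[OF P(1) N P(2,3)] by (intro T_eq) (simp add: is_roof_simps)
  qed
  have mem: "(Z, q, \<lambda>i x. vscale c (g0 i x)) \<in> T c" for c
    by (simp add: mem_T_iff std_roof val_std)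
  \<comment> \<open>All classes in the union coincide, and the standard representatives, which share
    the apex \<open>Z\<close>, show that it is not empty.\<close>
  have "{roof_class M N (P, s, \<lambda>i x. f i x + g i x) | P s f g. (P, s, f) \<in> T a \<and> (P, s, g) \<in> T b} = {T (a + b)}"
    (is "?S = _")
  proof
    show "?S \<subseteq> {T (a + b)}"
      using eq by blast
    have "roof_class M N (Z, q, \<lambda>i x. vscale a (g0 i x) + vscale b (g0 i x)) \<in> ?S"
      using mem by (intro CollectI exI[of _ Z] exI[of _ q] exI[of _ "\<lambda>i x. vscale a (g0 i x)"]
          exI[of _ "\<lambda>i x. vscale b (g0 i x)"] conjI refl)
    then show "{T (a + b)} \<subseteq> ?S"
      unfolding eq[OF mem mem] by simp
  qed
  then show ?thesis
    by (simp add: DHom_def)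
qed

lemma ksmult_DHom: "ksmult (DHom M N) a (T b) = T (a * b)"
proof -
  have eq: "roof_class M N (P, s, \<lambda>i x. vscale a (f i x)) = T (a * b)" if f: "(P, s, f) \<in> T b" for P s f
  proof -
    have r: "is_roof M N (P, s, f)" and v: "val (P, s, f) b"
      using f by (simp_all add: mem_T_iff)
    have P: "dg_module P" "dg_hom P N f"
      using r by (simp_all add: is_roof_simps)
    obtain z where z: "dg_hom Z P z" "homotopic Z M (gcomp s z) q"
      using v(1) unfolding val_def by blast
    have "homotopic Z N (\<lambda>i x. vscale a (gcomp f z i x)) (\<lambda>i x. vscale a (vscale b (g0 i x)))"
      by (rule homotopic_scale[OF ZM N val_any_lift[OF r(1) v(1) z]])
    then have "homotopic Z N (gcomp (\<lambda>i x. vscale a (f i x)) z) (\<lambda>i x. vscale (a * b) (g0 i x))"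
      unfolding gcomp_def vec.scale_scale .
    then have "val (P, s, \<lambda>i x. vscale a (f i x)) (a * b)"
      unfolding val_def using z by blast
    then show ?thesis
      using r dg_hom_scale[OF P(1) N P(2)] by (intro T_eq) (simp add: is_roof_simps)
  qed
  have mem: "(Z, q, \<lambda>i x. vscale b (g0 i x)) \<in> T b"
    by (simp add: mem_T_iff std_roof val_std)
  have "{roof_class M N (P, s, \<lambda>i x. vscale a (f i x)) | P s f. (P, s, f) \<in> T b} = {T (a * b)}"
    (is "?S = _")
  proof
    show "?S \<subseteq> {T (a * b)}"
      using eq by blast
    have "roof_class M N (Z, q, \<lambda>i x. vscale a (vscale b (g0 i x))) \<in> ?S"
      using mem by (intro CollectI exI[of _ Z] exI[of _ q] exI[of _ "\<lambda>i x. vscale b (g0 i x)"] conjI refl)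
    then show "{T (a * b)} \<subseteq> ?S"
      unfolding eq[OF mem] by simp
  qed
  then show ?thesis
    by (simp add: DHom_def)
qed

lemma DHom_line:
  assumes "\<not> homotopic Z N g0 (\<lambda>i x. 0)"
  shows "kspace_iso (DHom M N) k_line"
proof -
  have inj: "inj T"
  proof (rule injI, rule ccontr)
    fix a b assume ab: "T a = T b" "a \<noteq> b"
    have "val (Z, q, \<lambda>i x. vscale a (g0 i x)) b"
      using ab(1) mem_T_iff[of Z q _ a] mem_T_iff[of Z q _ b] std_roof val_std by blast
    from val_any_lift[OF std_roof this dg_hom_id]
    have "homotopic Z N (\<lambda>i x. vscale a (g0 i x)) (\<lambda>i x. vscale b (g0 i x))"
      by (simp add: homotopic_refl[OF M])
    then have "homotopic Z N (\<lambda>i x. vscale a (g0 i x) - vscale b (g0 i x)) (\<lambda>i x. 0)"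
      by (rule homotopic_diff_zero_iff[OF ZM N, THEN iffD2])
    then have "homotopic Z N (\<lambda>i x. vscale (a - b) (g0 i x)) (\<lambda>i x. 0)"
      unfolding vec.scale_left_diff_distrib .
    from homotopic_scale[OF ZM N this, of "inverse (a - b)"]
    show False
      using ab(2) assms by simp
  qed
  define \<phi> where "\<phi> = inv T"
  have \<phi>: "\<phi> (T c) = c" for c
    unfolding \<phi>_def using inj by simp
  have "bij_betw \<phi> (range T) UNIV"
    unfolding \<phi>_def using inj by (simp add: bij_betw_inv_into inj_imp_bij_betw_inv)
  then show ?thesis
    unfolding kspace_iso_def kcarrier_DHom k_line_def
    by (intro exI[of _ \<phi>]) (auto simp: \<phi> kadd_DHom ksmult_DHom)
qed

lemma DHom_zero:
  assumes "homotopic Z N g0 (\<lambda>i x. 0)"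
  shows "kspace_iso (DHom M N) k_zero"
proof -
  have const: "T a = T 0" for a
  proof -
    have "homotopic Z N (\<lambda>i x. vscale a (g0 i x)) (\<lambda>i x. vscale 0 (g0 i x))"
      using homotopic_scale[OF ZM N assms, of a] by simp
    then have "val (Z, q, \<lambda>i x. vscale a (g0 i x)) 0"
      unfolding val_def using dg_hom_id[of Z] homotopic_refl[OF M, of Z q] by (auto intro!: exI[of _ gid])
    from T_eq[OF std_roof this] show ?thesis
      by (simp add: T_def)
  qed
  have "range T = {T 0}"
    using const by blast
  then show ?thesis
    unfolding kspace_iso_def kcarrier_DHom k_zero_def
    by (intro exI[of _ "\<lambda>_. 0"]) (auto simp: bij_betw_def)
qed

end

text \<open>The space of homotopy classes of maps \<open>Z \<rightarrow> N\<close> has dimension \<open>1\<close> if \<open>b\<close> holds and \<open>0\<close> otherwise.\<close>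

definition hom_spanned :: "('k::field, 'u) dgm \<Rightarrow> ('k, 'u) dgm \<Rightarrow> bool \<Rightarrow> bool" where
  "hom_spanned Z N b \<longleftrightarrow> (\<exists>g0. dg_hom Z N g0 \<and>
     (\<forall>g. dg_hom Z N g \<longrightarrow> (\<exists>c. homotopic Z N g (\<lambda>i x. vscale c (g0 i x)))) \<and>
     (b \<longleftrightarrow> \<not> homotopic Z N g0 (\<lambda>i x. 0)))"

lemma DHom_if_hom_spanned:
  assumes "h_projective Z" "dg_module M" "dg_module N" "quasi_iso Z M q" "hom_spanned Z N b"
  shows "kspace_iso (DHom M N) (if b then k_line else k_zero)"
proof -
  obtain g0 where h0: "dg_hom Z N g0" "b \<longleftrightarrow> \<not> homotopic Z N g0 (\<lambda>i x. 0)"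
    and gen: "\<And>g. dg_hom Z N g \<Longrightarrow> \<exists>c. homotopic Z N g (\<lambda>i x. vscale c (g0 i x))"
    using assms(5) unfolding hom_spanned_def by blast
  interpret hom_generator Z M N q g0
    by unfold_locales (use assms h0 gen in auto)
  show ?thesis
    using DHom_line DHom_zero h0(2) by simp
qed

lemma gcomp_vscale:
  assumes "dg_hom M N t" "dg_module M" "\<And>i x. x \<in> gr Z i \<Longrightarrow> g i x \<in> gr M i" "dg_module N"
  shows "homotopic Z N (gcomp t (\<lambda>i x. vscale c (g i x))) (\<lambda>i x. vscale c (gcomp t g i x))"
  by (rule homotopic_cong[OF assms(4)]) (simp add: gcomp_def dg_hom_simps[OF assms(1,2)] assms(3))

text \<open>Composition with a quasi-isomorphism is bijective on homotopy classes of maps out of an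
  h-projective module. Here the dimension is known at the source of \<open>t\<close> and is carried
  to its target.\<close>

lemma hom_spanned_source:
  assumes Z: "h_projective Z" and N: "dg_module N" and N': "dg_module N'" and t: "quasi_iso N N' t"
    and "hom_spanned Z N b"
  shows "hom_spanned Z N' b"
proof -
  have ZM: "dg_module Z"
    using Z by (simp add: h_projective_def)
  note td = quasi_iso_dg_hom[OF t]
  obtain g0 where g0: "dg_hom Z N g0" "b \<longleftrightarrow> \<not> homotopic Z N g0 (\<lambda>i x. 0)"
    and gen: "\<And>g. dg_hom Z N g \<Longrightarrow> \<exists>c. homotopic Z N g (\<lambda>i x. vscale c (g0 i x))"
    using assms(5) unfolding hom_spanned_def by blast
  have "\<exists>c. homotopic Z N' g (\<lambda>i x. vscale c (gcomp t g0 i x))" if g: "dg_hom Z N' g" for g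
  proof -
    obtain g' where g': "dg_hom Z N g'" "homotopic Z N' (gcomp t g') g"
      by (rule h_projective_lift[OF Z N N' t g])
    obtain c where c: "homotopic Z N g' (\<lambda>i x. vscale c (g0 i x))"
      using gen[OF g'(1)] by blast
    note [trans] = homotopic_trans[OF ZM N']
    have "homotopic Z N' g (gcomp t g')"
      by (rule homotopic_sym[OF ZM N' g'(2)])
    also have "homotopic Z N' \<dots> (gcomp t (\<lambda>i x. vscale c (g0 i x)))"
      by (rule homotopic_comp_left[OF N ZM c g'(1) dg_hom_scale[OF ZM N g0(1)] td])
    also have "homotopic Z N' \<dots> (\<lambda>i x. vscale c (gcomp t g0 i x))"
      by (rule gcomp_vscale[OF td N dg_hom_in[OF g0(1)] N'])
    finally show ?thesis
      by blast
  qed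
  moreover have "homotopic Z N' (gcomp t g0) (\<lambda>i x. 0) \<longleftrightarrow> homotopic Z N g0 (\<lambda>i x. 0)"
  proof
    show "homotopic Z N g0 (\<lambda>i x. 0)" if "homotopic Z N' (gcomp t g0) (\<lambda>i x. 0)"
      by (rule h_projective_cancel[OF Z N N' t g0(1) that])
    show "homotopic Z N' (gcomp t g0) (\<lambda>i x. 0)" if "homotopic Z N g0 (\<lambda>i x. 0)"
      using homotopic_comp_left[OF N ZM that g0(1) dg_hom_zero[OF N] td]
      unfolding gcomp_def dg_hom_simps(3)[OF td N] .
  qed
  ultimately show ?thesis
    unfolding hom_spanned_def using dg_hom_comp[OF g0(1) td] g0(2) by blast
qed

text \<open>The dimension is known at the target of \<open>t\<close>; the spanning map is lifted
  back along \<open>t\<close>.\<close>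

lemma hom_spanned_target:
  assumes Z: "h_projective Z" and N: "dg_module N" and N': "dg_module N'" and t: "quasi_iso N N' t"
    and "hom_spanned Z N' b"
  shows "hom_spanned Z N b"
proof -
  have ZM: "dg_module Z"
    using Z by (simp add: h_projective_def)
  note td = quasi_iso_dg_hom[OF t]
  obtain g1 where g1: "dg_hom Z N' g1" "b \<longleftrightarrow> \<not> homotopic Z N' g1 (\<lambda>i x. 0)"
    and gen: "\<And>g. dg_hom Z N' g \<Longrightarrow> \<exists>c. homotopic Z N' g (\<lambda>i x. vscale c (g1 i x))"
    using assms(5) unfolding hom_spanned_def by blast
  obtain g0 where g0: "dg_hom Z N g0" "homotopic Z N' (gcomp t g0) g1"
    by (rule h_projective_lift[OF Z N N' t g1(1)])
  have "\<exists>c. homotopic Z N g (\<lambda>i x. vscale c (g0 i x))" if g: "dg_hom Z N g" for g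
  proof -
    obtain c where c: "homotopic Z N' (gcomp t g) (\<lambda>i x. vscale c (g1 i x))"
      using gen[OF dg_hom_comp[OF g td]] by blast
    note [trans] = homotopic_trans[OF ZM N']
    note c
    also have "homotopic Z N' (\<lambda>i x. vscale c (g1 i x)) (\<lambda>i x. vscale c (gcomp t g0 i x))"
      by (rule homotopic_scale[OF ZM N' homotopic_sym[OF ZM N' g0(2)]])
    also have "homotopic Z N' \<dots> (gcomp t (\<lambda>i x. vscale c (g0 i x)))"
      by (rule homotopic_sym[OF ZM N' gcomp_vscale[OF td N dg_hom_in[OF g0(1)] N']])
    finally show ?thesis
      using h_projective_unique[OF Z N N' t g dg_hom_scale[OF ZM N g0(1)]] by blast
  qed
  moreover have "homotopic Z N' g1 (\<lambda>i x. 0) \<longleftrightarrow> homotopic Z N g0 (\<lambda>i x. 0)"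
  proof
    show "homotopic Z N g0 (\<lambda>i x. 0)" if "homotopic Z N' g1 (\<lambda>i x. 0)"
      by (rule h_projective_cancel[OF Z N N' t g0(1) homotopic_trans[OF ZM N' g0(2) that]])
    show "homotopic Z N' g1 (\<lambda>i x. 0)" if "homotopic Z N g0 (\<lambda>i x. 0)"
    proof -
      have "homotopic Z N' (gcomp t g0) (\<lambda>i x. 0)"
        using homotopic_comp_left[OF N ZM that g0(1) dg_hom_zero[OF N] td]
        unfolding gcomp_def dg_hom_simps(3)[OF td N] .
      then show ?thesis
        using homotopic_trans[OF ZM N' homotopic_sym[OF ZM N' g0(2)]] by blast
    qed
  qed
  ultimately show ?thesis
    unfolding hom_spanned_def using g0(1) g1(2) by blast
qed

section \<open>Semifree modules\<close>

text \<open>The code places the generators of a semifree module into the factor \<open>nat\<close>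
  of the universe, whatever the type \<open>'u\<close> is.\<close>

class coded =
  fixes code :: "'a \<Rightarrow> nat"
  assumes inj_code: "inj code"

text \<open>Coefficient families become vectors that are constant in the argument of type
  \<open>'u\<close>.\<close>

definition fv :: "('b::coded \<Rightarrow> 'k::field) \<Rightarrow> ('k, 'u) vec" where
  "fv c = (\<lambda>(u, m). if m \<in> range (code :: 'b \<Rightarrow> nat) then c (inv code m) else 0)"

text \<open>Vectors of the form \<open>fv c\<close> do not depend on the first argument, so any
  point, here \<open>undefined\<close>, recovers the coefficients.\<close>

definition co :: "('k::field, 'u) vec \<Rightarrow> 'b::coded \<Rightarrow> 'k" where
  "co v b = v (undefined, code b)"

lemma co_fv [simp]: "co (fv c) = c"
  by (simp add: co_def fv_def inj_code fun_eq_iff)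

lemma fv_eq_iff [simp]: "(fv c :: ('k::field, 'u) vec) = fv c' \<longleftrightarrow> c = c'"
  by (metis co_fv)

lemma fv_add: "fv (c + c') = fv c + fv c'"
  by (auto simp: fv_def fun_eq_iff)

lemma fv_scale: "fv (\<lambda>b. a * c b) = vscale a (fv c)"
  by (auto simp: fv_def vscale_def fun_eq_iff)

lemma fv_zero [simp]: "fv (\<lambda>b. 0) = 0"
  by (auto simp: fv_def fun_eq_iff)

lemma co_add [simp]: "co (v + w) = co v + co w"
  by (simp add: co_def fun_eq_iff)

lemma co_scale [simp]: "co (vscale a v) = (\<lambda>b. a * co v b)"
  by (simp add: co_def vscale_def fun_eq_iff)

lemma co_zero [simp]: "co 0 = (\<lambda>b. 0)"
  by (simp add: co_def fun_eq_iff)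

text \<open>A generator \<open>b\<close> contributes to degree \<open>i\<close> through
  \<open>b\<close> times T to the power \<open>\<delta> b - i\<close>, hence only if
  \<open>i \<le> \<delta> b\<close>.\<close>

definition Fsp :: "('b \<Rightarrow> int) \<Rightarrow> int \<Rightarrow> ('b \<Rightarrow> 'k::field) set" where
  "Fsp \<delta> i = {c. finite {b. c b \<noteq> 0} \<and> (\<forall>b. c b \<noteq> 0 \<longrightarrow> i \<le> \<delta> b)}"

lemma Fsp_add: "c \<in> Fsp \<delta> i \<Longrightarrow> c' \<in> Fsp \<delta> i \<Longrightarrow> c + c' \<in> Fsp \<delta> i"
  unfolding Fsp_def mem_Collect_eq
proof (intro conjI allI impI)
  assume c: "finite {b. c b \<noteq> 0} \<and> (\<forall>b. c b \<noteq> 0 \<longrightarrow> i \<le> \<delta> b)"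
    and c': "finite {b. c' b \<noteq> 0} \<and> (\<forall>b. c' b \<noteq> 0 \<longrightarrow> i \<le> \<delta> b)"
  show "finite {b. (c + c') b \<noteq> 0}"
    by (rule finite_subset[of _ "{b. c b \<noteq> 0} \<union> {b. c' b \<noteq> 0}"]) (use c c' in auto)
  show "i \<le> \<delta> b" if "(c + c') b \<noteq> 0" for b
    using that c c' by (cases "c b = 0") auto
qed

lemma Fsp_scale: "c \<in> Fsp \<delta> i \<Longrightarrow> (\<lambda>b. a * c b) \<in> Fsp \<delta> i"
  unfolding Fsp_def by (auto intro: finite_subset[of _ "{b. c b \<noteq> 0}"])

lemma Fsp_zero: "(\<lambda>b. 0) \<in> Fsp \<delta> i"
  unfolding Fsp_def by auto

lemma Fsp_mono: "c \<in> Fsp \<delta> i \<Longrightarrow> j \<le> i \<Longrightarrow> c \<in> Fsp \<delta> j"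
  unfolding Fsp_def by fastforce

text \<open>One map \<open>d\<close> serves all degrees: \<open>T\<close> acts as an inclusion, so
  \<open>T\<close>-linearity says that the formula for the differential is the same in every
  degree.\<close>

definition sf_dif :: "('b \<Rightarrow> int) \<Rightarrow> (('b \<Rightarrow> 'k::field) \<Rightarrow> ('b \<Rightarrow> 'k)) \<Rightarrow> bool" where
  "sf_dif \<delta> d \<longleftrightarrow> (\<forall>c c'. d (c + c') = d c + d c') \<and> (\<forall>a c. d (\<lambda>b. a * c b) = (\<lambda>b. a * d c b)) \<and>
     (\<forall>i. \<forall>c\<in>Fsp \<delta> i. d c \<in> Fsp \<delta> (i + 1) \<and> d (d c) = (\<lambda>b. 0))"

text \<open>The semifree module on generators \<open>b\<close> of degree \<open>\<delta> b\<close>. Its part of degree \<open>i\<close> has the basis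
  \<open>b T\<^sup>\<delta>\<^sup>b\<^sup>-\<^sup>i\<close> with \<open>\<delta> b \<ge> i\<close>; writing \<open>b\<close> for \<open>b T\<^sup>m\<close> turns multiplication by \<open>T\<close> into an inclusion.\<close>

definition SF :: "('b::coded \<Rightarrow> int) \<Rightarrow> (('b \<Rightarrow> 'k::field) \<Rightarrow> ('b \<Rightarrow> 'k)) \<Rightarrow> ('k, 'u) dgm" where
  "SF \<delta> d = \<lparr> gr = (\<lambda>i. fv ` Fsp \<delta> i), dif = (\<lambda>i x. fv (d (co x))), act = (\<lambda>i x r. vscale (poly r 1) x) \<rparr>"

lemma SF_sel [simp]:
  "gr (SF \<delta> d) i = fv ` Fsp \<delta> i" "dif (SF \<delta> d) i x = fv (d (co x))" "act (SF \<delta> d) i x r = vscale (poly r 1) x"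
  by (simp_all add: SF_def)

text \<open>Evaluation at 1 is multiplicative and yields the coefficient of a monomial. The axioms
  thus reduce to linearity, and closure under \<open>T\<close> is \<open>Fsp_mono\<close>.\<close>

lemma dg_module_SF:
  assumes "sf_dif \<delta> d"
  shows "dg_module (SF \<delta> d)"
proof -
  have add: "d (c + c') = d c + d c'" and sc: "d (\<lambda>b. a * c b) = (\<lambda>b. a * d c b)" for a c c'
    using assms by (simp_all add: sf_dif_def)
  have d: "d c \<in> Fsp \<delta> (i + 1)" "d (d c) = (\<lambda>b. 0)" if "c \<in> Fsp \<delta> i" for c i
    using assms that by (auto simp: sf_dif_def)
  show ?thesis
    unfolding dg_module_def
  proof (intro conjI allI ballI)
    show "vec.subspace (gr (SF \<delta> d) i)" for i
    proof (rule vec.subspaceI)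
      show "0 \<in> gr (SF \<delta> d) i"
        using imageI[OF Fsp_zero, of fv \<delta> i] by simp
    qed (auto simp flip: fv_add fv_scale intro: Fsp_add Fsp_scale)
    show "klinear_on (gr (SF \<delta> d) i) (dif (SF \<delta> d) i)" for i
      unfolding klinear_on_def by (auto simp: add sc fv_add fv_scale)
    show "act (SF \<delta> d) i x r \<in> gr (SF \<delta> d) (i + j)" if "x \<in> gr (SF \<delta> d) i" "r \<in> Rgr j" for i j x r
      using that(2)
    proof (cases rule: RgrE)
      case (1 c m)
      then show ?thesis
        using that(1) by (auto simp flip: fv_scale intro!: imageI Fsp_scale elim!: Fsp_mono)
    next
      case 2
      then show ?thesis
        using imageI[OF Fsp_zero, of fv \<delta> "i + j"] by simp
    qed
    show "klinear_on (gr (SF \<delta> d) i) (\<lambda>x. act (SF \<delta> d) i x r)" for i r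
      by (simp add: klinear_on_def vec.scale_right_distrib vec.scale_left_commute)
    show "dif (SF \<delta> d) (i + j) (act (SF \<delta> d) i x r) = act (SF \<delta> d) (i + 1) (dif (SF \<delta> d) i x) r" for i j x r
      by (simp add: sc fv_scale)
  qed (auto simp: d vec.scale_left_distrib mult.commute)
qed

section \<open>Generators, and linear maps out of semifree modules\<close>

definition gen :: "'b::coded \<Rightarrow> ('k::field, 'u) vec" where
  "gen b = fv (\<lambda>b'. if b' = b then 1 else 0)"

lemma co_gen [simp]: "co (gen b) = (\<lambda>b'. if b' = b then 1 else 0)"
  by (simp add: gen_def)

lemma gen_in: "i \<le> \<delta> b \<Longrightarrow> gen b \<in> gr (SF \<delta> d) i"
  by (auto simp: gen_def Fsp_def)

lemma SF_expand:
  fixes \<delta> :: "'b::coded \<Rightarrow> int" and v :: "('k::field, 'u) vec"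
  assumes "v \<in> gr (SF \<delta> d) i"
  shows "v = (\<Sum>b::'b | co v b \<noteq> 0. vscale (co v b) (gen b))"
proof -
  obtain c :: "'b \<Rightarrow> 'k" where c: "v = fv c" "finite {b. c b \<noteq> 0}"
    using assms by (auto simp: Fsp_def)
  have fin: "finite {b::'b. co v b \<noteq> 0}" using c by simp
  have sum: "co (\<Sum>b\<in>A. vscale (c b) (gen b) :: ('k, 'u) vec) = (\<lambda>b'. if b' \<in> A then c b' else 0)"
    if "finite A" for A :: "'b set"
    using that
  proof (induction A rule: finite_induct)
    case empty
    show ?case
      by (simp only: sum.empty co_zero empty_iff if_False)
  next
    case (insert b A)
    show ?case
      unfolding sum.insert[OF insert.hyps] co_add insert.IH co_scale co_gen
      by (rule ext) (use insert.hyps in auto)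
  qed
  \<comment> \<open>\<open>co\<close> is injective only on the range of \<open>fv\<close>, so the
    sum must be shown to lie there before coordinates are compared.\<close>
  have fvsum: "(\<Sum>b\<in>A. vscale (c b) (gen b) :: ('k, 'u) vec) \<in> range (fv :: ('b \<Rightarrow> 'k) \<Rightarrow> _)"
    if "finite A" for A :: "'b set"
    using that
  proof (induction A rule: finite_induct)
    case empty
    then show ?case
      by (metis (no_types) fv_zero rangeI sum.empty)
  next
    case (insert b A)
    then obtain c' :: "'b \<Rightarrow> 'k" where c': "(\<Sum>b\<in>A. vscale (c b) (gen b)) = (fv c' :: ('k, 'u) vec)"
      by blast
    have "(\<Sum>b\<in>insert b A. vscale (c b) (gen b) :: ('k, 'u) vec) = fv ((\<lambda>b'. c b * (if b' = b then 1 else 0)) + c')"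
      unfolding fv_add fv_scale c'[symmetric] gen_def[symmetric] by (rule sum.insert[OF insert.hyps])
    then show ?case
      by blast
  qed
  obtain c' :: "'b \<Rightarrow> 'k" where c': "(\<Sum>b::'b | co v b \<noteq> 0. vscale (co v b) (gen b)) = (fv c' :: ('k, 'u) vec)"
    using fvsum[OF fin] unfolding c(1) co_fv by (rule rangeE)
  have "c' = (\<lambda>b'. if co v b' \<noteq> 0 then c b' else 0)"
    using arg_cong[OF c', of "co :: _ \<Rightarrow> 'b \<Rightarrow> 'k"] sum[OF fin] unfolding c(1) co_fv by simp
  then have "c' = c"
    using c(1) by auto
  then show ?thesis
    using c' c(1) by simp
qed

text \<open>In degree \<open>i\<close> the vector \<open>gen b\<close> stands for a multiple of the
  generator by a power of \<open>T\<close>, so the value in degree \<open>\<delta> b\<close>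
  determines all others.\<close>

lemma ghom_SF_gen:
  fixes N :: "('k::field, 'u) dgm"
  assumes "ghom s (SF \<delta> d) N f" "i \<le> \<delta> b"
  shows "f i (gen b) = act N (\<delta> b + s) (f (\<delta> b) (gen b)) (monom 1 (nat (\<delta> b - i)))"
proof -
  have "f (\<delta> b + - int (nat (\<delta> b - i))) (act (SF \<delta> d) (\<delta> b) (gen b) (monom 1 (nat (\<delta> b - i)))) =
      act N (\<delta> b + s) (f (\<delta> b) (gen b)) (monom 1 (nat (\<delta> b - i)))"
    by (rule ghom_act[OF assms(1) gen_in monom_in_Rgr]) simp
  then show ?thesis
    using assms(2) by (simp add: poly_monom)
qed

lemma ghom_SF_expand:
  fixes \<delta> :: "'b::coded \<Rightarrow> int" and N :: "('k::field, 'u) dgm"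
  assumes sd: "sf_dif \<delta> d" and f: "ghom s (SF \<delta> d) N f" and v: "v \<in> gr (SF \<delta> d) i"
  shows "f i v = (\<Sum>b::'b | co v b \<noteq> 0. vscale (co v b) (f i (gen b)))"
proof -
  note sub = gr_subspace[OF dg_module_SF[OF sd], of i]
  have g: "gen b \<in> gr (SF \<delta> d :: ('k, 'u) dgm) i" if "co v b \<noteq> 0" for b :: 'b
    using v that by - (rule gen_in, auto simp: Fsp_def)
  have "f i v = f i (\<Sum>b::'b | co v b \<noteq> 0. vscale (co v b) (gen b))"
    using SF_expand[OF v] by simp
  also have "\<dots> = (\<Sum>b::'b | co v b \<noteq> 0. f i (vscale (co v b) (gen b)))"
    by (rule klinear_on_sum[OF ghom_klinear[OF f] sub]) (use g vec.subspace_scale[OF sub] in blast)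
  also have "\<dots> = (\<Sum>b::'b | co v b \<noteq> 0. vscale (co v b) (f i (gen b)))"
    using klinear_onD(2)[OF ghom_klinear[OF f] sub g] by (intro sum.cong) auto
  finally show ?thesis .
qed

text \<open>Equality is demanded only at generators that occur in \<open>v\<close>. This local form
  is what the induction over levels in \<open>h_projective_SF\<close> uses.\<close>

lemma ghom_SF_eq:
  fixes \<delta> :: "'b::coded \<Rightarrow> int" and N :: "('k::field, 'u) dgm"
  assumes sd: "sf_dif \<delta> d" and f: "ghom s (SF \<delta> d) N f" and g: "ghom s (SF \<delta> d) N g"
    and v: "v \<in> gr (SF \<delta> d) i" and eq: "\<And>b::'b. co v b \<noteq> 0 \<Longrightarrow> f (\<delta> b) (gen b) = g (\<delta> b) (gen b)"
  shows "f i v = g i v"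
proof -
  have "f i (gen b) = g i (gen b)" if "co v b \<noteq> 0" for b :: 'b
  proof -
    have "i \<le> \<delta> b"
      using v that by (auto simp: Fsp_def)
    then show ?thesis
      using ghom_SF_gen[OF f] ghom_SF_gen[OF g] eq[OF that] by metis
  qed
  then show ?thesis
    unfolding ghom_SF_expand[OF sd f v] ghom_SF_expand[OF sd g v] by (intro sum.cong) auto
qed

text \<open>The \<open>R\<close>-linear map of degree \<open>s\<close> with prescribed values
  \<open>y\<close> on the free generators.\<close>

definition sf_ext :: "int \<Rightarrow> ('k::field, 'u) dgm \<Rightarrow> ('b::coded \<Rightarrow> int) \<Rightarrow> ('b \<Rightarrow> ('k, 'u) vec) \<Rightarrow> ('k, 'u) gmap" where
  "sf_ext s N \<delta> y i v =
     (\<Sum>b | co v b \<noteq> 0. vscale (co v b) (act N (\<delta> b + s) (y b) (monom 1 (nat (\<delta> b - i)))))"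

lemma sf_ext_superset:
  assumes "finite A" "{b. co v b \<noteq> 0} \<subseteq> A"
  shows "sf_ext s N \<delta> y i v = (\<Sum>b\<in>A. vscale (co v b) (act N (\<delta> b + s) (y b) (monom 1 (nat (\<delta> b - i)))))"
  unfolding sf_ext_def using assms by (intro sum.mono_neutral_left) auto

lemma sf_ext_gen:
  assumes "dg_module N" "y b \<in> gr N (\<delta> b + s)"
  shows "sf_ext s N \<delta> y (\<delta> b) (gen b) = y b"
proof -
  have "sf_ext s N \<delta> y (\<delta> b) (gen b) = act N (\<delta> b + s) (y b) (monom 1 0)"
    by (subst sf_ext_superset[of "{b}"]) auto
  then show ?thesis
    using act_one[OF assms] by (simp add: monom_0 one_pCons)
qed

lemma sf_ext_cong:
  assumes "\<And>b. co v b \<noteq> 0 \<Longrightarrow> y b = y' b"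
  shows "sf_ext s N \<delta> y i v = sf_ext s N \<delta> y' i v"
  unfolding sf_ext_def using assms by (intro sum.cong) auto

lemma sf_ext_ghom:
  fixes \<delta> :: "'b::coded \<Rightarrow> int" and d :: "('b \<Rightarrow> 'k::field) \<Rightarrow> 'b \<Rightarrow> 'k" and N :: "('k, 'u) dgm"
  assumes sd: "sf_dif \<delta> d" and N: "dg_module N" and y: "\<And>b. y b \<in> gr N (\<delta> b + s)"
  shows "ghom s (SF \<delta> d) N (sf_ext s N \<delta> y)"
proof (rule ghomI[OF dg_module_SF[OF sd] N])
  have fin: "finite {b::'b. co v b \<noteq> 0}" if "v \<in> gr (SF \<delta> d :: ('k, 'u) dgm) i" for v i
    using that by (auto simp: Fsp_def)
  have term_in: "act N (\<delta> b + s) (y b) (monom 1 (nat (\<delta> b - i))) \<in> gr N (i + s)" if "i \<le> \<delta> b" for b i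
    by (rule act_in'[OF N y monom_in_Rgr]) (use that in simp)
  show "klinear_on (gr (SF \<delta> d :: ('k, 'u) dgm) i) (sf_ext s N \<delta> y i)" for i
    unfolding klinear_on_def
  proof (intro conjI ballI allI)
    fix x z assume x: "x \<in> gr (SF \<delta> d :: ('k, 'u) dgm) i" and z: "z \<in> gr (SF \<delta> d :: ('k, 'u) dgm) i"
    let ?A = "{b::'b. co x b \<noteq> 0} \<union> {b. co z b \<noteq> 0}"
    have A: "finite ?A"
      using fin[OF x] fin[OF z] by simp
    have "sf_ext s N \<delta> y i (x + z) =
        (\<Sum>b\<in>?A. vscale (co (x + z) b) (act N (\<delta> b + s) (y b) (monom 1 (nat (\<delta> b - i)))))"
      by (rule sf_ext_superset[OF A]) auto
    also have "\<dots> = (\<Sum>b\<in>?A. vscale (co x b) (act N (\<delta> b + s) (y b) (monom 1 (nat (\<delta> b - i))))) +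
        (\<Sum>b\<in>?A. vscale (co z b) (act N (\<delta> b + s) (y b) (monom 1 (nat (\<delta> b - i)))))"
      by (simp only: co_add plus_fun_apply vec.scale_left_distrib sum.distrib)
    also have "(\<Sum>b\<in>?A. vscale (co x b) (act N (\<delta> b + s) (y b) (monom 1 (nat (\<delta> b - i))))) = sf_ext s N \<delta> y i x"
      by (rule sf_ext_superset[OF A, symmetric]) auto
    also have "(\<Sum>b\<in>?A. vscale (co z b) (act N (\<delta> b + s) (y b) (monom 1 (nat (\<delta> b - i))))) = sf_ext s N \<delta> y i z"
      by (rule sf_ext_superset[OF A, symmetric]) auto
    finally show "sf_ext s N \<delta> y i (x + z) = sf_ext s N \<delta> y i x + sf_ext s N \<delta> y i z" .
  next
    fix c x assume x: "x \<in> gr (SF \<delta> d :: ('k, 'u) dgm) i"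
    have "sf_ext s N \<delta> y i (vscale c x) =
      (\<Sum>b::'b | co x b \<noteq> 0. vscale (co (vscale c x) b) (act N (\<delta> b + s) (y b) (monom 1 (nat (\<delta> b - i)))))"
      by (rule sf_ext_superset[OF fin[OF x]]) auto
    also have "\<dots> = vscale c (sf_ext s N \<delta> y i x)"
      by (simp only: sf_ext_def co_scale vec.scale_sum_right vec.scale_scale)
    finally show "sf_ext s N \<delta> y i (vscale c x) = vscale c (sf_ext s N \<delta> y i x)" .
  qed
  show "sf_ext s N \<delta> y i x \<in> gr N (i + s)" if x: "x \<in> gr (SF \<delta> d :: ('k, 'u) dgm) i" for i x
    unfolding sf_ext_def
    using x by (intro vec.subspace_sum[OF gr_subspace[OF N]] vec.subspace_scale[OF gr_subspace[OF N]] term_in)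
      (auto simp: Fsp_def)
  show "sf_ext s N \<delta> y (i - int m) (act (SF \<delta> d) i x (monom 1 m)) =
      act N (i + s) (sf_ext s N \<delta> y i x) (monom 1 m)" if x: "x \<in> gr (SF \<delta> d :: ('k, 'u) dgm) i" for i m x
  proof -
    let ?t = "\<lambda>b. act N (\<delta> b + s) (y b) (monom 1 (nat (\<delta> b - i)))"
    have ib: "i \<le> \<delta> b" if "co x b \<noteq> 0" for b :: 'b
      using x that by (auto simp: Fsp_def)
    note lin = act_klinear[OF N monom_in_Rgr[of 1 m], of "i + s"]
    have "act N (i + s) (sf_ext s N \<delta> y i x) (monom 1 m) =
        (\<Sum>b::'b | co x b \<noteq> 0. act N (i + s) (vscale (co x b) (?t b)) (monom 1 m))"
      unfolding sf_ext_def
      by (rule klinear_on_sum[OF lin gr_subspace[OF N]])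
        (auto intro!: gr_closed(5)[OF N] term_in ib)
    also have "\<dots> = (\<Sum>b::'b | co x b \<noteq> 0. vscale (co x b) (act N (\<delta> b + s) (y b) (monom 1 (nat (\<delta> b - (i - int m))))))"
    proof (rule sum.cong[OF refl])
      fix b :: 'b assume "b \<in> {b. co x b \<noteq> 0}"
      then have b: "i \<le> \<delta> b"
        using ib by simp
      have "act N (i + s) (?t b) (monom 1 m) = act N (\<delta> b + s + - int (nat (\<delta> b - i))) (?t b) (monom 1 m)"
      proof -
        have "i + s = \<delta> b + s + - int (nat (\<delta> b - i))"
          using b by simp
        then show ?thesis
          by (simp only:)
      qed
      also have "\<dots> = act N (\<delta> b + s) (y b) (monom 1 (nat (\<delta> b - i)) * monom 1 m)"
        by (rule act_mult[OF N y monom_in_Rgr monom_in_Rgr, symmetric])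
      also have "monom 1 (nat (\<delta> b - i)) * monom 1 m = (monom 1 (nat (\<delta> b - (i - int m))) :: 'k poly)"
        using b by (simp add: mult_monom nat_add_distrib[symmetric] flip: nat_int_add) (simp add: nat_diff_distrib nat_add_distrib algebra_simps)
      finally show "act N (i + s) (vscale (co x b) (?t b)) (monom 1 m) =
          vscale (co x b) (act N (\<delta> b + s) (y b) (monom 1 (nat (\<delta> b - (i - int m)))))"
        using klinear_onD(2)[OF lin gr_subspace[OF N] term_in[OF b]] by simp
    qed
    finally show ?thesis
      by (simp add: sf_ext_def poly_monom)
  qed
qed

text \<open>Since differentials are themselves \<open>R\<close>-linear, both sides of a chain map or
  homotopy identity are, and such identities can be tested on generators.\<close>

lemma ghom_dif:
  assumes "dg_module M"
  shows "ghom 1 M M (dif M)"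
  unfolding ghom_def using assms by (auto simp: dif_klinear dif_in dif_act)

lemma SF_dg_homI:
  fixes \<delta> :: "'b::coded \<Rightarrow> int" and d :: "('b \<Rightarrow> 'k::field) \<Rightarrow> 'b \<Rightarrow> 'k" and N :: "('k, 'u) dgm"
  assumes sd: "sf_dif \<delta> d" and N: "dg_module N" and y: "\<And>b. y b \<in> gr N (\<delta> b)"
    and eq: "\<And>b. sf_ext 0 N \<delta> y (\<delta> b + 1) (dif (SF \<delta> d :: ('k, 'u) dgm) (\<delta> b) (gen b)) = dif N (\<delta> b) (y b)"
  shows "dg_hom (SF \<delta> d) N (sf_ext 0 N \<delta> y)"
  unfolding dg_hom_iff_ghom
proof (intro conjI allI ballI)
  have y': "y b \<in> gr N (\<delta> b + 0)" for b
    using y by simp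
  show gh: "ghom 0 (SF \<delta> d) N (sf_ext 0 N \<delta> y)"
    by (rule sf_ext_ghom[OF sd N y'])
  fix i x assume x: "x \<in> gr (SF \<delta> d :: ('k, 'u) dgm) i"
  have 1: "ghom 1 (SF \<delta> d) N (\<lambda>i x. sf_ext 0 N \<delta> y (i + 1) (dif (SF \<delta> d :: ('k, 'u) dgm) i x))"
    using ghom_comp[OF ghom_dif[OF dg_module_SF[OF sd]] gh] by simp
  have 2: "ghom 1 (SF \<delta> d) N (\<lambda>i x. dif N i (sf_ext 0 N \<delta> y i x))"
    using ghom_comp[OF gh ghom_dif[OF N]] by simp
  show "sf_ext 0 N \<delta> y (i + 1) (dif (SF \<delta> d :: ('k, 'u) dgm) i x) = dif N i (sf_ext 0 N \<delta> y i x)"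
    by (rule ghom_SF_eq[OF sd 1 2 x]) (simp only: eq sf_ext_gen[where y = y and \<delta> = \<delta>, OF N y'])
qed

lemma ghom_homotopy_rhs:
  assumes M: "dg_module M" and N: "dg_module N" and h: "ghom (- 1) M N h"
  shows "ghom 0 M N (\<lambda>i x. dif N (i - 1) (h i x) + h (i + 1) (dif M i x))"
  using ghom_add[OF N] ghom_comp[OF h ghom_dif[OF N]] ghom_comp[OF ghom_dif[OF M] h] by simp

lemma SF_homotopicI:
  fixes \<delta> :: "'b::coded \<Rightarrow> int" and d :: "('b \<Rightarrow> 'k::field) \<Rightarrow> 'b \<Rightarrow> 'k" and N :: "('k, 'u) dgm"
  assumes sd: "sf_dif \<delta> d" and N: "dg_module N" and f: "dg_hom (SF \<delta> d) N f" and g: "dg_hom (SF \<delta> d) N g"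
    and H: "\<And>b. H b \<in> gr N (\<delta> b - 1)"
    and eq: "\<And>b. f (\<delta> b) (gen b) - g (\<delta> b) (gen b) =
      dif N (\<delta> b - 1) (H b) + sf_ext (- 1) N \<delta> H (\<delta> b + 1) (dif (SF \<delta> d :: ('k, 'u) dgm) (\<delta> b) (gen b))"
  shows "homotopic (SF \<delta> d) N f g"
proof -
  have H': "H b \<in> gr N (\<delta> b + - 1)" for b
    using H by simp
  have h: "ghom (- 1) (SF \<delta> d) N (sf_ext (- 1) N \<delta> H)"
    by (rule sf_ext_ghom[OF sd N H'])
  note fg = ghom_diff[OF N dg_hom_ghom[OF f] dg_hom_ghom[OF g]]
  show ?thesis
  proof (rule homotopicI[OF h])
    fix i x assume x: "x \<in> gr (SF \<delta> d :: ('k, 'u) dgm) i"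
    show "f i x - g i x = dif N (i - 1) (sf_ext (- 1) N \<delta> H i x) + sf_ext (- 1) N \<delta> H (i + 1) (dif (SF \<delta> d :: ('k, 'u) dgm) i x)"
      by (rule ghom_SF_eq[OF sd fg ghom_homotopy_rhs[OF dg_module_SF[OF sd] N h] x])
        (simp only: eq sf_ext_gen[where y = H and \<delta> = \<delta>, OF N H'])
  qed
qed

text \<open>The differential of a generator involves only generators of lower level, so a null-homotopy can
  be chosen on the generators level by level.\<close>

lemma h_projective_SF:
  fixes d :: "('b::coded \<Rightarrow> 'k::field) \<Rightarrow> 'b \<Rightarrow> 'k" and lev :: "'b \<Rightarrow> nat"
  assumes sd: "sf_dif \<delta> d"
    and lev: "\<And>b b'. d (\<lambda>x. if x = b then 1 else 0) b' \<noteq> 0 \<Longrightarrow> lev b' < lev b"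
    and bound: "\<And>b. lev b < K"
  shows "h_projective (SF \<delta> d :: ('k, 'u) dgm)"
  unfolding h_projective_def
proof (intro conjI allI impI)
  show M: "dg_module (SF \<delta> d)"
    by (rule dg_module_SF[OF sd])
  fix C :: "('k, 'u) dgm" and f
  assume C: "dg_module C" and ac: "acyclic_dgm C" and f: "dg_hom (SF \<delta> d) C f"
  let ?M = "SF \<delta> d :: ('k, 'u) dgm"
  let ?e = "\<lambda>H. sf_ext (- 1) C \<delta> H"
  have dgen: "dif ?M (\<delta> b) (gen b) \<in> gr ?M (\<delta> b + 1)" for b
    by (rule dif_in[OF M gen_in]) simp
  have lev': "lev b' < lev b" if "co (dif ?M (\<delta> b) (gen b)) b' \<noteq> 0" for b b' :: 'b
    using that by (intro lev) simp
  \<comment> \<open>\<open>H\<close> is defined on all generators so that it extends linearly; the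
    homotopy identity is claimed only below level \<open>n\<close>.\<close>
  have "\<exists>H. (\<forall>b. H b \<in> gr C (\<delta> b + - 1)) \<and> (\<forall>b. lev b < n \<longrightarrow>
      f (\<delta> b) (gen b) = dif C (\<delta> b - 1) (H b) + ?e H (\<delta> b + 1) (dif ?M (\<delta> b) (gen b)))" for n
  proof (induction n)
    case 0
    show ?case
      by (intro exI[of _ "\<lambda>b. 0"] conjI allI gr_closed(1)[OF C]) simp
  next
    case (Suc n)
    then obtain H where H: "\<And>b. H b \<in> gr C (\<delta> b + - 1)" and eq: "\<And>b. lev b < n \<Longrightarrow>
      f (\<delta> b) (gen b) = dif C (\<delta> b - 1) (H b) + ?e H (\<delta> b + 1) (dif ?M (\<delta> b) (gen b))"
      by blast
    note h = sf_ext_ghom[OF sd C H]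
    have ex: "\<exists>y. y \<in> gr C (\<delta> b - 1) \<and>
        f (\<delta> b) (gen b) - ?e H (\<delta> b + 1) (dif ?M (\<delta> b) (gen b)) = dif C (\<delta> b - 1) y" if b: "lev b = n" for b
    proof -
      let ?v = "dif ?M (\<delta> b) (gen b)"
      have g: "gen b \<in> gr ?M (\<delta> b)"
        by (rule gen_in) simp
      \<comment> \<open>The differential of \<open>gen b\<close> is supported on levels below
        \<open>n\<close>, where the identity is known. It follows that the remaining defect at
        \<open>gen b\<close> is a cocycle of \<open>C\<close>.\<close>
      have "f (\<delta> b + 1) ?v = dif C (\<delta> b + 1 - 1) (?e H (\<delta> b + 1) ?v) + ?e H (\<delta> b + 1 + 1) (dif ?M (\<delta> b + 1) ?v)"
      proof (rule ghom_SF_eq[OF sd dg_hom_ghom[OF f] ghom_homotopy_rhs[OF M C h] dgen])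
        fix b' :: 'b assume "co ?v b' \<noteq> 0"
        then have "lev b' < n"
          using lev' b by blast
        then show "f (\<delta> b') (gen b') = dif C (\<delta> b' - 1) (?e H (\<delta> b') (gen b')) + ?e H (\<delta> b' + 1) (dif ?M (\<delta> b') (gen b'))"
          using eq by (simp only: sf_ext_gen[where y = H and \<delta> = \<delta>, OF C H])
      qed
      also have "dif ?M (\<delta> b + 1) ?v = 0"
        by (rule dif_dif[OF M g])
      also have "?e H (\<delta> b + 1 + 1) 0 = 0"
        by (rule ghom_simps(3)[OF h M])
      finally have v: "f (\<delta> b + 1) ?v = dif C (\<delta> b) (?e H (\<delta> b + 1) ?v)"
        by simp
      have in1: "f (\<delta> b) (gen b) \<in> gr C (\<delta> b)" and in2: "?e H (\<delta> b + 1) ?v \<in> gr C (\<delta> b)"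
        using dg_hom_in[OF f g] ghom_in[OF h dgen] by simp_all
      have "dif C (\<delta> b) (f (\<delta> b) (gen b) - ?e H (\<delta> b + 1) ?v) = 0"
        unfolding dif_simps(5)[OF C C in1 in2] dg_hom_dif[OF f g, symmetric] v by simp
      then show ?thesis
        using acyclic_dgmD[OF ac gr_closed(3)[OF C in1 in2]] by blast
    qed
    define H' where "H' b = (if lev b = n then SOME y. y \<in> gr C (\<delta> b - 1) \<and>
        f (\<delta> b) (gen b) - ?e H (\<delta> b + 1) (dif ?M (\<delta> b) (gen b)) = dif C (\<delta> b - 1) y else H b)" for b
    have H'n: "H' b \<in> gr C (\<delta> b - 1) \<and>
        f (\<delta> b) (gen b) - ?e H (\<delta> b + 1) (dif ?M (\<delta> b) (gen b)) = dif C (\<delta> b - 1) (H' b)" if "lev b = n" for b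
      using someI_ex[OF ex[OF that]] that unfolding H'_def by auto
    have H'o: "H' b = H b" if "lev b \<noteq> n" for b
      using that by (simp add: H'_def)
    \<comment> \<open>Changing the values on level \<open>n\<close> does not affect the extension on
      differentials of generators up to that level.\<close>
    have ext: "?e H' (\<delta> b + 1) (dif ?M (\<delta> b) (gen b)) = ?e H (\<delta> b + 1) (dif ?M (\<delta> b) (gen b))" if "lev b \<le> n" for b
    proof (rule sf_ext_cong)
      fix b' :: 'b assume "co (dif ?M (\<delta> b) (gen b)) b' \<noteq> 0"
      then have "lev b' < lev b"
        by (rule lev')
      then show "H' b' = H b'"
        using that by (intro H'o) simp
    qed
    show ?case
    proof (intro exI[of _ H'] conjI allI impI)
      show "H' b \<in> gr C (\<delta> b + - 1)" for b
        using H'n[of b] H'o[of b] H[of b] by (cases "lev b = n") simp_all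
      show "f (\<delta> b) (gen b) = dif C (\<delta> b - 1) (H' b) + ?e H' (\<delta> b + 1) (dif ?M (\<delta> b) (gen b))"
        if b: "lev b < Suc n" for b
      proof (cases "lev b = n")
        case True
        then have "dif C (\<delta> b - 1) (H' b) = f (\<delta> b) (gen b) - ?e H (\<delta> b + 1) (dif ?M (\<delta> b) (gen b))"
          using H'n by simp
        then show ?thesis
          unfolding ext[OF eq_refl[OF True]] by (simp only: diff_add_cancel)
      next
        case False
        then have "lev b < n"
          using b by simp
        then show ?thesis
          unfolding ext[OF less_imp_le[OF \<open>lev b < n\<close>]] H'o[OF False] by (rule eq)
      qed
    qed
  qed
  from this[of K] obtain H where H: "\<And>b. H b \<in> gr C (\<delta> b + - 1)" and eq: "\<And>b.
      f (\<delta> b) (gen b) = dif C (\<delta> b - 1) (H b) + ?e H (\<delta> b + 1) (dif ?M (\<delta> b) (gen b))"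
    using bound by blast
  show "homotopic ?M C f (\<lambda>i x. 0)"
  proof (rule SF_homotopicI[OF sd C f dg_hom_zero[OF C], of H])
    show "H b \<in> gr C (\<delta> b - 1)" for b
      using H[of b] by simp
    show "f (\<delta> b) (gen b) - 0 = dif C (\<delta> b - 1) (H b) + ?e H (\<delta> b + 1) (dif ?M (\<delta> b) (gen b))" for b
      using eq[of b] by (simp only: diff_zero)
  qed
qed

section \<open>Semifree models of \<open>X\<^sub>l\<close> and of the homotopy colimits\<close>

text \<open>The axioms pass to degreewise surjective images. The suspended \<open>X l\<close> and
  the homotopy colimits become DG modules in this way, from their semifree models.\<close>

lemma dg_module_surj_image:
  assumes M: "dg_module M" and f: "dg_hom M N f" and surj: "\<And>i. f i ` gr M i = gr N i"
  shows "dg_module N"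
proof -
  have ex: "\<exists>x\<in>gr M i. y = f i x" if "y \<in> gr N i" for y i
    using that surj by blast
  note [simp] = dg_hom_simps[OF f M] dg_hom_in[OF f]
  have act: "act N i (f i x) r = f (i + j) (act M i x r)" if "x \<in> gr M i" "r \<in> Rgr j" for i j x r
    using that by (simp add: dg_hom_act[OF f])
  have dif: "dif N i (f i x) = f (i + 1) (dif M i x)" if "x \<in> gr M i" for i x
    using that by (simp add: dg_hom_dif[OF f])
  show ?thesis
    unfolding dg_module_def
  proof (intro conjI allI ballI)
    show "vec.subspace (gr N i)" for i
    proof (rule vec.subspaceI)
      show "0 \<in> gr N i"
        using dg_hom_in[OF f gr_closed(1)[OF M]] dg_hom_simps(3)[OF f M] by metis
      show "x + y \<in> gr N i" if "x \<in> gr N i" "y \<in> gr N i" for x y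
        using ex[OF that(1)] ex[OF that(2)] dg_hom_in[OF f gr_closed(2)[OF M]] by fastforce
      show "vscale c x \<in> gr N i" if "x \<in> gr N i" for c x
        using ex[OF that] dg_hom_in[OF f gr_closed(5)[OF M]] by fastforce
    qed
    show "klinear_on (gr N i) (dif N i)" for i
      unfolding klinear_on_def
    proof (intro conjI ballI allI)
      fix y y' assume "y \<in> gr N i" "y' \<in> gr N i"
      then obtain x x' where x: "x \<in> gr M i" "y = f i x" "x' \<in> gr M i" "y' = f i x'"
        using ex by blast
      then have e: "y + y' = f i (x + x')"
        by simp
      have "dif N i (y + y') = f (i + 1) (dif M i (x + x'))"
        unfolding e by (rule dif[OF gr_closed(2)[OF M x(1,3)]])
      then show "dif N i (y + y') = dif N i y + dif N i y'"
        using x by (simp add: dif dif_simps[OF M M] dif_in[OF M])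
    next
      fix c y assume "y \<in> gr N i"
      then obtain x where x: "x \<in> gr M i" "y = f i x"
        using ex by blast
      then have e: "vscale c y = f i (vscale c x)"
        by simp
      have "dif N i (vscale c y) = f (i + 1) (dif M i (vscale c x))"
        unfolding e by (rule dif[OF gr_closed(5)[OF M x(1)]])
      then show "dif N i (vscale c y) = vscale c (dif N i y)"
        using x by (simp add: dif dif_simps[OF M M] dif_in[OF M])
    qed
    show "dif N i y \<in> gr N (i + 1)" if "y \<in> gr N i" for i y
      using ex[OF that] dif_in[OF M] by (auto simp: dif)
    show "dif N (i + 1) (dif N i y) = 0" if "y \<in> gr N i" for i y
      using ex[OF that] dif_in[OF M] by (auto simp: dif dif_dif[OF M])
    show "act N i y r \<in> gr N (i + j)" if "y \<in> gr N i" "r \<in> Rgr j" for i j y r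
      using ex[OF that(1)] that(2) act_in[OF M] by (auto simp: act)
    show "klinear_on (gr N i) (\<lambda>y. act N i y r)" if r: "r \<in> Rgr j" for i j r
      unfolding klinear_on_def
    proof (intro conjI ballI allI)
      fix y y' assume "y \<in> gr N i" "y' \<in> gr N i"
      then obtain x x' where x: "x \<in> gr M i" "y = f i x" "x' \<in> gr M i" "y' = f i x'"
        using ex by blast
      then have e: "y + y' = f i (x + x')"
        by simp
      have "act N i (y + y') r = f (i + j) (act M i (x + x') r)"
        unfolding e by (rule act[OF gr_closed(2)[OF M x(1,3)] r])
      then show "act N i (y + y') r = act N i y r + act N i y' r"
        using x by (simp add: act[OF _ r] act_simps[OF M r M] act_in[OF M _ r])
    next
      fix c y assume "y \<in> gr N i"
      then obtain x where x: "x \<in> gr M i" "y = f i x"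
        using ex by blast
      then have e: "vscale c y = f i (vscale c x)"
        by simp
      have "act N i (vscale c y) r = f (i + j) (act M i (vscale c x) r)"
        unfolding e by (rule act[OF gr_closed(5)[OF M x(1)] r])
      then show "act N i (vscale c y) r = vscale c (act N i y r)"
        using x by (simp add: act[OF _ r] act_simps[OF M r M] act_in[OF M _ r])
    qed
    show "act N i y (r + s) = act N i y r + act N i y s" if y: "y \<in> gr N i" and r: "r \<in> Rgr j" "s \<in> Rgr j" for i j y r s
    proof -
      obtain x where x: "x \<in> gr M i" "y = f i x"
        using ex[OF y] by blast
      have "r + s \<in> Rgr j"
        using r by (auto simp: Rgr_def add_monom split: if_splits)
      then show ?thesis
        using x r act_radd[OF M x(1) r] by (simp add: act act_in[OF M])
    qed
    show "act N i y (smult c r) = vscale c (act N i y r)" if y: "y \<in> gr N i" and r: "r \<in> Rgr j" for i j c y r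
    proof -
      obtain x where x: "x \<in> gr M i" "y = f i x"
        using ex[OF y] by blast
      have "smult c r \<in> Rgr j"
        using r by (auto simp: Rgr_def smult_monom split: if_splits)
      then show ?thesis
        using x r act_smult[OF M x(1) r] by (simp add: act act_in[OF M])
    qed
    show "act N i y 1 = y" if "y \<in> gr N i" for i y
      using ex[OF that] by (auto simp: act[OF _ one_in_Rgr] act_one[OF M])
    show "act N i y (r * s) = act N (i + j) (act N i y r) s"
      if y: "y \<in> gr N i" and r: "r \<in> Rgr j" "s \<in> Rgr l" for i j l y r s
    proof -
      obtain x where x: "x \<in> gr M i" "y = f i x"
        using ex[OF y] by blast
      have "r * s \<in> Rgr (j + l)"
        using r(1)
      proof (cases rule: RgrE)
        case r': (1 c m)
        show ?thesis
          using r(2)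
        proof (cases rule: RgrE)
          case (1 c' m')
          then show ?thesis
            using r' monom_in_Rgr[of "c * c'" "m + m'"] by (simp add: mult_monom)
        qed simp
      qed simp
      then show ?thesis
        using x r act_mult[OF M x(1) r] by (simp add: act act_in[OF M] add.assoc)
    qed
    show "dif N (i + j) (act N i y r) = act N (i + 1) (dif N i y) r" if y: "y \<in> gr N i" and r: "r \<in> Rgr j" for i j y r
    proof -
      obtain x where x: "x \<in> gr M i" "y = f i x"
        using ex[OF y] by blast
      have "act N (i + 1) (dif N i y) r = f (i + 1 + j) (act M (i + 1) (dif M i x) r)"
        using x r by (simp only: dif act[OF dif_in[OF M x(1)] r])
      also have "\<dots> = f (i + j + 1) (dif M (i + j) (act M i x r))"
        by (simp only: dif_act[OF M x(1) r] add.assoc add.commute[of j 1])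
      also have "\<dots> = dif N (i + j) (act N i y r)"
        using x r by (simp only: act[OF x(1) r] dif[OF act_in[OF M x(1) r]])
      finally show ?thesis ..
    qed
  qed
qed

text \<open>For targets whose module axioms are still to be derived: scalars in \<open>N\<close>
  cannot be pulled out, so all monomials are tested, and 0 separately because it has every
  degree.\<close>

lemma dg_homI_monom:
  assumes lin: "\<And>i. klinear_on (gr M i) (f i)" and deg: "\<And>i x. x \<in> gr M i \<Longrightarrow> f i x \<in> gr N i"
    and act: "\<And>i x c m. x \<in> gr M i \<Longrightarrow> f (i - int m) (act M i x (monom c m)) = act N i (f i x) (monom c m)"
    and act0: "\<And>i j x. x \<in> gr M i \<Longrightarrow> f j (act M i x 0) = act N i (f i x) 0"
    and dif: "\<And>i x. x \<in> gr M i \<Longrightarrow> f (i + 1) (dif M i x) = dif N i (f i x)"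
  shows "dg_hom M N f"
  unfolding dg_hom_def
proof (intro conjI allI ballI)
  show "f (i + j) (act M i x r) = act N i (f i x) r" if "x \<in> gr M i" "r \<in> Rgr j" for i j x r
    using that(2) by (cases rule: RgrE) (use act[OF that(1)] act0[OF that(1)] in simp_all)
qed (use lin deg dif in auto)

section \<open>Semifree models of the suspensions of \<open>X l\<close>\<close>

datatype xgen = Xe | Xr

instantiation xgen :: coded
begin

definition code_xgen :: "xgen \<Rightarrow> nat" where
  "code_xgen b = (case b of Xe \<Rightarrow> 0 | Xr \<Rightarrow> 1)"

instance
  by standard (auto simp: code_xgen_def inj_def split: xgen.splits)

end

text \<open>\<open>Xe\<close> is the generator of \<open>R\<close>, and \<open>Xr\<close> that of
  the other free summand. The latter is in degree -l-1 by suspension, one lower by the cone, and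
  both are shifted by \<open>a\<close>. The differential of \<open>Xr\<close> is \<open>Xe\<close>
  times the power l+1 of \<open>T\<close>.\<close>

definition xdeg :: "int \<Rightarrow> nat \<Rightarrow> xgen \<Rightarrow> int" where
  "xdeg a l b = (case b of Xe \<Rightarrow> - a | Xr \<Rightarrow> - a - int l - 2)"

definition xdif :: "(xgen \<Rightarrow> 'k::field) \<Rightarrow> xgen \<Rightarrow> 'k" where
  "xdif c b = (case b of Xe \<Rightarrow> c Xr | Xr \<Rightarrow> 0)"

text \<open>A model of \<open>\<Sigma>\<^sup>a X\<^sub>l\<close>.\<close>

definition Xsf :: "int \<Rightarrow> nat \<Rightarrow> ('k::field, 'u) dgm" where
  "Xsf a l = SF (xdeg a l) xdif"

lemma finite_xgen [simp]: "finite (A :: xgen set)"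
  by (rule finite_subset[of _ "{Xe, Xr}"]) (use xgen.exhaust in auto)

lemma Fsp_xdeg_iff: "c \<in> Fsp (xdeg a l) i \<longleftrightarrow> (c Xe \<noteq> 0 \<longrightarrow> i \<le> - a) \<and> (c Xr \<noteq> 0 \<longrightarrow> i \<le> - a - int l - 2)"
  unfolding Fsp_def by (auto simp: xdeg_def split: xgen.splits)

lemma sf_dif_X: "sf_dif (xdeg a l) xdif"
  unfolding sf_dif_def by (auto simp: Fsp_xdeg_iff xdif_def fun_eq_iff split: xgen.splits)

lemma dg_module_Xsf: "dg_module (Xsf a l)"
  unfolding Xsf_def by (rule dg_module_SF[OF sf_dif_X])

lemma h_projective_Xsf: "h_projective (Xsf a l)"
  unfolding Xsf_def
  by (rule h_projective_SF[OF sf_dif_X, where lev = "\<lambda>b. case b of Xe \<Rightarrow> 0 | Xr \<Rightarrow> 1" and K = 2])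
    (auto simp: xdif_def split: xgen.splits if_splits)

section \<open>Semifree models of the homotopy colimits\<close>

datatype egen = Ge nat | Gr nat | Fe nat | Fr nat

instantiation egen :: coded
begin

definition code_egen :: "egen \<Rightarrow> nat" where
  "code_egen b = (case b of Ge j \<Rightarrow> 4 * j | Gr j \<Rightarrow> 4 * j + 1 | Fe j \<Rightarrow> 4 * j + 2 | Fr j \<Rightarrow> 4 * j + 3)"

instance
proof
  show "inj (code :: egen \<Rightarrow> nat)"
  proof (rule injI)
    fix x y :: egen
    assume "code x = code y"
    then show "x = y"
      by (cases x; cases y; simp add: code_egen_def; presburger)
  qed
qed

end

text \<open>This is \<open>xdeg\<close> with \<open>a = n - j\<close> and \<open>l = j\<close>,
  where the dependence on \<open>j\<close> cancels for \<open>Gr j\<close>. The cone lowers the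
  \<open>F\<close> copies by one.\<close>

definition edeg :: "int \<Rightarrow> egen \<Rightarrow> int" where
  "edeg n b = (case b of Ge j \<Rightarrow> int j - n | Gr j \<Rightarrow> - n - 2 | Fe j \<Rightarrow> int j - n - 1 | Fr j \<Rightarrow> - n - 3)"

text \<open>\<open>\<beta> j\<close> is the component from \<open>Gr j\<close> to
  \<open>Ge (Suc j)\<close> of the structure map. It is null-homotopic, but an arbitrary choice of
  DG maps may contain it, so it is carried along. The values on generators are in
  \<open>Esf_dif_gen\<close>.\<close>

definition edif :: "(nat \<Rightarrow> 'k::field) \<Rightarrow> (egen \<Rightarrow> 'k) \<Rightarrow> egen \<Rightarrow> 'k" where
  "edif \<beta> c b = (case b of
     Ge j \<Rightarrow> c (Gr j) + c (Fe j) - (case j of 0 \<Rightarrow> 0 | Suc i \<Rightarrow> c (Fe i) + \<beta> i * c (Fr i))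
   | Gr j \<Rightarrow> c (Fr j) - (case j of 0 \<Rightarrow> 0 | Suc i \<Rightarrow> c (Fr i))
   | Fe j \<Rightarrow> - c (Fr j)
   | Fr j \<Rightarrow> 0)"

text \<open>A model of \<open>E\<^sub>n\<close>: \<open>Ge j\<close> and \<open>Gr j\<close> are rescaled generators of \<open>\<Sigma>\<^sup>n\<^sup>-\<^sup>j X\<^sub>j\<close>, and \<open>Fe j\<close>, \<open>Fr j\<close> are their copies in
  the suspended coproduct of the cone of \<open>id - shift\<close>.\<close>

definition Esf :: "int \<Rightarrow> (nat \<Rightarrow> 'k::field) \<Rightarrow> ('k, 'u) dgm" where
  "Esf n \<beta> = SF (edeg n) (edif \<beta>)"

lemma sf_dif_E: "sf_dif (edeg n) (edif \<beta>)"
  unfolding sf_dif_def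
proof (intro conjI allI ballI)
  show "edif \<beta> (c + c') = edif \<beta> c + edif \<beta> c'" for c c'
    by (rule ext) (auto simp: edif_def algebra_simps split: egen.splits nat.splits)
  show "edif \<beta> (\<lambda>b. a * c b) = (\<lambda>b. a * edif \<beta> c b)" for a c
    by (rule ext) (auto simp: edif_def algebra_simps split: egen.splits nat.splits)
  fix i and c :: "egen \<Rightarrow> 'a" assume c: "c \<in> Fsp (edeg n) i"
  show "edif \<beta> (edif \<beta> c) = (\<lambda>b. 0)"
    by (rule ext) (auto simp: edif_def algebra_simps split: egen.splits nat.splits)
  have deg: "i \<le> edeg n b" if "c b \<noteq> 0" for b
    using c that by (auto simp: Fsp_def)
  show "edif \<beta> c \<in> Fsp (edeg n) (i + 1)"
    unfolding Fsp_def mem_Collect_eq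
  proof (intro conjI allI impI)
    define J where "J = (\<lambda>b. case b of Ge j \<Rightarrow> j | Gr j \<Rightarrow> j | Fe j \<Rightarrow> j | Fr j \<Rightarrow> j) ` {b. c b \<noteq> 0}"
    have J: "j \<in> J" if "c (Ge j) \<noteq> 0 \<or> c (Gr j) \<noteq> 0 \<or> c (Fe j) \<noteq> 0 \<or> c (Fr j) \<noteq> 0" for j
      unfolding J_def using that by (force simp: image_iff split: egen.splits)
    have J_fin: "finite J"
      using c by (simp add: J_def Fsp_def)
    have sub: "{b. edif \<beta> c b \<noteq> 0} \<subseteq> Ge ` J \<union> Ge ` Suc ` J \<union> Gr ` J \<union> Gr ` Suc ` J \<union> Fe ` J"
    proof
      fix b assume "b \<in> {b. edif \<beta> c b \<noteq> 0}"
      then have b: "edif \<beta> c b \<noteq> 0"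
        by simp
      show "b \<in> Ge ` J \<union> Ge ` Suc ` J \<union> Gr ` J \<union> Gr ` Suc ` J \<union> Fe ` J"
      proof (rule ccontr)
        assume nb: "b \<notin> Ge ` J \<union> Ge ` Suc ` J \<union> Gr ` J \<union> Gr ` Suc ` J \<union> Fe ` J"
        have J0: "c (Ge j) = 0 \<and> c (Gr j) = 0 \<and> c (Fe j) = 0 \<and> c (Fr j) = 0" if "j \<notin> J" for j
          using J that by blast
        show False
          using b nb by (cases b) (auto simp: edif_def J0 image_iff split: nat.splits)
      qed
    qed
    show "finite {b. edif \<beta> c b \<noteq> 0}"
      by (rule finite_subset[OF sub]) (simp add: J_fin)
    fix b assume b: "edif \<beta> c b \<noteq> 0"
    show "i + 1 \<le> edeg n b"
    proof (rule ccontr)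
      assume nb: "\<not> i + 1 \<le> edeg n b"
      have z: "c b' = 0" if "edeg n b' < i" for b'
        using deg[of b'] that by force
      show False
        using b nb by (cases b) (auto simp: edif_def edeg_def z split: nat.splits)
    qed
  qed
qed

lemma dg_module_Esf: "dg_module (Esf n \<beta>)"
  unfolding Esf_def by (rule dg_module_SF[OF sf_dif_E])

text \<open>Three levels suffice for infinitely many generators, since the differential preserves or
  raises the index \<open>j\<close> but always lowers the kind of generator.\<close>

lemma h_projective_Esf: "h_projective (Esf n \<beta>)"
  unfolding Esf_def
  by (rule h_projective_SF[OF sf_dif_E,
        where lev = "\<lambda>b. case b of Ge _ \<Rightarrow> 0 | Gr _ \<Rightarrow> 1 | Fe _ \<Rightarrow> 1 | Fr _ \<Rightarrow> 2" and K = 3])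
    (auto simp: edif_def split: egen.splits if_splits nat.splits)


subsection \<open>The modules \<open>\<Sigma>\<^sup>k X\<^sub>l\<close>\<close>

lemma emb_arith:
  "emb (p + q) = emb p + emb q" "emb (smult c p) = vscale c (emb p)" "emb 0 = 0" "emb (- p) = - emb p"
  by (auto simp: emb_def vscale_def fun_eq_iff)

lemma emb_eq_iff [simp]: "(emb p :: ('k::field, 'u) vec) = emb q \<longleftrightarrow> p = q"
  by (auto simp: emb_def fun_eq_iff poly_eq_iff)

lemma conv_emb: "conv (emb p) r = emb (p * r)"
  by (auto simp: conv_def emb_def coeff_mult fun_eq_iff)

text \<open>The element of degree \<open>i\<close> of \<open>\<Sigma>\<^sup>k X\<^sub>l\<close> with coordinates \<open>\<alpha>\<close> and \<open>\<beta>\<close> on the generators of \<open>R\<close> and of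
  \<open>\<Sigma>\<^sup>l\<^sup>+\<^sup>1 R\<close>. It is meaningful only if \<open>xok\<close> holds, as \<open>nat\<close> truncates.\<close>

definition xel :: "int \<Rightarrow> nat \<Rightarrow> int \<Rightarrow> 'k::field \<Rightarrow> 'k \<Rightarrow> ('k, 'u) vec" where
  "xel k l i \<alpha> \<beta> = pair (emb (monom \<beta> (nat (- (i + k + int l + 2))))) (emb (monom \<alpha> (nat (- (i + k)))))"

definition xok :: "int \<Rightarrow> nat \<Rightarrow> int \<Rightarrow> 'k::field \<Rightarrow> 'k \<Rightarrow> bool" where
  "xok k l i \<alpha> \<beta> \<longleftrightarrow> (\<alpha> \<noteq> 0 \<longrightarrow> i + k \<le> 0) \<and> (\<beta> \<noteq> 0 \<longrightarrow> i + k + int l + 2 \<le> 0)"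

lemma xel_inj: "xel k l i \<alpha> \<beta> = xel k l i \<alpha>' \<beta>' \<longleftrightarrow> \<alpha> = \<alpha>' \<and> \<beta> = \<beta>'"
  by (auto simp: xel_def)

lemma xel_arith:
  fixes \<alpha> \<beta> \<alpha>' \<beta>' c :: "'k::field"
  shows
  "xel k l i \<alpha> \<beta> + xel k l i \<alpha>' \<beta>' = (xel k l i (\<alpha> + \<alpha>') (\<beta> + \<beta>') :: ('k, 'u) vec)"
  "vscale c (xel k l i \<alpha> \<beta> :: ('k, 'u) vec) = xel k l i (c * \<alpha>) (c * \<beta>)"
  "xel k l i 0 0 = (0 :: ('k, 'u) vec)" "- xel k l i \<alpha> \<beta> = (xel k l i (- \<alpha>) (- \<beta>) :: ('k, 'u) vec)"
  "xel k l i \<alpha> \<beta> - xel k l i \<alpha>' \<beta>' = (xel k l i (\<alpha> - \<alpha>') (\<beta> - \<beta>') :: ('k, 'u) vec)"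
proof -
  show add: "xel k l i \<alpha> \<beta> + xel k l i \<alpha>' \<beta>' = (xel k l i (\<alpha> + \<alpha>') (\<beta> + \<beta>') :: ('k, 'u) vec)" for \<alpha> \<beta> \<alpha>' \<beta>' :: 'k
    by (simp only: xel_def pair_arith add_monom flip: emb_arith)
  show neg: "- xel k l i \<alpha> \<beta> = (xel k l i (- \<alpha>) (- \<beta>) :: ('k, 'u) vec)" for \<alpha> \<beta> :: 'k
    by (simp only: xel_def pair_arith minus_monom flip: emb_arith)
  show "vscale c (xel k l i \<alpha> \<beta> :: ('k, 'u) vec) = xel k l i (c * \<alpha>) (c * \<beta>)"
    by (simp only: xel_def pair_arith smult_monom flip: emb_arith)
  show "xel k l i 0 0 = (0 :: ('k, 'u) vec)"
    by (simp only: xel_def pair_arith monom_eq_0 emb_arith)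
  show "xel k l i \<alpha> \<beta> - xel k l i \<alpha>' \<beta>' = (xel k l i (\<alpha> - \<alpha>') (\<beta> - \<beta>') :: ('k, 'u) vec)"
    using add[of \<alpha> \<beta> "- \<alpha>'" "- \<beta>'"] neg[of \<alpha>' \<beta>'] by (simp only: diff_conv_add_uminus)
qed

lemma xel_eq_0_iff: "xel k l i \<alpha> \<beta> = 0 \<longleftrightarrow> \<alpha> = 0 \<and> \<beta> = 0"
  using xel_inj[of k l i \<alpha> \<beta> 0 0] by (simp only: xel_arith)

lemma emb_Rgr_iff: "v \<in> emb ` Rgr j \<longleftrightarrow> (\<exists>\<alpha>. (\<alpha> \<noteq> 0 \<longrightarrow> j \<le> 0) \<and> v = emb (monom \<alpha> (nat (- j))))"
proof (cases "j \<le> 0")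
  case False
  then show ?thesis
    by (auto simp: Rgr_def intro!: exI[of _ 0])
qed (auto simp: Rgr_def)

lemma gr_susp_X: "v \<in> gr (susp k (X l)) i \<longleftrightarrow> (\<exists>\<alpha> \<beta>. xok k l i \<alpha> \<beta> \<and> v = xel k l i \<alpha> \<beta>)"
proof -
  have gr: "v \<in> gr (susp k (X l)) i \<longleftrightarrow> pfst v \<in> emb ` Rgr (i + k + int l + 2) \<and> psnd v \<in> emb ` Rgr (i + k)"
    unfolding X_def susp_sel cone_sel R_dgm_def by (simp add: add.commute add.left_commute)
  show ?thesis
  proof
    assume "v \<in> gr (susp k (X l)) i"
    then obtain \<alpha> \<beta> where "\<beta> \<noteq> 0 \<longrightarrow> i + k + int l + 2 \<le> 0" "pfst v = emb (monom \<beta> (nat (- (i + k + int l + 2))))"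
      "\<alpha> \<noteq> 0 \<longrightarrow> i + k \<le> 0" "psnd v = emb (monom \<alpha> (nat (- (i + k))))"
      unfolding gr emb_Rgr_iff by blast
    then show "\<exists>\<alpha> \<beta>. xok k l i \<alpha> \<beta> \<and> v = xel k l i \<alpha> \<beta>"
      unfolding xok_def xel_def by (metis pair_collapse)
  qed (auto simp: gr emb_Rgr_iff xok_def xel_def)
qed

lemma xel_in: "xok k l i \<alpha> \<beta> \<Longrightarrow> xel k l i \<alpha> \<beta> \<in> gr (susp k (X l)) i"
  using gr_susp_X by blast

lemma act_xel:
  assumes "xok k l i \<alpha> \<beta>"
  shows "act (susp k (X l)) i (xel k l i \<alpha> \<beta>) (monom c m) = xel k l (i - int m) (c * \<alpha>) (c * \<beta>)"
proof -
  have 1: "monom (\<beta> * c) (nat (- (i + k + int l + 2)) + m) = monom (c * \<beta>) (nat (- (i - int m + k + int l + 2)))"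
  proof (cases "\<beta> = 0")
    case False
    then have "nat (- (i + k + int l + 2)) + m = nat (- (i - int m + k + int l + 2))"
      using assms unfolding xok_def by arith
    then show ?thesis
      by (simp only: mult.commute)
  qed simp
  have 2: "monom (\<alpha> * c) (nat (- (i + k)) + m) = monom (c * \<alpha>) (nat (- (i - int m + k)))"
  proof (cases "\<alpha> = 0")
    case False
    then have "nat (- (i + k)) + m = nat (- (i - int m + k))"
      using assms unfolding xok_def by arith
    then show ?thesis
      by (simp only: mult.commute)
  qed simp
  show ?thesis
    unfolding X_def susp_sel cone_sel R_dgm_def xel_def dgm.simps pair_sel conv_emb mult_monom 1 2 ..
qed

lemma act_xel_zero: "act (susp k (X l)) i (xel k l i \<alpha> \<beta>) 0 = 0"
  by (simp add: X_def susp_sel cone_sel R_dgm_def xel_def conv_emb emb_arith)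

lemma dif_xel:
  assumes "xok k l i \<alpha> \<beta>"
  shows "dif (susp k (X l :: ('k::field, 'u) dgm)) i (xel k l i \<alpha> \<beta>) = xel k l (i + 1) (if even k then \<beta> else - \<beta>) 0"
proof -
  have 1: "monom \<beta> (nat (- (i + k + int l + 2)) + (l + 1)) = monom \<beta> (nat (- (i + 1 + k)))"
  proof (cases "\<beta> = 0")
    case False
    then have "nat (- (i + k + int l + 2)) + (l + 1) = nat (- (i + 1 + k))"
      using assms unfolding xok_def by arith
    then show ?thesis
      by (simp only:)
  qed simp
  have "dif (X l :: ('k, 'u) dgm) (i + k) (xel k l i \<alpha> \<beta>) = xel k l (i + 1) \<beta> 0"
    unfolding X_def cone_sel susp_sel R_dgm_def using 1
    by (simp add: xel_def conv_emb mult_monom emb_arith)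
  then show ?thesis
    by (simp add: susp_sel xel_arith)
qed

definition sgn_pow :: "int \<Rightarrow> 'k::field" where
  "sgn_pow k = (if even k then 1 else - 1)"

lemma sgn_pow_simps [simp]: "sgn_pow k * sgn_pow k = 1" "sgn_pow k \<noteq> 0" "sgn_pow (k - 1) = - sgn_pow k"
  by (auto simp: sgn_pow_def)

lemma sgn_pow_if: "(if even k then \<beta> else - \<beta>) = sgn_pow k * \<beta>"
  by (simp add: sgn_pow_def)

text \<open>The sign on \<open>Xr\<close> absorbs the sign that suspension puts on the differential
  of \<open>X l\<close>.\<close>

definition xmap :: "int \<Rightarrow> nat \<Rightarrow> ('k::field, 'u) gmap" where
  "xmap k l = (\<lambda>i v. xel k l i (co v Xe) (sgn_pow k * co v Xr))"

lemma Xsf_gr: "v \<in> gr (Xsf k l) i \<longleftrightarrow> (\<exists>c. v = fv c \<and> xok k l i (c Xe) (c Xr))"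
  by (auto simp: Xsf_def Fsp_xdeg_iff xok_def)

lemma dg_hom_xmap: "dg_hom (Xsf k l :: ('k::field, 'u) dgm) (susp k (X l)) (xmap k l)"
proof (rule dg_homI_monom)
  have ok: "xok k l i (co v Xe) (sgn_pow k * co v Xr)" if "v \<in> gr (Xsf k l :: ('k, 'u) dgm) i" for v :: "('k, 'u) vec" and i
    using that by (auto simp: Xsf_gr xok_def)
  show "klinear_on (gr (Xsf k l :: ('k, 'u) dgm) i) (xmap k l i)" for i
    unfolding klinear_on_def xmap_def by (simp add: xel_arith algebra_simps)
  show "xmap k l i v \<in> gr (susp k (X l)) i" if "v \<in> gr (Xsf k l :: ('k, 'u) dgm) i" for i v
    unfolding xmap_def by (rule xel_in[OF ok[OF that]])
  show "xmap k l (i - int m) (act (Xsf k l :: ('k, 'u) dgm) i v (monom c m)) = act (susp k (X l)) i (xmap k l i v) (monom c m)"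
    if "v \<in> gr (Xsf k l :: ('k, 'u) dgm) i" for i v c m
    unfolding xmap_def act_xel[OF ok[OF that]] by (simp add: Xsf_def poly_monom algebra_simps)
  show "xmap k l j (act (Xsf k l :: ('k, 'u) dgm) i v 0) = act (susp k (X l)) i (xmap k l i v) 0" for i j v
    unfolding xmap_def act_xel_zero by (simp add: Xsf_def xel_arith)
  show "xmap k l (i + 1) (dif (Xsf k l :: ('k, 'u) dgm) i v) = dif (susp k (X l)) i (xmap k l i v)"
    if "v \<in> gr (Xsf k l :: ('k, 'u) dgm) i" for i v
    unfolding xmap_def dif_xel[OF ok[OF that]] sgn_pow_if
    by (simp add: Xsf_def xdif_def mult.assoc[symmetric])
qed

lemma bij_xmap: "bij_betw (xmap k l i) (gr (Xsf k l :: ('k::field, 'u) dgm) i) (gr (susp k (X l)) i)"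
proof (rule bij_betw_imageI)
  show "inj_on (xmap k l i) (gr (Xsf k l :: ('k, 'u) dgm) i)"
  proof (rule inj_onI)
    fix v w :: "('k, 'u) vec" assume "v \<in> gr (Xsf k l :: ('k, 'u) dgm) i" "w \<in> gr (Xsf k l :: ('k, 'u) dgm) i" and eq: "xmap k l i v = xmap k l i w"
    then obtain c c' where v: "v = fv (c :: xgen \<Rightarrow> 'k)" and w: "w = fv (c' :: xgen \<Rightarrow> 'k)"
      by (auto simp: Xsf_gr)
    have "c x = c' x" for x
      using eq unfolding xmap_def xel_inj v w co_fv by (cases x) auto
    then show "v = w"
      by (auto simp: v w)
  qed
  show "xmap k l i ` gr (Xsf k l :: ('k, 'u) dgm) i = gr (susp k (X l)) i"
  proof
    show "xmap k l i ` gr (Xsf k l :: ('k, 'u) dgm) i \<subseteq> gr (susp k (X l)) i"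
      using dg_hom_in[OF dg_hom_xmap] by blast
    show "gr (susp k (X l)) i \<subseteq> xmap k l i ` gr (Xsf k l :: ('k, 'u) dgm) i"
    proof
      fix w :: "('k, 'u) vec" assume "w \<in> gr (susp k (X l)) i"
      then obtain \<alpha> \<beta> where w: "xok k l i \<alpha> \<beta>" "w = xel k l i \<alpha> \<beta>"
        by (auto simp: gr_susp_X)
      define c where "c = (\<lambda>b. case b of Xe \<Rightarrow> \<alpha> | Xr \<Rightarrow> sgn_pow k * \<beta>)"
      have "fv c \<in> gr (Xsf k l :: ('k, 'u) dgm) i"
        using w(1) by (auto simp: Xsf_gr xok_def c_def)
      moreover have "w = xmap k l i (fv c)"
        by (simp add: w(2) xmap_def c_def mult.assoc[symmetric])
      ultimately show "w \<in> xmap k l i ` gr (Xsf k l :: ('k, 'u) dgm) i"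
        by blast
    qed
  qed
qed

lemma dg_module_susp_X: "dg_module (susp k (X l))"
  by (rule dg_module_surj_image[OF dg_module_Xsf dg_hom_xmap]) (rule bij_betw_imp_surj_on[OF bij_xmap])

lemma quasi_iso_xmap: "quasi_iso (Xsf k l) (susp k (X l)) (xmap k l)"
  by (rule quasi_isoI_bij[OF dg_module_Xsf dg_hom_xmap bij_xmap dg_module_susp_X])

subsection \<open>The homotopy colimits\<close>

text \<open>The images of the two generators determine the map. By degree, the generator of
  \<open>R\<close> can only go to a multiple \<open>c\<close> of its counterpart; the other
  generator may have two components. Compatibility with the differentials fixes one of them as
  \<open>- c\<close>, the sign coming from the parity change between \<open>k\<close> and
  \<open>k - 1\<close>.\<close>

lemma system_map_form:
  fixes m :: "('k::field, 'u) gmap"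
  assumes m: "dg_hom (susp k (X l)) (susp (k - 1) (X (Suc l))) m"
  obtains c b where "\<And>i \<alpha> \<beta>. xok k l i \<alpha> \<beta> \<Longrightarrow> m i (xel k l i \<alpha> \<beta>) = xel (k - 1) (Suc l) i (c * \<alpha> + b * \<beta>) (- c * \<beta>)"
proof -
  let ?M = "susp k (X l) :: ('k, 'u) dgm" and ?N = "susp (k - 1) (X (Suc l)) :: ('k, 'u) dgm"
  have M: "dg_module ?M"
    by (rule dg_module_susp_X)
  note lin = dg_hom_simps[OF m M]
  have "xok k l (- k) 1 (0::'k)"
    by (simp add: xok_def)
  from dg_hom_in[OF m xel_in[OF this]] obtain c \<beta>0 where ok1: "xok (k - 1) (Suc l) (- k) c \<beta>0"
    and m1: "m (- k) (xel k l (- k) 1 0) = xel (k - 1) (Suc l) (- k) c \<beta>0"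
    unfolding gr_susp_X by blast
  have b0: "\<beta>0 = 0"
    using ok1 by (auto simp: xok_def)
  let ?e = "- k - int l - 2"
  have ok2: "xok k l ?e (0::'k) 1"
    by (simp add: xok_def)
  from dg_hom_in[OF m xel_in[OF this]] obtain b c' where ok3: "xok (k - 1) (Suc l) ?e b c'"
    and m2: "m ?e (xel k l ?e 0 1) = xel (k - 1) (Suc l) ?e b c'"
    unfolding gr_susp_X by blast
  have e: "m i (xel k l i \<alpha> 0) = xel (k - 1) (Suc l) i (c * \<alpha>) 0" if ok: "xok k l i \<alpha> 0" for i \<alpha>
  proof (cases "\<alpha> = 0")
    case True
    then show ?thesis
      using lin(3) by (simp add: xel_arith)
  next
    case False
    then have i: "i + k \<le> 0"
      using ok by (simp add: xok_def)
    have ok0: "xok k l (- k) (1::'k) 0" "xok (k - 1) (Suc l) (- k) c 0"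
      by (simp_all add: xok_def)
    have "m (- k + - int (nat (- k - i))) (act ?M (- k) (xel k l (- k) 1 0) (monom \<alpha> (nat (- k - i)))) =
      act ?N (- k) (m (- k) (xel k l (- k) 1 0)) (monom \<alpha> (nat (- k - i)))"
      by (rule dg_hom_act[OF m xel_in[OF ok0(1)] monom_in_Rgr])
    then show ?thesis
      using i by (simp add: act_xel[OF ok0(1)] m1 b0 act_xel[OF ok0(2)] mult.commute)
  qed
  have r: "m i (xel k l i 0 \<beta>) = xel (k - 1) (Suc l) i (b * \<beta>) (c' * \<beta>)" if ok: "xok k l i 0 \<beta>" for i \<beta>
  proof (cases "\<beta> = 0")
    case True
    then show ?thesis
      using lin(3) by (simp add: xel_arith)
  next
    case False
    then have i: "i \<le> ?e"
      using ok by (simp add: xok_def)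
    have "m (?e + - int (nat (?e - i))) (act ?M ?e (xel k l ?e 0 1) (monom \<beta> (nat (?e - i)))) =
      act ?N ?e (m ?e (xel k l ?e 0 1)) (monom \<beta> (nat (?e - i)))"
      by (rule dg_hom_act[OF m xel_in[OF ok2] monom_in_Rgr])
    then show ?thesis
      using i by (simp add: act_xel[OF ok2] m2 act_xel[OF ok3] mult.commute)
  qed
  have c': "c' = - c"
  proof -
    have "m (?e + 1) (dif ?M ?e (xel k l ?e 0 1)) = dif ?N ?e (m ?e (xel k l ?e 0 1))"
      by (rule dg_hom_dif[OF m xel_in[OF ok2]])
    moreover have "xok k l (?e + 1) (sgn_pow k :: 'k) 0"
      by (simp add: xok_def)
    ultimately have "xel (k - 1) (Suc l) (?e + 1) (c * sgn_pow k) 0 =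
        (xel (k - 1) (Suc l) (?e + 1) (sgn_pow (k - 1) * c') 0 :: ('k, 'u) vec)"
      unfolding dif_xel[OF ok2] sgn_pow_if m2 dif_xel[OF ok3] by (simp add: e)
    then have "sgn_pow k * c = sgn_pow k * - c'"
      by (simp add: xel_inj mult.commute)
    then have "c = - c'"
      unfolding mult_left_cancel[OF sgn_pow_simps(2)] .
    then show ?thesis
      by simp
  qed
  have "m i (xel k l i \<alpha> \<beta>) = xel (k - 1) (Suc l) i (c * \<alpha> + b * \<beta>) (- c * \<beta>)" if ok: "xok k l i \<alpha> \<beta>" for i \<alpha> \<beta>
  proof -
    have ok': "xok k l i \<alpha> 0" "xok k l i 0 \<beta>"
      using ok by (simp_all add: xok_def)
    have "m i (xel k l i \<alpha> \<beta>) = m i (xel k l i \<alpha> 0 + xel k l i 0 \<beta>)"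
      by (simp add: xel_arith)
    also have "\<dots> = m i (xel k l i \<alpha> 0) + m i (xel k l i 0 \<beta>)"
      by (rule lin(1)[OF xel_in[OF ok'(1)] xel_in[OF ok'(2)]])
    finally show ?thesis
      by (simp add: e[OF ok'(1)] r[OF ok'(2)] xel_arith c')
  qed
  then show thesis
    using that by blast
qed

lemma DMor_eqI:
  assumes M: "dg_module M" and N: "dg_module N" and f: "dg_hom M N f" and g: "dg_hom M N g"
    and Z: "dg_module Z" and q: "quasi_iso Z M q" and eq: "homotopic Z N (gcomp f q) (gcomp g q)"
  shows "DMor M N f = DMor M N g"
  unfolding DMor_def
proof (rule roof_class_eqI[OF M N])
  show "roof_eq M N (M, gid, f) (M, gid, g)"
    using Z q quasi_iso_dg_hom[OF q] eq by (intro roof_eqI[of Z _ q _ q]) (simp_all add: homotopic_refl[OF M])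
qed (simp_all add: is_roof_simps M f g quasi_iso_id)

lemma Xsf_sel:
  "gen Xe \<in> gr (Xsf k l :: ('k::field, 'u) dgm) (- k)"
  "gen Xr \<in> gr (Xsf k l :: ('k, 'u) dgm) (- k - int l - 2)"
  "dif (Xsf k l :: ('k, 'u) dgm) i (gen Xe) = 0"
  "dif (Xsf k l :: ('k, 'u) dgm) i (gen Xr) = gen Xe"
proof -
  show "gen Xe \<in> gr (Xsf k l :: ('k, 'u) dgm) (- k)" "gen Xr \<in> gr (Xsf k l :: ('k, 'u) dgm) (- k - int l - 2)"
    unfolding Xsf_def by (rule gen_in, simp add: xdeg_def)+
  have "xdif (\<lambda>b'. if b' = Xe then 1 else 0) = (\<lambda>b. 0 :: 'k)"
    by (auto simp: xdif_def fun_eq_iff split: xgen.splits)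
  then show "dif (Xsf k l :: ('k, 'u) dgm) i (gen Xe) = 0"
    by (simp add: Xsf_def)
  have "xdif (\<lambda>b'. if b' = Xr then 1 else 0) = (\<lambda>b'. if b' = Xe then 1 else (0 :: 'k))"
    by (auto simp: xdif_def fun_eq_iff split: xgen.splits)
  then show "dif (Xsf k l :: ('k, 'u) dgm) i (gen Xr) = gen Xe"
    by (simp add: Xsf_def gen_def)
qed

text \<open>With \<open>c = 0\<close> only the component \<open>b\<close> would remain, and that
  part is null-homotopic.\<close>

lemma system_map_nonzero:
  fixes m :: "('k::field, 'u) gmap"
  assumes m: "dg_hom (susp k (X l)) (susp (k - 1) (X (Suc l))) m"
    and form: "\<And>i \<alpha> \<beta>. xok k l i \<alpha> \<beta> \<Longrightarrow> m i (xel k l i \<alpha> \<beta>) = xel (k - 1) (Suc l) i (c * \<alpha> + b * \<beta>) (- c * \<beta>)"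
    and nz: "DMor (susp k (X l)) (susp (k - 1) (X (Suc l))) m \<noteq> DMor (susp k (X l)) (susp (k - 1) (X (Suc l))) (\<lambda>i x. 0)"
  shows "c \<noteq> 0"
proof
  assume c: "c = 0"
  let ?M = "susp k (X l) :: ('k, 'u) dgm" and ?N = "susp (k - 1) (X (Suc l)) :: ('k, 'u) dgm"
  let ?Z = "Xsf k l :: ('k, 'u) dgm"
  let ?e = "- k - int l - 2"
  note N = dg_module_susp_X[of "k - 1" "Suc l"]
  have mq: "dg_hom ?Z ?N (gcomp m (xmap k l))"
    by (rule dg_hom_comp[OF dg_hom_xmap m])
  \<comment> \<open>\<open>Xr\<close> is sent to a multiple of \<open>T\<close> times the relation
    generator of the target, whose differential is the unwanted component. The signs undo those of
    the suspension and of \<open>xmap\<close>.\<close>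
  define H :: "xgen \<Rightarrow> ('k, 'u) vec" where
    "H x = (case x of Xe \<Rightarrow> 0 | Xr \<Rightarrow> xel (k - 1) (Suc l) (?e - 1) 0 (sgn_pow (k - 1) * (b * sgn_pow k)))" for x
  have okH: "xok (k - 1) (Suc l) (?e - 1) 0 (sgn_pow (k - 1) * (b * sgn_pow k))"
    by (simp add: xok_def)
  have "homotopic ?Z ?N (gcomp m (xmap k l)) (\<lambda>i x. 0)"
    unfolding Xsf_def
  proof (rule SF_homotopicI[OF sf_dif_X N mq[unfolded Xsf_def] dg_hom_zero[OF N]])
    show H_in: "H x \<in> gr ?N (xdeg k l x - 1)" for x
      using xel_in[OF okH] by (cases x) (simp_all add: H_def xdeg_def N)
    fix x
    have ext: "sf_ext (- 1) ?N (xdeg k l) H j (gen Xe) = 0" for j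
    proof -
      have "sf_ext (- 1) ?N (xdeg k l) H j (gen Xe) =
          (\<Sum>b\<in>{Xe}. vscale (co (gen Xe :: ('k, 'u) vec) b) (act ?N (xdeg k l b + - 1) (H b) (monom 1 (nat (xdeg k l b - j)))))"
        by (rule sf_ext_superset) (auto simp: co_gen)
      then show ?thesis
        by (simp add: H_def act_simps(3)[OF N monom_in_Rgr N])
    qed
    show "gcomp m (xmap k l) (xdeg k l x) (gen x) - 0 = dif ?N (xdeg k l x - 1) (H x) +
        sf_ext (- 1) ?N (xdeg k l) H (xdeg k l x + 1) (dif (SF (xdeg k l) xdif) (xdeg k l x) (gen x))"
    proof (cases x)
      case Xe
      have ok: "xok k l (- k) (1::'k) 0"
        by (simp add: xok_def)
      have "sf_ext (- 1) ?N (xdeg k l) H (- k + 1) 0 = 0"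
        by (simp add: sf_ext_def)
      then show ?thesis
        using Xe form[OF ok] c
        by (simp add: Xsf_sel gcomp_def xmap_def xdeg_def H_def dif_simps(3)[OF N N] xel_arith Xsf_def[symmetric] del: SF_sel)
    next
      case Xr
      have ok: "xok k l ?e 0 (sgn_pow k :: 'k)"
        by (simp add: xok_def)
      have "dif ?N (?e - 1) (H Xr) = xel (k - 1) (Suc l) ?e (b * sgn_pow k) 0"
        unfolding H_def xgen.case dif_xel[OF okH] sgn_pow_if
        unfolding mult.assoc[symmetric] sgn_pow_simps(1) by simp
      then show ?thesis
        using Xr form[OF ok] c ext
        by (simp add: Xsf_sel gcomp_def xmap_def xdeg_def xel_arith Xsf_def[symmetric] del: SF_sel)
    qed
  qed
  then have "homotopic ?Z ?N (gcomp m (xmap k l)) (gcomp (\<lambda>i x. 0) (xmap k l))"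
    unfolding gcomp_def .
  then show False
    using nz DMor_eqI[OF dg_module_susp_X N m dg_hom_zero[OF N] dg_module_Xsf quasi_iso_xmap] by blast
qed

section \<open>Coordinates of coproducts, and the comparison of \<open>E\<close> with its
  model\<close>

lemma slot_tuple [simp]: "slot j (tuple F) = F j"
  by (auto simp: slot_def tuple_def fun_eq_iff)

lemma tuple_slot [simp]: "tuple (\<lambda>j. slot j v) = v"
  by (auto simp: slot_def tuple_def fun_eq_iff split: prod.splits dest: arg_cong[where f = prod_encode])

lemma vec_eq_slotI: "(\<And>j. slot j v = slot j w) \<Longrightarrow> v = w"
  by (metis tuple_slot ext)

lemma slot_arith:
  "slot j (v + w) = slot j v + slot j w" "slot j (v - w) = slot j v - slot j w"
  "slot j (vscale c v) = vscale c (slot j v)" "slot j 0 = 0" "slot j (- v) = - slot j v"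
  by (auto simp: slot_def vscale_def fun_eq_iff)

lemma coprod_sel:
  "v \<in> gr (coprod A) i \<longleftrightarrow> (\<forall>j. slot j v \<in> gr (A j) i) \<and> finite {j. slot j v \<noteq> 0}"
  "dif (coprod A) i v = tuple (\<lambda>j. dif (A j) i (slot j v))"
  "act (coprod A) i v r = tuple (\<lambda>j. act (A j) i (slot j v) r)"
  by (simp_all add: coprod_def)

text \<open>All structure scalars \<open>c j\<close> are nonzero, so rescaling the generators turns
  them into 1. Only the null-homotopic components survive, as the parameter
  \<open>\<beta>\<close>.\<close>

lemma E_model:
  fixes E :: "('k::field, 'u) dgm"
  assumes "is_E n E"
  obtains \<beta> f where "dg_hom (Esf n \<beta>) E f" "\<And>i. bij_betw (f i) (gr (Esf n \<beta>) i) (gr E i)"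
proof -
  obtain \<mu> where mu: "\<And>j. dg_hom (susp (n - int j) (X j)) (susp (n - int j - 1) (X (j + 1))) (\<mu> j)"
    and nz: "\<And>j. DMor (susp (n - int j) (X j)) (susp (n - int j - 1) (X (j + 1))) (\<mu> j) \<noteq>
      DMor (susp (n - int j) (X j)) (susp (n - int j - 1) (X (j + 1))) (\<lambda>j x. 0)"
    and E: "E = hocolim (\<lambda>j. susp (n - int j) (X j)) \<mu>"
    using assms unfolding is_E_def by blast
  define P where "P j c b \<longleftrightarrow> c \<noteq> 0 \<and> (\<forall>i \<alpha> \<beta>. xok (n - int j) j i \<alpha> \<beta> \<longrightarrow> \<mu> j i (xel (n - int j) j i \<alpha> \<beta>) =
      xel (n - int j - 1) (Suc j) i (c * \<alpha> + b * \<beta>) (- c * \<beta>))" for j c b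
  have "\<exists>c b. P j c b" for j
  proof -
    obtain c b where cb: "\<And>i \<alpha> \<beta>. xok (n - int j) j i \<alpha> \<beta> \<Longrightarrow> \<mu> j i (xel (n - int j) j i \<alpha> \<beta>) =
        xel (n - int j - 1) (Suc j) i (c * \<alpha> + b * \<beta>) (- c * \<beta>)"
      using system_map_form mu[of j] by (metis Suc_eq_plus1)
    have "c \<noteq> 0"
      by (rule system_map_nonzero[OF mu[of j, folded Suc_eq_plus1] cb nz[of j, folded Suc_eq_plus1]])
    then show ?thesis
      unfolding P_def using cb by blast
  qed
  then obtain c b where "\<And>j. P j (c j) (b j)"
    by metis
  then have c: "\<And>j. c j \<noteq> 0"
    and mu_xel: "\<And>j i \<alpha> \<beta>. xok (n - int j) j i \<alpha> \<beta> \<Longrightarrow> \<mu> j i (xel (n - int j) j i \<alpha> \<beta>) =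
      xel (n - int j - 1) (Suc j) i (c j * \<alpha> + b j * \<beta>) (- c j * \<beta>)"
    unfolding P_def by blast+
  \<comment> \<open>\<open>\<kappa> j\<close> accumulates the scalars of the first \<open>j\<close>
    structure maps. \<open>\<tau> j\<close> also carries the suspension sign, so that in the
    coordinates \<open>x\<close> below neither differentials nor structure maps show a sign.\<close>
  define \<kappa> where "\<kappa> j = (\<Prod>i<j. c i)" for j
  define \<tau> where "\<tau> j = sgn_pow (n - int j) * \<kappa> j" for j
  define \<beta> where "\<beta> j = b j * \<tau> j / \<kappa> (Suc j)" for j
  have \<kappa>: "\<kappa> j \<noteq> 0" "\<kappa> (Suc j) = c j * \<kappa> j" for j
    using c by (simp_all add: \<kappa>_def mult.commute)
  have \<tau>: "\<tau> j \<noteq> 0" "\<tau> (Suc j) = - (c j * \<tau> j)" for j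
  proof -
    show "\<tau> j \<noteq> 0"
      by (simp add: \<tau>_def \<kappa>)
    have s: "n - int (Suc j) = n - int j - 1"
      by simp
    show "\<tau> (Suc j) = - (c j * \<tau> j)"
      unfolding \<tau>_def s sgn_pow_simps(3) \<kappa>(2) by (simp add: mult.left_commute)
  qed
  have \<sigma>\<tau>: "sgn_pow (n - int j) * \<tau> j = \<kappa> j" for j
    by (simp add: \<tau>_def mult.assoc[symmetric])
  define x where "x j i \<alpha> \<rho> = (xel (n - int j) j i (\<kappa> j * \<alpha>) (\<tau> j * \<rho>) :: ('k, 'u) vec)" for j i \<alpha> \<rho>
  let ?A = "\<lambda>j. susp (n - int j) (X j) :: ('k, 'u) dgm"
  \<comment> \<open>The first component of the cone is the suspended coproduct, whence the degree
    \<open>i + 1\<close> for the \<open>F\<close> generators.\<close>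
  define f where "f i v = pair (tuple (\<lambda>j. x j (i + 1) (co v (Fe j)) (co v (Fr j))))
      (tuple (\<lambda>j. x j i (co v (Ge j)) (co v (Gr j))))" for i and v :: "('k, 'u) vec"
  have x_arith: "x j i \<alpha> \<rho> + x j i \<alpha>' \<rho>' = x j i (\<alpha> + \<alpha>') (\<rho> + \<rho>')" "vscale a (x j i \<alpha> \<rho>) = x j i (a * \<alpha>) (a * \<rho>)"
    "x j i \<alpha> \<rho> - x j i \<alpha>' \<rho>' = x j i (\<alpha> - \<alpha>') (\<rho> - \<rho>')" "- x j i \<alpha> \<rho> = x j i (- \<alpha>) (- \<rho>)" "x j i 0 0 = 0"
    for j i \<alpha> \<rho> \<alpha>' \<rho>' a
    by (simp_all add: x_def xel_arith algebra_simps)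
  have x_inj: "x j i \<alpha> \<rho> = x j i \<alpha>' \<rho>' \<longleftrightarrow> \<alpha> = \<alpha>' \<and> \<rho> = \<rho>'" for j i \<alpha> \<rho> \<alpha>' \<rho>'
    by (simp add: x_def xel_inj \<kappa> \<tau>)
  have x_eq0: "x j i \<alpha> \<rho> = 0 \<longleftrightarrow> \<alpha> = 0 \<and> \<rho> = 0" for j i \<alpha> \<rho>
    by (simp add: x_def xel_eq_0_iff \<kappa> \<tau>)
  have x_ok: "xok (n - int j) j i (\<kappa> j * \<alpha>) (\<tau> j * \<rho>) \<longleftrightarrow> (\<alpha> \<noteq> 0 \<longrightarrow> i \<le> int j - n) \<and> (\<rho> \<noteq> 0 \<longrightarrow> i \<le> - n - 2)" for j i \<alpha> \<rho>
    by (auto simp: xok_def \<kappa> \<tau>)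
  have x_dif: "dif (?A j) i (x j i \<alpha> \<rho>) = x j (i + 1) \<rho> 0"
    if "\<alpha> \<noteq> 0 \<longrightarrow> i \<le> int j - n" "\<rho> \<noteq> 0 \<longrightarrow> i \<le> - n - 2" for j i \<alpha> \<rho>
  proof -
    have ok: "xok (n - int j) j i (\<kappa> j * \<alpha>) (\<tau> j * \<rho>)"
      using that by (simp add: x_ok)
    show ?thesis
      unfolding x_def dif_xel[OF ok] sgn_pow_if mult.assoc[symmetric] \<sigma>\<tau> by simp
  qed
  have x_act: "act (?A j) i (x j i \<alpha> \<rho>) (monom a m) = x j (i - int m) (a * \<alpha>) (a * \<rho>)"
    if "\<alpha> \<noteq> 0 \<longrightarrow> i \<le> int j - n" "\<rho> \<noteq> 0 \<longrightarrow> i \<le> - n - 2" for j i \<alpha> \<rho> a m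
  proof -
    have ok: "xok (n - int j) j i (\<kappa> j * \<alpha>) (\<tau> j * \<rho>)"
      using that by (simp add: x_ok)
    show ?thesis
      unfolding x_def act_xel[OF ok] by (simp only: mult.left_commute)
  qed
  have x_act0: "act (?A j) i (x j i \<alpha> \<rho>) 0 = 0" for j i \<alpha> \<rho>
    by (simp add: x_def act_xel_zero)
  have x_mu: "\<mu> j i (x j i \<alpha> \<rho>) = x (Suc j) i (\<alpha> + \<beta> j * \<rho>) \<rho>"
    if "\<alpha> \<noteq> 0 \<longrightarrow> i \<le> int j - n" "\<rho> \<noteq> 0 \<longrightarrow> i \<le> - n - 2" for j i \<alpha> \<rho>
  proof -
    have 1: "c j * (\<kappa> j * \<alpha>) + b j * (\<tau> j * \<rho>) = \<kappa> (Suc j) * (\<alpha> + \<beta> j * \<rho>)"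
      using \<kappa>(1)[of "Suc j"] by (simp add: \<beta>_def \<kappa>(2)[symmetric] distrib_left mult.assoc[symmetric])
    have 2: "- c j * (\<tau> j * \<rho>) = \<tau> (Suc j) * \<rho>"
      by (simp add: \<tau>)
    have 3: "n - int j - 1 = n - int (Suc j)"
      by simp
    show ?thesis
    proof -
      have ok: "xok (n - int j) j i (\<kappa> j * \<alpha>) (\<tau> j * \<rho>)"
        using that by (simp add: x_ok)
      show ?thesis
        unfolding x_def mu_xel[OF ok] 1 2 3 ..
    qed
  qed
  have x_gr: "v \<in> gr (?A j) i \<longleftrightarrow> (\<exists>\<alpha> \<rho>. (\<alpha> \<noteq> 0 \<longrightarrow> i \<le> int j - n) \<and> (\<rho> \<noteq> 0 \<longrightarrow> i \<le> - n - 2) \<and> v = x j i \<alpha> \<rho>)" for v j i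
  proof
    assume "v \<in> gr (?A j) i"
    then obtain \<alpha> \<rho> where v: "xok (n - int j) j i \<alpha> \<rho>" "v = xel (n - int j) j i \<alpha> \<rho>"
      by (auto simp: gr_susp_X)
    then show "\<exists>\<alpha> \<rho>. (\<alpha> \<noteq> 0 \<longrightarrow> i \<le> int j - n) \<and> (\<rho> \<noteq> 0 \<longrightarrow> i \<le> - n - 2) \<and> v = x j i \<alpha> \<rho>"
      using x_ok[of j i "\<alpha> / \<kappa> j" "\<rho> / \<tau> j"] \<kappa>(1)[of j] \<tau>(1)[of j]
      by (intro exI[of _ "\<alpha> / \<kappa> j"] exI[of _ "\<rho> / \<tau> j"]) (simp add: x_def)
  next
    assume "\<exists>\<alpha> \<rho>. (\<alpha> \<noteq> 0 \<longrightarrow> i \<le> int j - n) \<and> (\<rho> \<noteq> 0 \<longrightarrow> i \<le> - n - 2) \<and> v = x j i \<alpha> \<rho>"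
    then show "v \<in> gr (?A j) i"
      using x_ok gr_susp_X unfolding x_def by blast
  qed
  have x_in: "x j i \<alpha> \<rho> \<in> gr (?A j) i" if "\<alpha> \<noteq> 0 \<longrightarrow> i \<le> int j - n" "\<rho> \<noteq> 0 \<longrightarrow> i \<le> - n - 2" for j i \<alpha> \<rho>
    unfolding x_gr using that by blast
  have E_gr: "w \<in> gr E i \<longleftrightarrow> pfst w \<in> gr (coprod ?A) (i + 1) \<and> psnd w \<in> gr (coprod ?A) i" for w i
    by (simp add: E hocolim_def cone_sel)
  have S_gr: "v \<in> gr (Esf n \<beta> :: ('k, 'u) dgm) i \<longleftrightarrow> (\<exists>c. v = fv c \<and> finite {b. c b \<noteq> 0} \<and> (\<forall>b. c b \<noteq> 0 \<longrightarrow> i \<le> edeg n b))" for v i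
    by (auto simp: Esf_def Fsp_def)
  have deg: "co v (Ge j) \<noteq> 0 \<longrightarrow> i \<le> int j - n" "co v (Gr j) \<noteq> 0 \<longrightarrow> i \<le> - n - 2"
    "co v (Fe j) \<noteq> 0 \<longrightarrow> i + 1 \<le> int j - n" "co v (Fr j) \<noteq> 0 \<longrightarrow> i + 1 \<le> - n - 2"
    if v: "v \<in> gr (Esf n \<beta> :: ('k, 'u) dgm) i" for v i j
  proof -
    have d: "co v b \<noteq> 0 \<longrightarrow> i \<le> edeg n b" for b
      using v unfolding S_gr by auto
    show "co v (Ge j) \<noteq> 0 \<longrightarrow> i \<le> int j - n" "co v (Gr j) \<noteq> 0 \<longrightarrow> i \<le> - n - 2"
      "co v (Fe j) \<noteq> 0 \<longrightarrow> i + 1 \<le> int j - n" "co v (Fr j) \<noteq> 0 \<longrightarrow> i + 1 \<le> - n - 2"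
      using d[of "Ge j"] d[of "Gr j"] d[of "Fe j"] d[of "Fr j"] by (auto simp: edeg_def)
  qed
  have hom: "dg_hom (Esf n \<beta>) E f"
  proof (rule dg_homI_monom)
    show "klinear_on (gr (Esf n \<beta> :: ('k, 'u) dgm) i) (f i)" for i
      unfolding klinear_on_def
    proof (intro conjI ballI allI)
      show "f i (v + w) = f i v + f i w" for v w
        by (rule vec_eq_pairI; rule vec_eq_slotI) (simp_all add: f_def proj_arith slot_arith x_arith)
      show "f i (vscale a v) = vscale a (f i v)" for a v
        by (rule vec_eq_pairI; rule vec_eq_slotI) (simp_all add: f_def proj_arith slot_arith x_arith)
    qed
    fix i and v :: "('k, 'u) vec" assume v: "v \<in> gr (Esf n \<beta>) i"
    obtain c' :: "egen \<Rightarrow> 'k" where c': "v = fv c'" "finite {b. c' b \<noteq> 0}"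
      using v unfolding S_gr by blast
    have inj: "inj Ge" "inj Gr" "inj Fe" "inj Fr"
      by (auto simp: inj_def)
    have "finite {j. c' (g j) \<noteq> 0}" if "inj g" for g :: "nat \<Rightarrow> egen"
      using finite_vimageI[OF c'(2) that] by (simp add: vimage_def)
    then have fin: "finite {j. c' (Fe j) \<noteq> 0}" "finite {j. c' (Fr j) \<noteq> 0}" "finite {j. c' (Ge j) \<noteq> 0}" "finite {j. c' (Gr j) \<noteq> 0}"
      using inj by blast+
    have fin': "finite {j. c' (Fe j) = 0 \<longrightarrow> c' (Fr j) \<noteq> 0}" "finite {j. c' (Ge j) = 0 \<longrightarrow> c' (Gr j) \<noteq> 0}"
      by (rule finite_subset[OF _ finite_UnI[OF fin(1,2)]], force)
        (rule finite_subset[OF _ finite_UnI[OF fin(3,4)]], force)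
    show "f i v \<in> gr E i"
      unfolding E_gr coprod_sel f_def pair_sel slot_tuple x_eq0
      using x_in[OF deg(3,4)[OF v]] x_in[OF deg(1,2)[OF v]] fin' by (simp add: c'(1))
    show "f (i - int m) (act (Esf n \<beta>) i v (monom a m)) = act E i (f i v) (monom a m)" for a m
      by (rule vec_eq_pairI; rule vec_eq_slotI)
        (simp_all add: f_def E hocolim_def cone_sel coprod_sel x_act deg[OF v] Esf_def poly_monom diff_add_eq)
    show "f j (act (Esf n \<beta>) i v 0) = act E i (f i v) 0" for j
      by (rule vec_eq_pairI; rule vec_eq_slotI)
        (simp_all add: f_def E hocolim_def cone_sel coprod_sel x_act0 Esf_def x_arith)
    show "f (i + 1) (dif (Esf n \<beta>) i v) = dif E i (f i v)"
    proof (rule vec_eq_pairI; rule vec_eq_slotI)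
      fix j
      show "slot j (pfst (f (i + 1) (dif (Esf n \<beta>) i v))) = slot j (pfst (dif E i (f i v)))"
        by (simp add: f_def E hocolim_def cone_sel coprod_sel slot_arith x_dif deg[OF v] x_arith Esf_def edif_def)
      note D = x_dif[OF deg(1,2)[OF v]] and M = x_mu[OF deg(3,4)[OF v]]
      have R: "slot j (psnd (dif E i (f i v))) = x j (i + 1) (co v (Fe j)) (co v (Fr j)) -
          (case j of 0 \<Rightarrow> 0 | Suc l \<Rightarrow> x (Suc l) (i + 1) (co v (Fe l) + \<beta> l * co v (Fr l)) (co v (Fr l))) +
          x j (i + 1) (co v (Gr j)) 0"
        unfolding f_def E hocolim_def cone_sel coprod_sel slot_arith id_minus_shift_def pair_sel slot_tuple D M ..
      have L: "slot j (psnd (f (i + 1) (dif (Esf n \<beta>) i v))) =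
          x j (i + 1) (edif \<beta> (co v) (Ge j)) (edif \<beta> (co v) (Gr j))"
        by (simp add: f_def Esf_def)
      show "slot j (psnd (f (i + 1) (dif (Esf n \<beta>) i v))) = slot j (psnd (dif E i (f i v)))"
        unfolding R L by (cases j) (simp_all add: x_arith edif_def x_inj)
    qed
  qed
  have "bij_betw (f i) (gr (Esf n \<beta> :: ('k, 'u) dgm) i) (gr E i)" for i
  proof (rule bij_betw_imageI)
    show "inj_on (f i) (gr (Esf n \<beta> :: ('k, 'u) dgm) i)"
    proof (rule inj_onI)
      fix v w :: "('k, 'u) vec"
      assume v: "v \<in> gr (Esf n \<beta>) i" and w: "w \<in> gr (Esf n \<beta>) i" and eq: "f i v = f i w"
      have "x j (i + 1) (co v (Fe j)) (co v (Fr j)) = x j (i + 1) (co w (Fe j)) (co w (Fr j))"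
        "x j i (co v (Ge j)) (co v (Gr j)) = x j i (co w (Ge j)) (co w (Gr j))" for j
        using arg_cong[OF eq, of "\<lambda>v. slot j (pfst v)"] arg_cong[OF eq, of "\<lambda>v. slot j (psnd v)"]
        by (simp_all add: f_def)
      then have "co v b = co w b" for b :: egen
        unfolding x_inj by (cases b) auto
      then have "co v = (co w :: egen \<Rightarrow> 'k)"
        by blast
      then show "v = w"
        using v w unfolding S_gr by auto
    qed
    show "f i ` gr (Esf n \<beta>) i = gr E i"
    proof
      show "f i ` gr (Esf n \<beta>) i \<subseteq> gr E i"
        using dg_hom_in[OF hom] by blast
      show "gr E i \<subseteq> f i ` gr (Esf n \<beta>) i"
      proof
        fix w assume w: "w \<in> gr E i"
        have "\<forall>j. \<exists>\<alpha> \<rho>. (\<alpha> \<noteq> 0 \<longrightarrow> i + 1 \<le> int j - n) \<and> (\<rho> \<noteq> 0 \<longrightarrow> i + 1 \<le> - n - 2) \<and> slot j (pfst w) = x j (i + 1) \<alpha> \<rho>"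
          using w unfolding E_gr coprod_sel x_gr by blast
        then obtain \<alpha> \<rho> where 1: "\<And>j. (\<alpha> j \<noteq> 0 \<longrightarrow> i + 1 \<le> int j - n)" "\<And>j. (\<rho> j \<noteq> 0 \<longrightarrow> i + 1 \<le> - n - 2)"
          "\<And>j. slot j (pfst w) = x j (i + 1) (\<alpha> j) (\<rho> j)"
          by metis
        have "\<forall>j. \<exists>\<alpha> \<rho>. (\<alpha> \<noteq> 0 \<longrightarrow> i \<le> int j - n) \<and> (\<rho> \<noteq> 0 \<longrightarrow> i \<le> - n - 2) \<and> slot j (psnd w) = x j i \<alpha> \<rho>"
          using w unfolding E_gr coprod_sel x_gr by blast
        then obtain \<alpha>' \<rho>' where 2: "\<And>j. (\<alpha>' j \<noteq> 0 \<longrightarrow> i \<le> int j - n)" "\<And>j. (\<rho>' j \<noteq> 0 \<longrightarrow> i \<le> - n - 2)"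
          "\<And>j. slot j (psnd w) = x j i (\<alpha>' j) (\<rho>' j)"
          by metis
        define d where "d b = (case b of Ge j \<Rightarrow> \<alpha>' j | Gr j \<Rightarrow> \<rho>' j | Fe j \<Rightarrow> \<alpha> j | Fr j \<Rightarrow> \<rho> j)" for b
        define J where "J = {j. slot j (pfst w) \<noteq> 0} \<union> {j. slot j (psnd w) \<noteq> 0}"
        have J: "finite J"
          using w unfolding J_def E_gr coprod_sel by blast
        have sub: "{b. d b \<noteq> 0} \<subseteq> Ge ` J \<union> Gr ` J \<union> Fe ` J \<union> Fr ` J"
        proof
          fix b assume "b \<in> {b. d b \<noteq> 0}"
          then show "b \<in> Ge ` J \<union> Gr ` J \<union> Fe ` J \<union> Fr ` J"
            unfolding J_def 1(3) 2(3) x_eq0 by (cases b) (auto simp: d_def)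
        qed
        have "finite {b. d b \<noteq> 0}"
          by (rule finite_subset[OF sub]) (simp add: J)
        moreover have "i \<le> edeg n b" if "d b \<noteq> 0" for b
        proof (cases b)
          case (Ge j)
          then show ?thesis
            using that 2(1)[of j] by (simp add: d_def edeg_def)
        next
          case (Gr j)
          then show ?thesis
            using that 2(2)[of j] by (simp add: d_def edeg_def)
        next
          case (Fe j)
          then show ?thesis
            using that 1(1)[of j] by (simp add: d_def edeg_def)
        next
          case (Fr j)
          then show ?thesis
            using that 1(2)[of j] by (simp add: d_def edeg_def)
        qed
        ultimately have "fv d \<in> gr (Esf n \<beta> :: ('k, 'u) dgm) i"
          unfolding S_gr by blast
        moreover have "f i (fv d) = w"
          by (rule vec_eq_pairI; rule vec_eq_slotI) (simp_all add: f_def d_def 1(3) 2(3))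
        ultimately show "w \<in> f i ` gr (Esf n \<beta>) i"
          by blast
      qed
    qed
  qed
  then show thesis
    using that[OF hom] by blast
qed

section \<open>Interval modules\<close>

text \<open>One line of the universe serves as every nonzero graded piece, so that \<open>T\<close>
  can act as the identity.\<close>

definition sv :: "'k::field \<Rightarrow> ('k, 'u) vec" where
  "sv c = (\<lambda>_. c)"

lemma sv_simps [simp]:
  "sv a + sv b = sv (a + b)" "vscale c (sv a) = sv (c * a)" "sv a = 0 \<longleftrightarrow> a = 0" "sv a = sv b \<longleftrightarrow> a = b"
  by (auto simp: sv_def vscale_def fun_eq_iff)

text \<open>For a homogeneous \<open>r\<close>, \<open>degree r\<close> is the downward shift and
  \<open>poly r 1\<close> the coefficient; the action is cut off where the new degree leaves
  \<open>P\<close>.\<close>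

definition Kint :: "(int \<Rightarrow> bool) \<Rightarrow> ('k::field, 'u) dgm" where
  "Kint P = \<lparr> gr = (\<lambda>i. {sv c | c. c \<noteq> 0 \<longrightarrow> P i}), dif = (\<lambda>i x. 0),
     act = (\<lambda>i x r. if P (i - int (degree r)) then vscale (poly r 1) x else 0) \<rparr>"

text \<open>With a gap in \<open>P\<close>, a power of \<open>T\<close> could act as the identity
  across the gap although the composite of smaller powers is 0. Convexity is what makes the action
  associative.\<close>

definition convex_pred :: "(int \<Rightarrow> bool) \<Rightarrow> bool" where
  "convex_pred P \<longleftrightarrow> (\<forall>i j m. P i \<longrightarrow> P j \<longrightarrow> i \<le> m \<longrightarrow> m \<le> j \<longrightarrow> P m)"

lemma Kint_sel:
  "v \<in> gr (Kint P) i \<longleftrightarrow> (\<exists>c. v = sv c \<and> (c \<noteq> 0 \<longrightarrow> P i))" "dif (Kint P) i x = 0"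
  "act (Kint P) i x (monom c m) = (if P (i - int m) then vscale c x else 0)"
  "act (Kint P) i x 0 = 0"
proof -
  show "act (Kint P) i x (monom c m) = (if P (i - int m) then vscale c x else 0)"
    by (cases "c = 0") (simp_all add: Kint_def degree_monom_eq poly_monom)
qed (auto simp: Kint_def)

lemma Kint_gr_cases:
  assumes "v \<in> gr (Kint P) i"
  shows "\<not> P i \<Longrightarrow> v = 0"
  using assms by (auto simp: Kint_sel)

lemma dg_module_Kint:
  assumes "convex_pred P"
  shows "dg_module (Kint P :: ('k::field, 'u) dgm)"
  unfolding dg_module_def
proof (intro conjI allI ballI)
  let ?N = "Kint P :: ('k, 'u) dgm"
  have z: "sv 0 = (0 :: ('k, 'u) vec)"
    by simp
  show "vec.subspace (gr ?N i)" for i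
  proof (rule vec.subspaceI)
    show "0 \<in> gr ?N i"
      unfolding Kint_sel by (intro exI[of _ 0]) (simp add: z)
  qed (auto simp: Kint_sel)
  show "klinear_on (gr ?N i) (dif ?N i)" for i
    unfolding klinear_on_def Kint_sel by simp
  show "dif ?N i x \<in> gr ?N (i + 1)" for i x
    unfolding Kint_sel by (intro exI[of _ 0]) (simp add: z)
  show "dif ?N (i + 1) (dif ?N i x) = 0" for i x
    unfolding Kint_sel ..
  show "act ?N i x r \<in> gr ?N (i + j)" if x: "x \<in> gr ?N i" and r: "r \<in> Rgr j" for i j x r
    using r
  proof (cases rule: RgrE)
    case (1 c m)
    obtain a where "x = sv a"
      using x by (auto simp: Kint_sel)
    then show ?thesis
      unfolding 1 Kint_sel using z by (intro exI[of _ "if P (i + - int m) then c * a else 0"]) auto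
  next
    case 2
    then show ?thesis
      unfolding 2 Kint_sel by (intro exI[of _ 0]) (simp add: z)
  qed
  show "klinear_on (gr ?N i) (\<lambda>x. act ?N i x r)" for i r
    unfolding klinear_on_def Kint_def by (simp add: vec.scale_right_distrib vec.scale_left_commute)
  show "act ?N i x (r + s) = act ?N i x r + act ?N i x s" if "r \<in> Rgr j" "s \<in> Rgr j" for i j x r s
    using that(1)
  proof (cases rule: RgrE)
    case r: (1 c m)
    show ?thesis
      using that(2)
    proof (cases rule: RgrE)
      case (1 c' m')
      then have s: "s = monom c' m"
        using r by simp
      show ?thesis
        unfolding r(1) s add_monom Kint_sel by (simp add: vec.scale_left_distrib)
    qed (simp add: Kint_sel)
  next
    case 2
    then show ?thesis
      using that(2) by (auto elim: RgrE simp: Kint_sel)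
  qed
  show "act ?N i x (smult c r) = vscale c (act ?N i x r)" if "r \<in> Rgr j" for i j c x r
    using that by (cases rule: RgrE) (simp_all add: smult_monom Kint_sel)
  show "act ?N i x 1 = x" if "x \<in> gr ?N i" for i x
    using that by (auto simp: Kint_def)
  show "act ?N i x (r * s) = act ?N (i + j) (act ?N i x r) s"
    if x: "x \<in> gr ?N i" and "r \<in> Rgr j" "s \<in> Rgr l" for i j l x r s
    using that(2)
  proof (cases rule: RgrE)
    case r: (1 c m)
    show ?thesis
      using that(3)
    proof (cases rule: RgrE)
      case s: (1 c' m')
      have "P (i - int m)" if "P (i - int m - int m')" "x \<noteq> 0"
        using assms x that unfolding convex_pred_def Kint_sel
        by (elim allE[of _ "i - int m - int m'"] allE[of _ i] allE[of _ "i - int m"]) auto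
      then show ?thesis
        unfolding r s mult_monom Kint_sel by (auto simp: mult.commute algebra_simps)
    qed (simp add: Kint_sel)
  qed (simp add: Kint_sel, use that(3) in \<open>auto elim: RgrE simp: Kint_sel\<close>)
  show "dif ?N (i + j) (act ?N i x r) = act ?N (i + 1) (dif ?N i x) r" for i j x r
    unfolding Kint_sel by (simp add: Kint_def)
qed

text \<open>The differential is zero, so the sign of the suspension disappears.\<close>

lemma susp_Kint: "susp 1 (Kint P) = Kint (\<lambda>i. P (i + 1))"
  unfolding susp_def Kint_def by (auto simp: fun_eq_iff algebra_simps)

lemma coboundaries_Kint: "convex_pred P \<Longrightarrow> coboundaries (Kint P) i = {0}"
  by (simp add: coboundaries_def Kint_sel(2) image_constant[OF gr_closed(1)[OF dg_module_Kint]])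

text \<open>A multiple of a generator by a power of \<open>T\<close> keeps the value of the
  generator as long as its degree stays in \<open>P\<close>.\<close>

lemma sf_ext_Kint_gen:
  assumes "i \<le> \<delta> b"
  shows "sf_ext s (Kint P) \<delta> y i (gen b) = (if P (i + s) then y b else 0)"
proof -
  have e: "\<delta> b + s - int (nat (\<delta> b - i)) = i + s"
    using assms by simp
  have "sf_ext s (Kint P) \<delta> y i (gen b) = act (Kint P) (\<delta> b + s) (y b) (monom 1 (nat (\<delta> b - i)))"
    by (subst sf_ext_superset[of "{b}"]) auto
  then show ?thesis
    unfolding Kint_sel e by simp
qed

lemma ghom_Kint_gen:
  assumes "ghom s (SF \<delta> d) (Kint P) f" "i \<le> \<delta> b"
  shows "f i (gen b) = (if P (i + s) then f (\<delta> b) (gen b) else 0)"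
proof -
  have e: "\<delta> b + s - int (nat (\<delta> b - i)) = i + s"
    using assms(2) by simp
  show ?thesis
    unfolding ghom_SF_gen[OF assms] Kint_sel e by simp
qed

section \<open>Cohomology of the model of \<open>X l\<close>, and its maps to half-lines\<close>

lemma xgen_gen_cases: "fv c = vscale (c Xe) (gen Xe) + vscale (c Xr) (gen Xr)"
proof -
  have "c = (\<lambda>b. c Xe * (if b = Xe then 1 else 0)) + (\<lambda>b. c Xr * (if b = Xr then 1 else 0))"
  proof
    fix b
    show "c b = ((\<lambda>b. c Xe * (if b = Xe then 1 else 0)) + (\<lambda>b. c Xr * (if b = Xr then 1 else 0))) b"
      by (cases b) auto
  qed
  then show ?thesis
    unfolding gen_def fv_scale[symmetric] fv_add[symmetric] by (rule arg_cong)
qed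

text \<open>No nonzero multiple of \<open>Xr\<close> is a cocycle, and \<open>Xr\<close> bounds
  \<open>Xe\<close> times the power l+1 of \<open>T\<close>. Cohomology is thus spanned by
  \<open>Xe\<close> times the powers 0 to l of \<open>T\<close>.\<close>

lemma Xsf_Kint:
  defines "P \<equiv> \<lambda>a l i. - a - int l \<le> i \<and> i \<le> - a"
  obtains f where "quasi_iso (Xsf a l :: ('k::field, 'u) dgm) (Kint (P a l)) f"
proof -
  let ?M = "Xsf a l :: ('k, 'u) dgm" and ?N = "Kint (P a l) :: ('k, 'u) dgm"
  define y :: "xgen \<Rightarrow> ('k, 'u) vec" where "y b = (case b of Xe \<Rightarrow> sv 1 | Xr \<Rightarrow> 0)" for b
  let ?f = "sf_ext 0 ?N (xdeg a l) y"
  have conv: "convex_pred (P a l)"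
    by (auto simp: convex_pred_def P_def)
  note N = dg_module_Kint[OF conv]
  have M: "dg_module ?M"
    by (rule dg_module_Xsf)
  have y0: "y b \<in> gr ?N (xdeg a l b + 0)" for b
  proof (cases b)
    case Xe
    have "sv 1 \<in> gr ?N (- a)"
      unfolding Kint_sel P_def by (intro exI[of _ 1]) simp
    then show ?thesis
      using Xe by (simp add: y_def xdeg_def)
  next
    case Xr
    then show ?thesis
      using gr_closed(1)[OF N] by (simp add: y_def)
  qed
  have y: "y b \<in> gr ?N (xdeg a l b)" for b
    using y0[of b] by simp
  have gh: "ghom 0 ?M ?N ?f"
    unfolding Xsf_def by (rule sf_ext_ghom[OF sf_dif_X N y0])
  have hom: "dg_hom ?M ?N ?f"
    unfolding Xsf_def
  proof (rule SF_dg_homI[OF sf_dif_X N y])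
    fix b
    show "?f (xdeg a l b + 1) (dif (SF (xdeg a l) xdif :: ('k, 'u) dgm) (xdeg a l b) (gen b)) = dif ?N (xdeg a l b) (y b)"
    proof (cases b)
      case Xe
      then show ?thesis
        unfolding Xsf_def[symmetric] Kint_sel Xe Xsf_sel(3) by (rule_tac ghom_simps(3)[OF gh M])
    next
      case Xr
      have "?f (xdeg a l Xr + 1) (gen Xe) = 0"
        by (subst sf_ext_Kint_gen) (simp_all add: xdeg_def P_def)
      then show ?thesis
        unfolding Xsf_def[symmetric] Kint_sel Xr Xsf_sel(4) .
    qed
  qed
  have f_e: "?f i (gen Xe) = (if P a l i then sv 1 else 0)" if "i \<le> - a" for i
    using sf_ext_Kint_gen[of i "xdeg a l" Xe 0 "P a l" y] that by (simp add: xdeg_def y_def)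
  have "quasi_iso ?M ?N ?f"
    unfolding quasi_iso_def
  proof (intro conjI allI ballI impI hom)
    fix i v assume v: "v \<in> cocycles ?M i" and fv0: "?f i v \<in> coboundaries ?N i"
    obtain c where c: "v = fv c" "xok a l i (c Xe) (c Xr)"
      using coc_in_gr[OF v] by (auto simp: Xsf_gr)
    have "fv (xdif c) = (0 :: ('k, 'u) vec)"
      using v by (simp add: cocycles_def c(1) Xsf_def)
    then have "fv (xdif c) = (fv (\<lambda>b::xgen. 0) :: ('k, 'u) vec)"
      by simp
    then have "xdif c Xe = 0"
      unfolding fv_eq_iff by simp
    then have r0: "c Xr = 0"
      by (simp add: xdif_def)
    have v': "v = vscale (c Xe) (gen Xe)"
      using c(1) xgen_gen_cases[of c] r0 by simp
    show "v \<in> coboundaries ?M i"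
    proof (cases "c Xe = 0")
      case True
      then show ?thesis
        using v' cob_simps(1)[OF M] by simp
    next
      case False
      then have i: "i \<le> - a"
        using c(2) by (simp add: xok_def)
      have g: "gen Xe \<in> gr ?M i"
        unfolding Xsf_def using i by (intro gen_in) (simp add: xdeg_def)
      have "vscale (c Xe) (?f i (gen Xe)) = 0"
        using fv0 unfolding coboundaries_Kint[OF conv] v' by (simp add: ghom_simps(2)[OF gh M g])
      then have "\<not> P a l i"
        using False f_e[OF i] by (auto split: if_splits)
      \<comment> \<open>Below the interval there is room for \<open>Xr\<close> one degree further
        down, and its differential is the given multiple of \<open>Xe\<close>.\<close>
      then have i': "i - 1 \<le> - a - int l - 2"
        using i by (simp add: P_def)
      have g': "gen Xr \<in> gr ?M (i - 1)"
        unfolding Xsf_def using i' by (intro gen_in) (simp add: xdeg_def)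
      show ?thesis
      proof (rule coboundariesI)
        show "vscale (c Xe) (gen Xr) \<in> gr ?M (i - 1)"
          by (rule gr_closed(5)[OF M g'])
        show "v = dif ?M (i - 1) (vscale (c Xe) (gen Xr))"
          unfolding dif_simps(2)[OF M M g'] Xsf_sel v' ..
      qed
    qed
  next
    fix i w assume "w \<in> cocycles ?N i"
    then obtain c where c: "w = sv c" "c \<noteq> 0 \<longrightarrow> P a l i"
      by (auto simp: cocycles_def Kint_sel)
    show "\<exists>v\<in>cocycles ?M i. ?f i v - w \<in> coboundaries ?N i"
    proof (cases "c = 0")
      case True
      then have "w = 0"
        using c(1) by simp
      then show ?thesis
        using coc_simps(1)[OF M] ghom_simps(3)[OF gh M] cob_simps(1)[OF N] by (intro bexI[of _ 0]) simp_all
    next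
      case False
      then have i: "i \<le> - a" "P a l i"
        using c(2) by (auto simp: P_def)
      have g: "gen Xe \<in> gr ?M i"
        unfolding Xsf_def using i by (intro gen_in) (simp add: xdeg_def)
      then have "gen Xe \<in> cocycles ?M i"
        by (simp add: cocycles_def Xsf_sel)
      moreover have "?f i (vscale c (gen Xe)) = w"
        unfolding ghom_simps(2)[OF gh M g] f_e[OF i(1)] using i(2) c(1) by simp
      ultimately show ?thesis
        using coc_simps(5)[OF M, of "gen Xe" i c] cob_simps(1)[OF N] by (intro bexI[of _ "vscale c (gen Xe)"]) simp_all
    qed
  qed
  then show thesis
    by (rule that)
qed

text \<open>Up to homotopy a map is given by its scalar at \<open>Xe\<close>, which requires
  \<open>m \<le> - a\<close>. The differential of \<open>Xr\<close> is a multiple of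
  \<open>Xe\<close> in degree -a-l-1 and must be sent to 0, so the half-line has to start above that
  degree for the scalar to be nonzero.\<close>

lemma hom_spanned_Xsf_Kint:
  "hom_spanned (Xsf a l :: ('k::field, 'u) dgm) (Kint (\<lambda>i. m \<le> i)) (m \<le> - a \<and> - a - int l - 1 < m)"
proof -
  let ?P = "\<lambda>i::int. m \<le> i"
  let ?b = "m \<le> - a \<and> - a - int l - 1 < m"
  let ?M = "Xsf a l :: ('k, 'u) dgm" and ?N = "Kint ?P :: ('k, 'u) dgm"
  have conv: "convex_pred ?P"
    by (auto simp: convex_pred_def)
  note N = dg_module_Kint[OF conv]
  have M: "dg_module ?M"
    by (rule dg_module_Xsf)
  define y :: "xgen \<Rightarrow> ('k, 'u) vec" where "y x = (case x of Xe \<Rightarrow> if ?b then sv 1 else 0 | Xr \<Rightarrow> 0)" for x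
  let ?f = "sf_ext 0 ?N (xdeg a l) y"
  have y0: "y x \<in> gr ?N (xdeg a l x + 0)" for x
  proof (cases "x = Xe \<and> ?b")
    case True
    then have "sv 1 \<in> gr ?N (xdeg a l x + 0)"
      unfolding Kint_sel by (intro exI[of _ 1]) (simp add: xdeg_def)
    then show ?thesis
      using True by (simp add: y_def)
  next
    case False
    then have "y x = 0"
      by (cases x) (auto simp: y_def)
    then show ?thesis
      using gr_closed(1)[OF N] by simp
  qed
  have y: "y x \<in> gr ?N (xdeg a l x)" for x
    using y0[of x] by simp
  have gh: "ghom 0 ?M ?N ?f"
    unfolding Xsf_def by (rule sf_ext_ghom[OF sf_dif_X N y0])
  have hom: "dg_hom ?M ?N ?f"
    unfolding Xsf_def
  proof (rule SF_dg_homI[OF sf_dif_X N y])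
    fix x
    show "?f (xdeg a l x + 1) (dif (SF (xdeg a l) xdif :: ('k, 'u) dgm) (xdeg a l x) (gen x)) = dif ?N (xdeg a l x) (y x)"
    proof (cases x)
      case Xe
      then show ?thesis
        unfolding Xsf_def[symmetric] Kint_sel Xe Xsf_sel(3) by (rule_tac ghom_simps(3)[OF gh M])
    next
      case Xr
      have "?f (xdeg a l Xr + 1) (gen Xe) = 0"
        by (subst sf_ext_Kint_gen) (auto simp: xdeg_def y_def)
      then show ?thesis
        unfolding Xsf_def[symmetric] Kint_sel Xr Xsf_sel(4) .
    qed
  qed
  have f_e: "?f (- a) (gen Xe) = (if ?b then sv 1 else 0)"
    using sf_ext_gen[where y = y and \<delta> = "xdeg a l", OF N y0, of Xe] by (simp add: xdeg_def y_def)
  have null: "homotopic ?M ?N g (\<lambda>i x. 0)" if g: "dg_hom ?M ?N g" and ge: "g (- a) (gen Xe) = 0" for g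
  proof -
    \<comment> \<open>The value at \<open>Xr\<close> is absorbed by placing it at \<open>Xe\<close>.
      It then has the higher degree -a-1, which is possible because the half-line is unbounded
      above.\<close>
    define H :: "xgen \<Rightarrow> ('k, 'u) vec" where "H x = (case x of Xe \<Rightarrow> g (- a - int l - 2) (gen Xr) | Xr \<Rightarrow> 0)" for x
    have gr: "g (- a - int l - 2) (gen Xr) \<in> gr ?N (- a - int l - 2)"
      by (rule dg_hom_in[OF g Xsf_sel(2)])
    show ?thesis
      unfolding Xsf_def
    proof (rule SF_homotopicI[OF sf_dif_X N g[unfolded Xsf_def] dg_hom_zero[OF N]])
      show "H x \<in> gr ?N (xdeg a l x - 1)" for x
      proof (cases x)
        case Xe
        then show ?thesis
          using gr unfolding Kint_sel by (auto simp: H_def xdeg_def)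
      next
        case Xr
        then show ?thesis
          using gr_closed(1)[OF N] by (simp add: H_def)
      qed
      fix x
      show "g (xdeg a l x) (gen x) - 0 = dif ?N (xdeg a l x - 1) (H x) +
          sf_ext (- 1) ?N (xdeg a l) H (xdeg a l x + 1) (dif (SF (xdeg a l) xdif :: ('k, 'u) dgm) (xdeg a l x) (gen x))"
      proof (cases x)
        case Xe
        have "sf_ext (- 1) ?N (xdeg a l) H i 0 = 0" for i
          by (simp add: sf_ext_def)
        then show ?thesis
          unfolding Xsf_def[symmetric] Kint_sel Xe Xsf_sel(3) using ge by (simp add: xdeg_def)
      next
        case Xr
        have "sf_ext (- 1) ?N (xdeg a l) H (xdeg a l Xr + 1) (gen Xe) = g (- a - int l - 2) (gen Xr)"
          using Kint_gr_cases[OF gr] by (subst sf_ext_Kint_gen) (auto simp: xdeg_def H_def)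
        then show ?thesis
          unfolding Xsf_def[symmetric] Kint_sel Xr Xsf_sel(4) by (simp add: xdeg_def)
      qed
    qed
  qed
  have span: "\<exists>c. homotopic ?M ?N g (\<lambda>i x. vscale c (?f i x))" if g: "dg_hom ?M ?N g" for g
  proof -
    obtain c where c: "g (- a) (gen Xe) = sv c" "c \<noteq> 0 \<longrightarrow> m \<le> - a"
      using dg_hom_in[OF g Xsf_sel(1)] unfolding Kint_sel by blast
    have "g (- a - int l - 2 + 1) (dif ?M (- a - int l - 2) (gen Xr)) = 0"
      using dg_hom_dif[OF g Xsf_sel(2)] unfolding Kint_sel .
    then have "g (- a - int l - 1) (gen Xe) = 0"
      unfolding Xsf_sel by simp
    moreover have "g (- a - int l - 1) (gen Xe) = (if m \<le> - a - int l - 1 then g (- a) (gen Xe) else 0)"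
      using ghom_Kint_gen[OF dg_hom_ghom[OF g, unfolded Xsf_def], of "- a - int l - 1" Xe] by (simp add: xdeg_def)
    ultimately have c': "c \<noteq> 0 \<longrightarrow> ?b"
      using c by (auto split: if_splits)
    have fc: "dg_hom ?M ?N (\<lambda>i x. vscale c (?f i x))"
      by (rule dg_hom_scale[OF M N hom])
    have "g (- a) (gen Xe) - vscale c (?f (- a) (gen Xe)) = 0"
      unfolding c f_e using c' by auto
    then have "homotopic ?M ?N (\<lambda>i x. g i x - vscale c (?f i x)) (\<lambda>i x. 0)"
      by (intro null dg_hom_diff[OF M N g fc])
    then show ?thesis
      using homotopic_diff_zero_iff[OF M N] by blast
  qed
  have "?b \<longleftrightarrow> \<not> homotopic ?M ?N ?f (\<lambda>i x. 0)"
  proof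
    assume b: ?b
    show "\<not> homotopic ?M ?N ?f (\<lambda>i x. 0)"
    proof
      assume h: "homotopic ?M ?N ?f (\<lambda>i x. 0)"
      have "gen Xe \<in> cocycles ?M (- a)"
        unfolding cocycles_def using Xsf_sel by blast
      from homotopic_cohomologous[OF M h this] show False
        unfolding f_e coboundaries_Kint[OF conv] using b by simp
    qed
  next
    assume "\<not> homotopic ?M ?N ?f (\<lambda>i x. 0)"
    then show ?b
      using null[OF hom] f_e by presburger
  qed
  then show ?thesis
    unfolding hom_spanned_def using hom span by blast
qed

section \<open>Cohomology of the model of \<open>E\<close>, and its maps to bounded
  intervals\<close>

lemma fv_diff: "fv c - fv c' = fv (\<lambda>b. c b - c' b)"
  by (auto simp: fv_def fun_eq_iff)

lemma Esf_dif_gen: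
  "dif (Esf n \<beta> :: ('k::field, 'u) dgm) i (gen (Ge j)) = 0"
  "dif (Esf n \<beta> :: ('k, 'u) dgm) i (gen (Gr j)) = gen (Ge j)"
  "dif (Esf n \<beta> :: ('k, 'u) dgm) i (gen (Fe j)) = gen (Ge j) - gen (Ge (Suc j))"
  "dif (Esf n \<beta> :: ('k, 'u) dgm) i (gen (Fr j)) =
     gen (Gr j) - gen (Gr (Suc j)) - gen (Fe j) - vscale (\<beta> j) (gen (Ge (Suc j)))"
proof -
  have "edif \<beta> (\<lambda>b. if b = Ge j then 1 else 0) = (\<lambda>b. 0)"
    by (auto simp: edif_def fun_eq_iff split: egen.splits nat.splits)
  then show "dif (Esf n \<beta> :: ('k::field, 'u) dgm) i (gen (Ge j)) = 0"
    by (simp add: Esf_def)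
  show "dif (Esf n \<beta> :: ('k, 'u) dgm) i (gen (Gr j)) = gen (Ge j)"
    unfolding Esf_def SF_sel co_gen gen_def fv_eq_iff
    by (auto simp: edif_def fun_eq_iff split: egen.splits nat.splits)
  show "dif (Esf n \<beta> :: ('k, 'u) dgm) i (gen (Fe j)) = gen (Ge j) - gen (Ge (Suc j))"
    unfolding Esf_def SF_sel co_gen gen_def fv_diff fv_eq_iff
    by (auto simp: edif_def fun_eq_iff split: egen.splits nat.splits)
  show "dif (Esf n \<beta> :: ('k, 'u) dgm) i (gen (Fr j)) =
      gen (Gr j) - gen (Gr (Suc j)) - gen (Fe j) - vscale (\<beta> j) (gen (Ge (Suc j)))"
    unfolding Esf_def SF_sel co_gen gen_def fv_scale[symmetric] fv_diff fv_eq_iff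
    by (auto simp: edif_def fun_eq_iff split: egen.splits nat.splits)
qed

lemma sv_sum: "(\<Sum>b\<in>A. sv (g b)) = sv (\<Sum>b\<in>A. g b)"
proof (induction A rule: infinite_finite_induct)
  case (infinite A)
  show ?case
    unfolding sum.infinite[OF infinite] by (rule sv_simps(3)[THEN iffD2, OF refl, symmetric])
next
  case empty
  show ?case
    unfolding sum.empty by (rule sv_simps(3)[THEN iffD2, OF refl, symmetric])
next
  case (insert b A)
  show ?case
    unfolding sum.insert[OF insert.hyps] insert.IH by (rule sv_simps(1))
qed

lemma Esf_gr: "v \<in> gr (Esf n \<beta> :: ('k::field, 'u) dgm) i \<longleftrightarrow> (\<exists>c. v = fv c \<and> c \<in> Fsp (edeg n) i)"
  by (auto simp: Esf_def)

text \<open>\<open>Fe j\<close> identifies \<open>Ge j\<close> with \<open>T\<close> times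
  \<open>Ge (Suc j)\<close>, and \<open>Gr j\<close> bounds multiples of \<open>Ge j\<close> from
  degree -n-1 downward. What survives is one line in each degree from -n on.\<close>

lemma Esf_Kint:
  obtains f where "quasi_iso (Esf n \<beta> :: ('k::field, 'u) dgm) (Kint (\<lambda>i. - n \<le> i)) f"
proof -
  let ?P = "\<lambda>i. - n \<le> i"
  let ?M = "Esf n \<beta> :: ('k, 'u) dgm" and ?N = "Kint ?P :: ('k, 'u) dgm"
  define w :: "egen \<Rightarrow> 'k" where "w b = (case b of Ge j \<Rightarrow> 1 | _ \<Rightarrow> 0)" for b
  define y :: "egen \<Rightarrow> ('k, 'u) vec" where "y b = sv (w b)" for b
  let ?f = "sf_ext 0 ?N (edeg n) y"
  have conv: "convex_pred ?P"
    by (auto simp: convex_pred_def)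
  note N = dg_module_Kint[OF conv]
  have M: "dg_module ?M"
    by (rule dg_module_Esf)
  have y: "y b \<in> gr ?N (edeg n b)" for b
    unfolding y_def Kint_sel by (intro exI[of _ "w b"]) (auto simp: w_def edeg_def split: egen.splits)
  have y0: "y b \<in> gr ?N (edeg n b + 0)" for b
    using y[of b] by simp
  have gh: "ghom 0 ?M ?N ?f"
    unfolding Esf_def by (rule sf_ext_ghom[OF sf_dif_E N y0])
  note f_gen = sf_ext_Kint_gen[where \<delta> = "edeg n" and P = ?P and y = y and s = 0]
  have gen_in: "gen b \<in> gr ?M i" if "i \<le> edeg n b" for b i
    unfolding Esf_def using that by (rule gen_in)
  have hom: "dg_hom ?M ?N ?f"
    unfolding Esf_def
  proof (rule SF_dg_homI[OF sf_dif_E N y])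
    fix b
    show "?f (edeg n b + 1) (dif (SF (edeg n) (edif \<beta>) :: ('k, 'u) dgm) (edeg n b) (gen b)) = dif ?N (edeg n b) (y b)"
    proof (cases b)
      case (Ge j)
      show ?thesis
        unfolding Esf_def[symmetric] Kint_sel Ge Esf_dif_gen by (rule ghom_simps(3)[OF gh M])
    next
      case (Gr j)
      show ?thesis
        unfolding Esf_def[symmetric] Kint_sel Gr Esf_dif_gen
        by (subst f_gen) (auto simp: edeg_def)
    next
      case (Fe j)
      let ?i = "edeg n (Fe j) + 1"
      have 1: "gen (Ge j) \<in> gr ?M ?i" "gen (Ge (Suc j)) \<in> gr ?M ?i"
        by (rule gen_in, simp add: edeg_def)+
      have "?f ?i (gen (Ge j)) = y (Ge j)" "?f ?i (gen (Ge (Suc j))) = y (Ge (Suc j))"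
        by (subst f_gen; simp add: edeg_def)+
      then show ?thesis
        unfolding Esf_def[symmetric] Kint_sel Fe Esf_dif_gen ghom_simps(5)[OF gh M 1]
        by (simp add: y_def w_def)
    next
      case (Fr j)
      let ?v = "dif ?M (edeg n (Fr j)) (gen (Fr j))"
      have "?v \<in> gr ?M (edeg n (Fr j) + 1)"
        by (rule dif_in[OF M gen_in]) simp
      then have "?f (edeg n (Fr j) + 1) ?v \<in> gr ?N (edeg n (Fr j) + 1)"
        using ghom_in[OF gh] by fastforce
      then have "?f (edeg n (Fr j) + 1) ?v = 0"
        by (rule Kint_gr_cases) (simp add: edeg_def)
      then show ?thesis
        unfolding Esf_def[symmetric] Kint_sel Fr .
    qed
  qed
  have inj: "inj Ge" "inj Fe"
    by (auto simp: inj_def)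
  have "quasi_iso ?M ?N ?f"
    unfolding quasi_iso_def
  proof (intro conjI allI ballI impI hom)
    fix i v assume v: "v \<in> cocycles ?M i" and fv0: "?f i v \<in> coboundaries ?N i"
    obtain c :: "egen \<Rightarrow> 'k" where c: "v = fv c" "c \<in> Fsp (edeg n) i"
      using coc_in_gr[OF v] unfolding Esf_gr by blast
    have deg: "i \<le> edeg n b" if "c b \<noteq> 0" for b
      using c(2) that by (simp add: Fsp_def)
    have fin: "finite {b. c b \<noteq> 0}"
      using c(2) by (simp add: Fsp_def)
    have finG: "finite {j. c (Ge j) \<noteq> 0}" and finF: "finite {j. c (Fe j) \<noteq> 0}"
      using finite_vimageI[OF fin inj(1)] finite_vimageI[OF fin inj(2)] by (simp_all add: vimage_def)
    have "fv (edif \<beta> c) = (fv (\<lambda>b::egen. 0) :: ('k, 'u) vec)"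
      using v by (simp add: cocycles_def c(1) Esf_def)
    then have z: "edif \<beta> c b = 0" for b
      unfolding fv_eq_iff by simp
    have Fr0: "c (Fr j) = 0" for j
      using z[of "Fe j"] by (simp add: edif_def)
    have Gr: "c (Gr 0) = - c (Fe 0)" "c (Gr (Suc l)) = c (Fe l) - c (Fe (Suc l))" for l
      using z[of "Ge 0"] z[of "Ge (Suc l)"] by (simp_all add: edif_def Fr0 eq_neg_iff_add_eq_0 algebra_simps)
    \<comment> \<open>From degree -n-1 on there is no multiple of any \<open>Gr j\<close>, and the
      cocycle equations then force the \<open>Fe\<close> coordinates to vanish successively.\<close>
    have Fe0: "c (Fe j) = 0" if "- n - 1 \<le> i" for j
    proof (induction j)
      case 0
      show ?case
        using deg[of "Gr 0"] that Gr(1) by (force simp: edeg_def)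
    next
      case (Suc j)
      then show ?case
        using deg[of "Gr (Suc j)"] that Gr(2)[of j] by (force simp: edeg_def)
    qed
    have "\<exists>h. h \<in> Fsp (edeg n) (i - 1) \<and> edif \<beta> h = c"
    proof (cases "i \<le> - n - 1")
      case True
      \<comment> \<open>In low degrees \<open>Gr j\<close> bounds the \<open>Ge\<close> part and
        \<open>Fr j\<close> the \<open>Fe\<close> part. The summand with \<open>\<beta>\<close>
        cancels the contribution of \<open>Fr\<close> to \<open>Ge (Suc l)\<close>.\<close>
      define h where "h b = (case b of Gr j \<Rightarrow> c (Ge j) - (case j of 0 \<Rightarrow> 0 | Suc l \<Rightarrow> \<beta> l * c (Fe l))
        | Fr j \<Rightarrow> - c (Fe j) | _ \<Rightarrow> 0)" for b
      have sub: "{b. h b \<noteq> 0} \<subseteq> Gr ` {j. c (Ge j) \<noteq> 0} \<union> Gr ` Suc ` {j. c (Fe j) \<noteq> 0} \<union> Fr ` {j. c (Fe j) \<noteq> 0}"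
      proof
        fix b assume "b \<in> {b. h b \<noteq> 0}"
        then show "b \<in> Gr ` {j. c (Ge j) \<noteq> 0} \<union> Gr ` Suc ` {j. c (Fe j) \<noteq> 0} \<union> Fr ` {j. c (Fe j) \<noteq> 0}"
          by (cases b) (auto simp: h_def image_iff split: nat.splits)
      qed
      have "finite {b. h b \<noteq> 0}"
        by (rule finite_subset[OF sub]) (simp add: finG finF)
      \<comment> \<open>In the boundary case \<open>i = - n - 1\<close> there is room for
        \<open>Gr\<close> but not for \<open>Fr\<close>; there \<open>Fe0\<close> makes the
        coefficients of \<open>Fr\<close> vanish.\<close>
      moreover have "i - 1 \<le> edeg n b" if "h b \<noteq> 0" for b
        using that True Fe0 by (cases b) (force simp: h_def edeg_def)+
      ultimately have "h \<in> Fsp (edeg n) (i - 1)"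
        by (simp add: Fsp_def)
      moreover have "edif \<beta> h = c"
      proof
        fix b
        show "edif \<beta> h b = c b"
          by (cases b) (auto simp: edif_def h_def Fr0 Gr algebra_simps split: nat.splits)
      qed
      ultimately show ?thesis
        by blast
    next
      case False
      then have i: "- n \<le> i"
        by simp
      have Fe: "c (Fe j) = 0" for j
        using Fe0 i by simp
      have Gr0: "c (Gr j) = 0" for j
        using deg[of "Gr j"] i by (force simp: edeg_def)
      obtain K where K: "\<And>j. c (Ge j) \<noteq> 0 \<Longrightarrow> j \<le> K"
        using finG finite_nat_set_iff_bounded_le by auto
      have v_in: "v \<in> gr (SF (edeg n) (edif \<beta>) :: ('k, 'u) dgm) i"
        using coc_in_gr[OF v] by (simp only: Esf_def)
      have "?f i v = (\<Sum>b::egen | co v b \<noteq> 0. vscale (co v b) (?f i (gen b)))"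
        by (rule ghom_SF_expand[OF sf_dif_E gh[unfolded Esf_def] v_in])
      also have "\<dots> = (\<Sum>b::egen | co v b \<noteq> 0. sv (c b * w b))"
      proof (rule sum.cong[OF refl])
        fix b :: egen assume "b \<in> {b. co v b \<noteq> 0}"
        then have "i \<le> edeg n b"
          using deg c(1) by simp
        from f_gen[OF this] show "vscale (co v b) (?f i (gen b)) = sv (c b * w b)"
          using i by (simp add: c(1) y_def)
      qed
      also have "\<dots> = sv (\<Sum>b::egen | co v b \<noteq> 0. c b * w b)"
        by (rule sv_sum)
      also have "(\<Sum>b | co v b \<noteq> 0. c b * w b) = (\<Sum>b\<in>Ge ` {..K}. c b)"
      proof (rule sum.mono_neutral_cong)
        fix b assume "b \<in> {b. co v b \<noteq> 0} - Ge ` {..K}"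
        then show "c b * w b = 0"
          using K by (cases b) (auto simp: w_def c(1))
      next
        fix b assume "b \<in> {b. co v b \<noteq> 0} \<inter> Ge ` {..K}"
        then show "c b * w b = c b"
          by (auto simp: w_def)
      qed (use fin c(1) in auto)
      also have "\<dots> = (\<Sum>j\<le>K. c (Ge j))"
        using inj(1) by (subst sum.reindex) (auto simp: inj_on_def)
      finally have sum0: "(\<Sum>j\<le>K. c (Ge j)) = 0"
        using fv0 unfolding coboundaries_Kint[OF conv] by simp
      \<comment> \<open>Partial sums telescope under the differential of \<open>Fe\<close>. Their
        support is finite because the total sum is the image of \<open>v\<close> in the interval
        module, which is 0.\<close>
      define h where "h b = (case b of Fe j \<Rightarrow> (\<Sum>k\<le>j. c (Ge k)) | _ \<Rightarrow> 0)" for b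
      have hK: "(\<Sum>k\<le>j. c (Ge k)) = 0" if "K \<le> j" for j
      proof -
        have "(\<Sum>k\<le>j. c (Ge k)) = (\<Sum>k\<le>K. c (Ge k))"
          by (rule sum.mono_neutral_right) (use that K in force)+
        then show ?thesis
          using sum0 by simp
      qed
      have sub: "{b. h b \<noteq> 0} \<subseteq> Fe ` {..K}"
      proof
        fix b assume hb: "b \<in> {b. h b \<noteq> 0}"
        then obtain j where b: "b = Fe j"
          by (cases b) (auto simp: h_def)
        then have "j \<le> K"
          using hb hK[of j] by (cases "K \<le> j") (auto simp: h_def)
        then show "b \<in> Fe ` {..K}"
          using b by blast
      qed
      have "finite {b. h b \<noteq> 0}"
        by (rule finite_subset[OF sub]) simp
      moreover have "i - 1 \<le> edeg n b" if hb: "h b \<noteq> 0" for b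
      proof -
        obtain j where b: "b = Fe j" and "(\<Sum>k\<le>j. c (Ge k)) \<noteq> 0"
          using hb by (cases b) (auto simp: h_def)
        then obtain k where "k \<le> j" "c (Ge k) \<noteq> 0"
          by (meson atMost_iff sum.not_neutral_contains_not_neutral)
        then show ?thesis
          using deg[of "Ge k"] by (simp add: b edeg_def)
      qed
      ultimately have "h \<in> Fsp (edeg n) (i - 1)"
        by (simp add: Fsp_def)
      moreover have "edif \<beta> h = c"
      proof
        fix b
        show "edif \<beta> h b = c b"
          by (cases b) (auto simp: edif_def h_def Fr0 Gr0 Fe split: nat.splits)
      qed
      ultimately show ?thesis
        by blast
    qed
    then obtain h where h: "h \<in> Fsp (edeg n) (i - 1)" "edif \<beta> h = c"
      by blast
    show "v \<in> coboundaries ?M i"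
    proof (rule coboundariesI)
      show "fv h \<in> gr ?M (i - 1)"
        unfolding Esf_gr using h by blast
      show "v = dif ?M (i - 1) (fv h)"
        by (simp add: c(1) h(2) Esf_def)
    qed
  next
    fix i u assume "u \<in> cocycles ?N i"
    then obtain c where c: "u = sv c" "c \<noteq> 0 \<longrightarrow> - n \<le> i"
      by (auto simp: cocycles_def Kint_sel)
    show "\<exists>v\<in>cocycles ?M i. ?f i v - u \<in> coboundaries ?N i"
    proof (cases "c = 0")
      case True
      then have "u = 0"
        using c(1) by simp
      then show ?thesis
        using coc_simps(1)[OF M] ghom_simps(3)[OF gh M] cob_simps(1)[OF N] by (intro bexI[of _ 0]) simp_all
    next
      case False
      define j where "j = nat (i + n)"
      have i: "- n \<le> i" and j: "i = edeg n (Ge j)"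
        using c(2) False by (auto simp: j_def edeg_def)
      have g: "gen (Ge j) \<in> gr ?M i"
        by (rule gen_in) (simp add: j)
      then have "gen (Ge j) \<in> cocycles ?M i"
        by (simp add: cocycles_def Esf_dif_gen)
      moreover have "?f i (vscale c (gen (Ge j))) = u"
        unfolding ghom_simps(2)[OF gh M g] using f_gen[of i "Ge j"] i j c(1) by (simp add: y_def w_def)
      ultimately show ?thesis
        using coc_simps(5)[OF M, of "gen (Ge j)" i c] cob_simps(1)[OF N]
        by (intro bexI[of _ "vscale c (gen (Ge j))"]) simp_all
    qed
  qed
  then show thesis
    by (rule that)
qed

text \<open>The differential of \<open>Fr j\<close> relates the values at \<open>Gr j\<close>,
  \<open>Gr (Suc j)\<close> and \<open>Fe j\<close>. Beyond the upper end \<open>q\<close> the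
  \<open>Fe\<close> values vanish, so the values at \<open>Gr j\<close> are eventually constant;
  this constant classifies the map and can be nonzero only if the common degree -n-2 lies in the
  interval.\<close>

lemma hom_spanned_Esf_Kint:
  "hom_spanned (Esf n \<beta> :: ('k::field, 'u) dgm) (Kint (\<lambda>i. p \<le> i \<and> i \<le> q)) (p \<le> - n - 2 \<and> - n - 2 \<le> q)"
proof -
  let ?P = "\<lambda>i. p \<le> i \<and> i \<le> q"
  let ?b = "?P (- n - 2)"
  let ?M = "Esf n \<beta> :: ('k, 'u) dgm" and ?N = "Kint ?P :: ('k, 'u) dgm"
  have conv: "convex_pred ?P"
    by (auto simp: convex_pred_def)
  note N = dg_module_Kint[OF conv]
  have M: "dg_module ?M"
    by (rule dg_module_Esf)
  have gen_in: "gen b \<in> gr ?M i" if "i \<le> edeg n b" for b i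
    unfolding Esf_def using that by (rule gen_in)
  \<comment> \<open>From this index on, the degree j-n-1 of \<open>Fe j\<close> exceeds
    \<open>q\<close>.\<close>
  define J where "J = nat (q + n + 2)"
  have J: "\<not> ?P (int j - n - 1)" if "J \<le> j" for j
    using that unfolding J_def by linarith
  define y :: "egen \<Rightarrow> ('k, 'u) vec" where "y x = (case x of Gr j \<Rightarrow> if ?b then sv 1 else 0 | _ \<Rightarrow> 0)" for x
  let ?f = "sf_ext 0 ?N (edeg n) y"
  have z: "(0 :: ('k, 'u) vec) \<in> gr ?N i" for i
    by (rule gr_closed(1)[OF N])
  have y: "y x \<in> gr ?N (edeg n x)" for x
  proof (cases "?b \<and> (\<exists>j. x = Gr j)")
    case True
    then have "sv 1 \<in> gr ?N (edeg n x)"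
      unfolding Kint_sel by (intro exI[of _ 1]) (auto simp: edeg_def)
    then show ?thesis
      using True by (auto simp: y_def)
  next
    case False
    then have "y x = 0"
      by (cases x) (auto simp: y_def)
    then show ?thesis
      using z by simp
  qed
  have y0: "y x \<in> gr ?N (edeg n x + 0)" for x
    using y[of x] by simp
  have gh: "ghom 0 ?M ?N ?f"
    unfolding Esf_def by (rule sf_ext_ghom[OF sf_dif_E N y0])
  have Fr_gens: "gen (Gr j) \<in> gr ?M (edeg n (Fr j) + 1)" "gen (Gr (Suc j)) \<in> gr ?M (edeg n (Fr j) + 1)"
    "gen (Fe j) \<in> gr ?M (edeg n (Fr j) + 1)" "gen (Ge (Suc j)) \<in> gr ?M (edeg n (Fr j) + 1)" for j
    by (rule gen_in, simp add: edeg_def)+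
  have Fe_gens: "gen (Ge j) \<in> gr ?M (edeg n (Fe j) + 1)" "gen (Ge (Suc j)) \<in> gr ?M (edeg n (Fe j) + 1)" for j
    by (rule gen_in, simp add: edeg_def)+
  have lin_Fr: "g (edeg n (Fr j) + 1) (dif ?M (edeg n (Fr j)) (gen (Fr j))) =
      g (edeg n (Fr j) + 1) (gen (Gr j)) - g (edeg n (Fr j) + 1) (gen (Gr (Suc j))) -
      g (edeg n (Fr j) + 1) (gen (Fe j)) - vscale (\<beta> j) (g (edeg n (Fr j) + 1) (gen (Ge (Suc j))))"
    if g: "ghom s ?M ?N g" for g s j
    unfolding Esf_dif_gen
    by (simp only: ghom_simps[OF g M] Fr_gens gr_closed[OF M])
  have lin_Fe: "g (edeg n (Fe j) + 1) (dif ?M (edeg n (Fe j)) (gen (Fe j))) =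
      g (edeg n (Fe j) + 1) (gen (Ge j)) - g (edeg n (Fe j) + 1) (gen (Ge (Suc j)))"
    if g: "ghom s ?M ?N g" for g s j
    unfolding Esf_dif_gen
    by (simp only: ghom_simps[OF g M] Fe_gens gr_closed[OF M])
  note f_gen = sf_ext_Kint_gen[where \<delta> = "edeg n" and P = ?P]
  have hom: "dg_hom ?M ?N ?f"
    unfolding Esf_def
  proof (rule SF_dg_homI[OF sf_dif_E N y])
    fix x
    have "?f (edeg n x + 1) (dif ?M (edeg n x) (gen x)) = 0"
    proof (cases x)
      case (Ge j)
      show ?thesis
        unfolding Ge Esf_dif_gen by (rule ghom_simps(3)[OF gh M])
    next
      case (Gr j)
      show ?thesis
        unfolding Gr Esf_dif_gen by (subst f_gen) (auto simp: edeg_def y_def)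
    next
      case (Fe j)
      show ?thesis
        unfolding Fe lin_Fe[OF gh] by (subst (1 2) f_gen) (simp_all add: edeg_def y_def)
    next
      case (Fr j)
      show ?thesis
        unfolding Fr lin_Fr[OF gh] by (subst (1 2 3 4) f_gen) (simp_all add: edeg_def y_def)
    qed
    then show "?f (edeg n x + 1) (dif (SF (edeg n) (edif \<beta>) :: ('k, 'u) dgm) (edeg n x) (gen x)) = dif ?N (edeg n x) (y x)"
      unfolding Kint_sel Esf_def .
  qed
  have f_Gr: "?f (- n - 2) (gen (Gr j)) = (if ?b then sv 1 else 0)" for j
    using sf_ext_gen[where y = y and \<delta> = "edeg n", OF N y0, of "Gr j"] by (simp add: edeg_def y_def)
  note g_gen = ghom_Kint_gen[where P = ?P and \<delta> = "edeg n" and d = "edif \<beta>", folded Esf_def]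
  \<comment> \<open>By the relation of \<open>Fe\<close>, a nonzero value at \<open>Ge j\<close>
    would propagate to all later indices, whose degrees leave the interval at the top.\<close>
  have g_Ge: "g (int j - n) (gen (Ge j)) = 0" if g: "dg_hom ?M ?N g" for g j
  proof (rule ccontr)
    assume nz: "g (int j - n) (gen (Ge j)) \<noteq> 0"
    have step: "g (int j - n) (gen (Ge j)) = (if ?P (int j - n) then g (int (Suc j) - n) (gen (Ge (Suc j))) else 0)" for j
    proof -
      have "g (edeg n (Fe j) + 1) (dif ?M (edeg n (Fe j)) (gen (Fe j))) = 0"
        using dg_hom_dif[OF g gen_in[of "edeg n (Fe j)" "Fe j"]] unfolding Kint_sel by simp
      then have "g (edeg n (Fe j) + 1) (gen (Ge j)) = g (edeg n (Fe j) + 1) (gen (Ge (Suc j)))"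
        unfolding lin_Fe[OF dg_hom_ghom[OF g]] by simp
      then show ?thesis
        using g_gen[OF dg_hom_ghom[OF g], of "edeg n (Fe j) + 1" "Ge (Suc j)"] by (simp add: edeg_def)
    qed
    have "g (int (j + m) - n) (gen (Ge (j + m))) \<noteq> 0" for m
    proof (induction m)
      case 0
      show ?case
        unfolding add_0_right by (rule nz)
    next
      case (Suc m)
      then show ?case
        using step[of "j + m"] by (auto split: if_splits)
    qed
    from this[of "Suc J"] step[of "j + Suc J"] J[of "j + Suc J + 1"] show False
      by (auto split: if_splits)
  qed
  \<comment> \<open>The relation of \<open>Fr j\<close>; its \<open>\<beta>\<close> term drops out
    because \<open>g\<close> vanishes on all \<open>Ge\<close>.\<close>
  have g_Gr: "g (- n - 2) (gen (Gr j)) = g (- n - 2) (gen (Gr (Suc j))) + (if ?b then g (int j - n - 1) (gen (Fe j)) else 0)"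
    if g: "dg_hom ?M ?N g" for g j
  proof -
    have "g (edeg n (Fr j) + 1) (dif ?M (edeg n (Fr j)) (gen (Fr j))) = 0"
      using dg_hom_dif[OF g gen_in[of "edeg n (Fr j)" "Fr j"]] unfolding Kint_sel by simp
    moreover have "g (edeg n (Fr j) + 1) (gen (Fe j)) = (if ?b then g (int j - n - 1) (gen (Fe j)) else 0)"
      using g_gen[OF dg_hom_ghom[OF g], of "edeg n (Fr j) + 1" "Fe j"] by (simp add: edeg_def)
    moreover have "g (edeg n (Fr j) + 1) (gen (Ge (Suc j))) = 0"
      using g_gen[OF dg_hom_ghom[OF g], of "edeg n (Fr j) + 1" "Ge (Suc j)"] g_Ge[OF g, of "Suc j"]
      by (simp add: edeg_def)
    moreover have "edeg n (Fr j) + 1 = - n - 2"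
      by (simp add: edeg_def)
    ultimately show ?thesis
      unfolding lin_Fr[OF dg_hom_ghom[OF g]] by (simp only: vec.scale_zero_right diff_zero add_0_right diff_diff_eq right_minus_eq)
  qed
  have g_Fe0: "g (int j - n - 1) (gen (Fe j)) = 0" if g: "dg_hom ?M ?N g" and "\<not> ?P (int j - n - 1)" for g j
    using Kint_gr_cases[OF dg_hom_in[OF g gen_in[of "int j - n - 1" "Fe j"]]] that(2) by (simp add: edeg_def)
  have null: "homotopic ?M ?N g (\<lambda>i x. 0)"
    if g: "dg_hom ?M ?N g" and ge: "\<And>j. J \<le> j \<Longrightarrow> g (- n - 2) (gen (Gr j)) = 0" for g
  proof -
    \<comment> \<open>The homotopy at \<open>Ge j\<close> must have consecutive differences
      \<open>g (Fe j)\<close>. The tail sums solve this, and they stop at \<open>J\<close>. The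
      summands have different degrees, but all pieces of the interval module are the same
      line.\<close>
    define S where "S j = (\<Sum>k\<in>{j..<J}. g (int k - n - 1) (gen (Fe k)))" for j
    have S_Suc: "S j = g (int j - n - 1) (gen (Fe j)) + S (Suc j)" for j
    proof (cases "j < J")
      case True
      then show ?thesis
        unfolding S_def by (rule sum.atLeast_Suc_lessThan)
    next
      case False
      then have "g (int j - n - 1) (gen (Fe j)) = 0"
        using g_Fe0[OF g J] by simp
      moreover have "{j..<J} = {}" "{Suc j..<J} = {}"
        using False by auto
      ultimately show ?thesis
        unfolding S_def by (simp only: sum.empty add_0)
    qed
    have Gr_S: "g (- n - 2) (gen (Gr j)) = (if ?b then S j else 0)" for j
    proof (cases "J \<le> j")
      case True
      then have "S j = 0"
        unfolding S_def by (simp only: atLeastLessThan_empty sum.empty)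
      then show ?thesis
        using ge[OF True] by simp
    next
      case False
      then have "j \<le> J"
        by simp
      then show ?thesis
      proof (induction j rule: inc_induct)
        case base
        have "S J = 0"
          unfolding S_def by (simp only: atLeastLessThan_empty sum.empty le_refl)
        then show ?case
          using ge[of J] by simp
      next
        case (step j)
        show ?case
        proof (cases ?b)
          case True
          show ?thesis
            unfolding g_Gr[OF g, of j] step.IH S_Suc[of j] if_P[OF True] by (rule add.commute)
        next
          case False
          show ?thesis
            unfolding g_Gr[OF g, of j] step.IH if_not_P[OF False] by (rule add_0_right)
        qed
      qed
    qed
    have S_in: "S j \<in> gr ?N (int j - n - 1)" if "?P (int j - n - 1)" for j
      unfolding S_def
    proof (rule vec.subspace_sum[OF gr_subspace[OF N]])
      fix k assume "k \<in> {j..<J}"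
      have "g (int k - n - 1) (gen (Fe k)) \<in> gr ?N (int k - n - 1)"
        by (rule dg_hom_in[OF g gen_in]) (simp add: edeg_def)
      then show "g (int k - n - 1) (gen (Fe k)) \<in> gr ?N (int j - n - 1)"
        using that unfolding Kint_sel by blast
    qed
    \<comment> \<open>A degree that fails \<open>?P\<close> and lies above one that satisfies it is
      beyond the top of the interval, and so are the degrees of all later
      \<open>Fe k\<close>.\<close>
    have S0: "S j = 0" if "?P i" "i \<le> int j - n - 1" "\<not> ?P (int j - n - 1)" for i j
      unfolding S_def
    proof (rule sum.neutral, rule ballI)
      fix k assume "k \<in> {j..<J}"
      then have "\<not> ?P (int k - n - 1)"
        using that by auto
      then show "g (int k - n - 1) (gen (Fe k)) = 0"
        by (rule g_Fe0[OF g])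
    qed
    define t where "t j = (if ?P (int j - n - 1) then S j else 0)" for j
    \<comment> \<open>The values at \<open>Gr j\<close> are solved for recursively from the equation
      at \<open>Fr j\<close>. The initial value is free and is taken to be 0.\<close>
    define r where "r = rec_nat (0 :: ('k, 'u) vec) (\<lambda>j x. x - g (- n - 3) (gen (Fr j)) -
      vscale (\<beta> j) (if ?P (- n - 3) then t (Suc j) else 0))"
    have r_Suc: "r (Suc j) = r j - g (- n - 3) (gen (Fr j)) - vscale (\<beta> j) (if ?P (- n - 3) then t (Suc j) else 0)" for j
      by (simp add: r_def)
    have t_in: "t j \<in> gr ?N (int j - n - 1)" for j
      using S_in z by (simp add: t_def)
    have t_in': "(if ?P i then t j else 0) \<in> gr ?N i" for i j
      using t_in[of j] z unfolding Kint_sel by (auto split: if_splits)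
    have r_in: "r j \<in> gr ?N (- n - 3)" for j
    proof (induction j)
      case 0
      show ?case
        unfolding r_def nat.rec by (rule z)
    next
      case (Suc j)
      have "g (- n - 3) (gen (Fr j)) \<in> gr ?N (- n - 3)"
        by (rule dg_hom_in[OF g gen_in]) (simp add: edeg_def)
      then show ?case
        unfolding r_Suc by (intro gr_closed(3,5)[OF N] Suc t_in')
    qed
    define H where "H x = (case x of Ge j \<Rightarrow> t j | Gr j \<Rightarrow> r j | _ \<Rightarrow> 0)" for x
    have H_in: "H x \<in> gr ?N (edeg n x + - 1)" for x
    proof (cases x)
      case (Gr j)
      then have "edeg n x + - 1 = - n - 3"
        by (simp add: edeg_def)
      then show ?thesis
        using r_in[of j] by (simp only: Gr H_def egen.case)
    qed (use t_in z in \<open>simp_all add: H_def edeg_def\<close>)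
    note h = sf_ext_ghom[OF sf_dif_E N H_in, of \<beta>, folded Esf_def]
    let ?h = "sf_ext (- 1) ?N (edeg n) H"
    show ?thesis
      unfolding Esf_def
    proof (rule SF_homotopicI[OF sf_dif_E N g[unfolded Esf_def] dg_hom_zero[OF N]])
      show "H x \<in> gr ?N (edeg n x - 1)" for x
        using H_in[of x] by simp
      fix x
      have "g (edeg n x) (gen x) = ?h (edeg n x + 1) (dif ?M (edeg n x) (gen x))"
      proof (cases x)
        case (Ge j)
        have "g (edeg n x) (gen x) = 0"
          using g_Ge[OF g, of j] by (simp add: Ge edeg_def)
        then show ?thesis
          unfolding Ge Esf_dif_gen by (simp only: ghom_simps(3)[OF h M])
      next
        case (Gr j)
        have "?h (edeg n (Gr j) + 1) (gen (Ge j)) = (if ?b then t j else 0)"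
          by (subst f_gen) (auto simp: edeg_def H_def)
        also have "\<dots> = (if ?b then S j else 0)"
          using S0[of "- n - 2" j] by (auto simp: t_def)
        finally show ?thesis
          using Gr_S[of j] unfolding Gr Esf_dif_gen by (simp add: edeg_def)
      next
        case (Fe j)
        have "?h (edeg n (Fe j) + 1) (gen (Ge j)) - ?h (edeg n (Fe j) + 1) (gen (Ge (Suc j))) =
            (if ?P (int j - n - 1) then t j - t (Suc j) else 0)"
          by (subst (1 2) f_gen) (auto simp: edeg_def H_def)
        also have "\<dots> = g (int j - n - 1) (gen (Fe j))"
        proof (cases "?P (int j - n - 1)")
          case True
          then have "t (Suc j) = S (Suc j)"
            using S0[of "int j - n - 1" "Suc j"] by (auto simp: t_def)
          moreover have "t j = S j"
            using True by (simp add: t_def)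
          ultimately show ?thesis
            using True S_Suc[of j] by simp
        next
          case False
          then show ?thesis
            using g_Fe0[OF g] by auto
        qed
        finally show ?thesis
          unfolding Fe lin_Fe[OF h] by (simp add: edeg_def)
      next
        case (Fr j)
        have "?h (edeg n (Fr j) + 1) (gen (Gr j)) = r j" "?h (edeg n (Fr j) + 1) (gen (Gr (Suc j))) = r (Suc j)"
          using Kint_gr_cases[OF r_in[of j]] Kint_gr_cases[OF r_in[of "Suc j"]]
          by (subst f_gen; auto simp: edeg_def H_def)+
        moreover have "?h (edeg n (Fr j) + 1) (gen (Fe j)) = 0"
          by (subst f_gen) (auto simp: edeg_def H_def)
        moreover have "?h (edeg n (Fr j) + 1) (gen (Ge (Suc j))) = (if ?P (- n - 3) then t (Suc j) else 0)"
          by (subst f_gen) (auto simp: edeg_def H_def)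
        ultimately show ?thesis
          unfolding Fr lin_Fr[OF h] using r_Suc[of j] by (simp add: edeg_def)
      qed
      then show "g (edeg n x) (gen x) - 0 = dif ?N (edeg n x - 1) (H x) +
          ?h (edeg n x + 1) (dif (SF (edeg n) (edif \<beta>) :: ('k, 'u) dgm) (edeg n x) (gen x))"
        unfolding Kint_sel Esf_def by simp
    qed
  qed
  have span: "\<exists>c. homotopic ?M ?N g (\<lambda>i x. vscale c (?f i x))" if g: "dg_hom ?M ?N g" for g
  proof -
    have "g (- n - 2) (gen (Gr J)) \<in> gr ?N (- n - 2)"
      by (rule dg_hom_in[OF g gen_in]) (simp add: edeg_def)
    then obtain c where c: "g (- n - 2) (gen (Gr J)) = sv c" "c \<noteq> 0 \<longrightarrow> ?b"
      unfolding Kint_sel by blast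
    have const: "g (- n - 2) (gen (Gr j)) = sv c" if "J \<le> j" for j
      using that
    proof (induction j rule: dec_induct)
      case base
      show ?case
        by (rule c(1))
    next
      case (step j)
      have "g (int j - n - 1) (gen (Fe j)) = 0"
        by (rule g_Fe0[OF g J[OF step.hyps(1)]])
      then show ?case
        using g_Gr[OF g, of j] step.IH by (simp split: if_splits)
    qed
    have fc: "dg_hom ?M ?N (\<lambda>i x. vscale c (?f i x))"
      by (rule dg_hom_scale[OF M N hom])
    have "homotopic ?M ?N (\<lambda>i x. g i x - vscale c (?f i x)) (\<lambda>i x. 0)"
    proof (rule null[OF dg_hom_diff[OF M N g fc]])
      show "g (- n - 2) (gen (Gr j)) - vscale c (?f (- n - 2) (gen (Gr j))) = 0" if "J \<le> j" for j
        unfolding const[OF that] f_Gr using c(2) by auto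
    qed
    then show ?thesis
      using homotopic_diff_zero_iff[OF M N] by blast
  qed
  have "?b \<longleftrightarrow> \<not> homotopic ?M ?N ?f (\<lambda>i x. 0)"
  proof
    assume b: ?b
    show "\<not> homotopic ?M ?N ?f (\<lambda>i x. 0)"
    proof
      assume "homotopic ?M ?N ?f (\<lambda>i x. 0)"
      then obtain h where h: "ghom (- 1) ?M ?N h" and eq: "\<And>i x. x \<in> gr ?M i \<Longrightarrow>
          ?f i x - 0 = dif ?N (i - 1) (h i x) + h (i + 1) (dif ?M i x)"
        by (rule homotopicE) blast
      \<comment> \<open>At \<open>Gr J\<close> a contraction would give 1 as a multiple of its value
        at \<open>Ge J\<close>, and the latter lies above the interval.\<close>
      have g: "gen (Gr J) \<in> gr ?M (- n - 2)" "gen (Ge J) \<in> gr ?M (int J - n)"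
        by (rule gen_in, simp add: edeg_def)+
      have "sv 1 = h (- n - 2 + 1) (gen (Ge J))"
        using eq[OF g(1)] unfolding f_Gr Kint_sel Esf_dif_gen if_P[OF b] by (simp only: diff_zero add_0_left)
      moreover have "h (int J - n) (gen (Ge J)) = 0"
        using Kint_gr_cases[OF ghom_in[OF h g(2)]] J[OF order_refl] by simp
      moreover have "edeg n (Ge J) = int J - n"
        by (simp add: edeg_def)
      ultimately have "sv 1 = (0 :: ('k, 'u) vec)"
        using g_gen[OF h, of "- n - 2 + 1" "Ge J"] by (auto split: if_splits)
      then show False
        by simp
    qed
  next
    assume nh: "\<not> homotopic ?M ?N ?f (\<lambda>i x. 0)"
    show ?b
    proof (rule ccontr)
      assume "\<not> ?b"
      then have "homotopic ?M ?N ?f (\<lambda>i x. 0)"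
        using f_Gr by (intro null[OF hom]) auto
      then show False
        using nh by blast
    qed
  qed
  then show ?thesis
    unfolding hom_spanned_def using hom span by blast
qed

section \<open>Indecomposable objects\<close>

lemma quasi_iso_exact_iff:
  assumes M: "dg_module M" and N: "dg_module N" and f: "quasi_iso M N f"
  shows "cocycles M i \<subseteq> coboundaries M i \<longleftrightarrow> cocycles N i \<subseteq> coboundaries N i"
proof
  note fd = quasi_iso_dg_hom[OF f]
  assume M0: "cocycles M i \<subseteq> coboundaries M i"
  show "cocycles N i \<subseteq> coboundaries N i"
  proof
    fix y assume "y \<in> cocycles N i"
    then obtain x where x: "x \<in> cocycles M i" "f i x - y \<in> coboundaries N i"
      using quasi_iso_surj[OF f] by blast
    have "f i x \<in> coboundaries N i"
      using dg_hom_coboundary[OF fd] M0 x(1) by blast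
    then show "y \<in> coboundaries N i"
      using cob_simps(3)[OF N _ x(2)] by fastforce
  qed
next
  assume "cocycles N i \<subseteq> coboundaries N i"
  then show "cocycles M i \<subseteq> coboundaries M i"
    using quasi_iso_inj[OF f] dg_hom_cocycle[OF M N quasi_iso_dg_hom[OF f]] by blast
qed

lemma Xsf_exact_iff:
  "cocycles (Xsf a l :: ('k::field, 'u) dgm) i \<subseteq> coboundaries (Xsf a l) i \<longleftrightarrow> \<not> (- a - int l \<le> i \<and> i \<le> - a)"
proof -
  let ?P = "\<lambda>i. - a - int l \<le> i \<and> i \<le> - a"
  let ?N = "Kint ?P :: ('k, 'u) dgm"
  have conv: "convex_pred ?P"
    by (auto simp: convex_pred_def)
  obtain f where f: "quasi_iso (Xsf a l :: ('k, 'u) dgm) ?N f"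
    using Xsf_Kint by blast
  have coc: "cocycles ?N i = gr ?N i"
    unfolding cocycles_def Kint_sel(2) by simp
  have "gr ?N i \<subseteq> {0} \<longleftrightarrow> \<not> ?P i"
  proof
    assume sub: "gr ?N i \<subseteq> {0}"
    show "\<not> ?P i"
    proof
      assume "?P i"
      then have "sv 1 \<in> gr ?N i"
        unfolding Kint_sel by (intro exI[of _ 1]) simp
      then have "sv 1 \<in> {0 :: ('k, 'u) vec}"
        using sub by blast
      then show False
        by simp
    qed
  next
    assume "\<not> ?P i"
    then show "gr ?N i \<subseteq> {0}"
      using Kint_gr_cases by blast
  qed
  then show ?thesis
    unfolding quasi_iso_exact_iff[OF dg_module_Xsf dg_module_Kint[OF conv] f] coc coboundaries_Kint[OF conv] .
qed

section \<open>Submodules, functionals, and finiteness of cohomology for summands\<close>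

lemma dg_module_sub:
  assumes M: "dg_module M"
    and sub: "\<And>i. vec.subspace (G i)" "\<And>i. G i \<subseteq> gr M i"
    and dif: "\<And>i x. x \<in> G i \<Longrightarrow> dif M i x \<in> G (i + 1)"
    and act: "\<And>i j x r. x \<in> G i \<Longrightarrow> r \<in> Rgr j \<Longrightarrow> act M i x r \<in> G (i + j)"
  shows "dg_module \<lparr> gr = G, dif = dif M, act = act M \<rparr>"
proof -
  have G: "x \<in> gr M i" if "x \<in> G i" for x i
    using sub(2) that by blast
  have lin: "klinear_on (G i) f" if "klinear_on (gr M i) f" for f i
    using that G unfolding klinear_on_def by blast
  show ?thesis
    unfolding dg_module_def dgm.simps
  proof (intro conjI allI ballI)
    show "klinear_on (G i) (dif M i)" for i
      by (rule lin[OF dif_klinear[OF M]])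
    show "klinear_on (G i) (\<lambda>x. act M i x r)" if "r \<in> Rgr j" for i j r
      by (rule lin[OF act_klinear[OF M that]])
    show "act M i x (r + s) = act M i x r + act M i x s" if "x \<in> G i" "r \<in> Rgr j" "s \<in> Rgr j" for i j x r s
      by (rule act_radd[OF M G[OF that(1)] that(2,3)])
    show "act M i x (smult c r) = vscale c (act M i x r)" if "x \<in> G i" "r \<in> Rgr j" for i j c x r
      by (rule act_smult[OF M G[OF that(1)] that(2)])
    show "act M i x (r * s) = act M (i + j) (act M i x r) s" if "x \<in> G i" "r \<in> Rgr j" "s \<in> Rgr l" for i j l x r s
      by (rule act_mult[OF M G[OF that(1)] that(2,3)])
    show "dif M (i + j) (act M i x r) = act M (i + 1) (dif M i x) r" if "x \<in> G i" "r \<in> Rgr j" for i j x r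
      by (rule dif_act[OF M G[OF that(1)] that(2)])
    show "dif M (i + 1) (dif M i x) = 0" if "x \<in> G i" for i x
      by (rule dif_dif[OF M G[OF that]])
    show "act M i x 1 = x" if "x \<in> G i" for i x
      by (rule act_one[OF M G[OF that]])
  qed (use sub dif act in auto)
qed

lemma separating_functional:
  fixes x :: "('k::field, 'u) vec"
  assumes S: "vec.subspace S" and x: "x \<notin> S"
  obtains f :: "('k, 'u) vec \<Rightarrow> 'k" where "\<And>u v. f (u + v) = f u + f v" "\<And>c u. f (vscale c u) = c * f u"
    "\<And>u. u \<in> S \<Longrightarrow> f u = 0" "f x = 1"
proof -
  interpret vp: vector_space_pair vscale "(*) :: 'k \<Rightarrow> 'k \<Rightarrow> 'k"
    by unfold_locales (auto simp: algebra_simps)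
  obtain B where B: "B \<subseteq> S" "vec.independent B" "S \<subseteq> vec.span B"
    using vec.basis_exists by metis
  have span: "vec.span B = S"
    using B S vec.span_mono[OF B(1)] vec.span_eq_iff[THEN iffD2, OF S] by blast
  have "vec.independent (insert x B)"
    using B(2) x span by (simp add: vec.independent_insert)
  then obtain f where f: "Vector_Spaces.linear vscale (*) f" "\<forall>y\<in>insert x B. f y = (if y = x then 1 else 0)"
    using vp.linear_independent_extend[of "insert x B" "\<lambda>y. if y = x then 1 else 0"] by blast
  interpret f: Vector_Spaces.linear vscale "(*)" f
    by (rule f(1))
  have "f u = 0" if "u \<in> S" for u
  proof -
    have "f y = 0" if "y \<in> B" for y
      using f(2) that x B(1) by auto
    then show ?thesis
      using vp.linear_eq_0_on_span[OF f(1)] that span by blast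
  qed
  then show thesis
    using that[of f] f.add f.scale f(2) by auto
qed

text \<open>A finite set of cocycles spanning the cohomology of \<open>N\<close> is lifted along
  \<open>f\<close>, and injectivity shows that the lifts span.\<close>

lemma finite_total_quasi_iso:
  assumes M: "dg_module M" and N: "dg_module N" and f: "quasi_iso M N f" and fin: "finite_total_cohomology N"
  shows "finite_total_cohomology M"
  unfolding finite_total_cohomology_def
proof (intro conjI allI)
  note fd = quasi_iso_dg_hom[OF f]
  have eq: "cocycles L i = coboundaries L i \<longleftrightarrow> cocycles L i \<subseteq> coboundaries L i" if "dg_module L" for L :: "('a, 'b) dgm" and i
    using coboundaries_cocycles[OF that] by blast
  show "finite {i. cocycles M i \<noteq> coboundaries M i}"
    using fin unfolding finite_total_cohomology_def eq[OF M] eq[OF N] quasi_iso_exact_iff[OF M N f] by blast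
  fix i
  obtain S where S: "finite S" "S \<subseteq> cocycles N i" "\<forall>x\<in>cocycles N i. \<exists>s\<in>vec.span S. x - s \<in> coboundaries N i"
    using fin unfolding finite_total_cohomology_def by blast
  have "\<forall>s\<in>S. \<exists>x. x \<in> cocycles M i \<and> f i x - s \<in> coboundaries N i"
    using S(2) quasi_iso_surj[OF f] by blast
  then obtain h where h: "\<And>s. s \<in> S \<Longrightarrow> h s \<in> cocycles M i" "\<And>s. s \<in> S \<Longrightarrow> f i (h s) - s \<in> coboundaries N i"
    by metis
  have lift: "\<exists>t\<in>vec.span (h ` S). f i t - s \<in> coboundaries N i" if "s \<in> vec.span S" for s
    using that
  proof (induction rule: vec.span_induct_alt)
    case base
    show ?case
      by (rule bexI[of _ 0]) (simp_all only: dg_hom_simps(3)[OF fd M] diff_zero cob_simps(1)[OF N] vec.span_zero)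
  next
    case (step c s v)
    obtain t where t: "t \<in> vec.span (h ` S)" "f i t - v \<in> coboundaries N i"
      using step.IH by blast
    have span: "vec.span (h ` S) \<subseteq> cocycles M i"
      using vec.span_minimal[OF _ subspace_cocycles[OF M]] h(1) by blast
    have in1: "h s \<in> gr M i" "t \<in> gr M i"
      using coc_in_gr h(1)[OF step.hyps(1)] span t(1) by blast+
    have "vscale c (f i (h s) - s) + (f i t - v) \<in> coboundaries N i"
      by (intro cob_simps(2,5)[OF N] h(2)[OF step.hyps(1)] t(2))
    moreover have "f i (vscale c (h s) + t) - (vscale c s + v) = vscale c (f i (h s) - s) + (f i t - v)"
      using in1 gr_closed(5)[OF M in1(1)] by (simp add: dg_hom_simps[OF fd M] vec.scale_right_diff_distrib)
    ultimately have "f i (vscale c (h s) + t) - (vscale c s + v) \<in> coboundaries N i"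
      by (simp only:)
    moreover have "vscale c (h s) + t \<in> vec.span (h ` S)"
      by (intro vec.span_add vec.span_scale t(1) vec.span_base imageI step.hyps(1))
    ultimately show ?case
      by blast
  qed
  show "\<exists>S. finite S \<and> S \<subseteq> cocycles M i \<and> (\<forall>x\<in>cocycles M i. \<exists>s\<in>vec.span S. x - s \<in> coboundaries M i)"
  proof (intro exI[of _ "h ` S"] conjI ballI)
    show "finite (h ` S)" "h ` S \<subseteq> cocycles M i"
      using S(1) h(1) by auto
    fix x assume x: "x \<in> cocycles M i"
    obtain s where s: "s \<in> vec.span S" "f i x - s \<in> coboundaries N i"
      using S(3) dg_hom_cocycle[OF M N fd x] by blast
    obtain t where t: "t \<in> vec.span (h ` S)" "f i t - s \<in> coboundaries N i"
      using lift[OF s(1)] by blast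
    have tc: "t \<in> cocycles M i"
      using t(1) vec.span_minimal[OF _ subspace_cocycles[OF M]] h(1) by blast
    have "f i (x - t) = (f i x - s) - (f i t - s)"
      using coc_in_gr[OF x] coc_in_gr[OF tc] by (simp add: dg_hom_simps[OF fd M])
    then have "f i (x - t) \<in> coboundaries N i"
      using cob_simps(3)[OF N s(2) t(2)] by (simp only:)
    then have "x - t \<in> coboundaries M i"
      by (rule quasi_iso_inj[OF f coc_simps(3)[OF M x tc]])
    then show "\<exists>s\<in>vec.span (h ` S). x - s \<in> coboundaries M i"
      using t(1) by blast
  qed
qed

lemma finite_total_retract:
  assumes M: "dg_module M" and N: "dg_module N" and u: "dg_hom M N u" and r: "dg_hom N M r"
    and ru: "\<And>i x. x \<in> gr M i \<Longrightarrow> r i (u i x) = x" and fin: "finite_total_cohomology N"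
  shows "finite_total_cohomology M"
  unfolding finite_total_cohomology_def
proof (intro conjI allI)
  have "{i. cocycles M i \<noteq> coboundaries M i} \<subseteq> {i. cocycles N i \<noteq> coboundaries N i}"
  proof
    fix i assume "i \<in> {i. cocycles M i \<noteq> coboundaries M i}"
    then obtain x where x: "x \<in> cocycles M i" "x \<notin> coboundaries M i"
      using coboundaries_cocycles[OF M] by blast
    have "u i x \<in> cocycles N i"
      by (rule dg_hom_cocycle[OF M N u x(1)])
    moreover have "u i x \<notin> coboundaries N i"
      using dg_hom_coboundary[OF r, of "u i x" i] ru[OF coc_in_gr[OF x(1)]] x(2) by auto
    ultimately show "i \<in> {i. cocycles N i \<noteq> coboundaries N i}"
      by blast
  qed
  then show "finite {i. cocycles M i \<noteq> coboundaries M i}"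
    using fin finite_subset unfolding finite_total_cohomology_def by blast
  fix i
  obtain S where S: "finite S" "S \<subseteq> cocycles N i" "\<forall>x\<in>cocycles N i. \<exists>s\<in>vec.span S. x - s \<in> coboundaries N i"
    using fin unfolding finite_total_cohomology_def by blast
  have span: "vec.span S \<subseteq> cocycles N i"
    using vec.span_minimal[OF S(2) subspace_cocycles[OF N]] .
  \<comment> \<open>Membership in the span of \<open>S\<close> is carried along, because
    \<open>r\<close> is linear only on the pieces of \<open>N\<close>.\<close>
  have r_span': "s \<in> vec.span S \<and> r i s \<in> vec.span (r i ` S)" if "s \<in> vec.span S" for s
    using that
  proof (induction rule: vec.span_induct_alt)
    case base
    show ?case
      unfolding dg_hom_simps(3)[OF r N] by (intro conjI vec.span_zero)
  next
    case (step c s v)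
    have in0: "s \<in> vec.span S" "v \<in> vec.span S"
      using vec.span_base[OF step.hyps(1)] step.IH by blast+
    have in1: "s \<in> gr N i" "v \<in> gr N i"
      using in0 span coc_in_gr by blast+
    have "r i (vscale c s + v) \<in> vec.span (r i ` S)"
      unfolding dg_hom_simps(1)[OF r N gr_closed(5)[OF N in1(1)] in1(2)] dg_hom_simps(2)[OF r N in1(1)]
      by (rule vec.span_add[OF vec.span_scale[OF vec.span_base[OF imageI[OF step.hyps(1)]]] conjunct2[OF step.IH]])
    then show ?case
      using vec.span_add[OF vec.span_scale[OF in0(1)] in0(2)] by blast
  qed
  note r_span = conjunct2[OF r_span']
  show "\<exists>S. finite S \<and> S \<subseteq> cocycles M i \<and> (\<forall>x\<in>cocycles M i. \<exists>s\<in>vec.span S. x - s \<in> coboundaries M i)"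
  proof (intro exI[of _ "r i ` S"] conjI ballI)
    show "finite (r i ` S)" "r i ` S \<subseteq> cocycles M i"
      using S(1,2) dg_hom_cocycle[OF N M r] by auto
    fix x assume x: "x \<in> cocycles M i"
    have ux: "u i x \<in> cocycles N i"
      by (rule dg_hom_cocycle[OF M N u x])
    then obtain s where s: "s \<in> vec.span S" "u i x - s \<in> coboundaries N i"
      using S(3) by blast
    have "s \<in> gr N i"
      using s(1) span coc_in_gr by blast
    then have "r i (u i x - s) = x - r i s"
      using coc_in_gr[OF ux] ru[OF coc_in_gr[OF x]] by (simp add: dg_hom_simps[OF r N])
    then have "x - r i s \<in> coboundaries M i"
      using dg_hom_coboundary[OF r s(2)] by (simp only:)
    then show "\<exists>s\<in>vec.span (r i ` S). x - s \<in> coboundaries M i"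
      using r_span[OF s(1)] by blast
  qed
qed

lemma dsum_maps:
  assumes A: "dg_module A" and B: "dg_module B"
  shows "dg_hom A (dsum A B) (\<lambda>i x. pair x 0)" "dg_hom B (dsum A B) (\<lambda>i x. pair 0 x)"
    "dg_hom (dsum A B) A (\<lambda>i. pfst)" "dg_hom (dsum A B) B (\<lambda>i. psnd)"
  unfolding dg_hom_def
  by (auto simp: klinear_on_def dsum_sel pair_arith proj_arith dif_simps[OF A A] dif_simps[OF B B]
      act_simps[OF A _ A] act_simps[OF B _ B] A B)

lemma finite_total_dsum:
  assumes A: "dg_module A" and B: "dg_module B" and fin: "finite_total_cohomology (dsum A B)"
  shows "finite_total_cohomology A" "finite_total_cohomology B"
  using finite_total_retract[OF A dg_module_dsum[OF A B] dsum_maps(1,3)[OF A B] _ fin]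
    finite_total_retract[OF B dg_module_dsum[OF A B] dsum_maps(2,4)[OF A B] _ fin] by simp_all

lemma zero_dgm_sel: "gr zero_dgm i = {0}" "dif zero_dgm i x = 0" "act zero_dgm i x r = 0"
  by (simp_all add: zero_dgm_def)

lemma finite_total_zero: "finite_total_cohomology (zero_dgm :: ('k::field, 'u) dgm)"
proof -
  have "cocycles (zero_dgm :: ('k, 'u) dgm) i = {0}" "coboundaries (zero_dgm :: ('k, 'u) dgm) i = {0}" for i
    by (auto simp: cocycles_def coboundaries_def zero_dgm_sel)
  then show ?thesis
    unfolding finite_total_cohomology_def
    by (auto intro!: exI[of _ "{}"] simp: vec.span_empty)
qed

lemma derived_iso_zero_if_acyclic:
  assumes Y: "dg_module Y" and ac: "\<And>i. cocycles Y i \<subseteq> coboundaries Y i"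
  shows "derived_iso Y zero_dgm"
proof (rule derived_iso_roof[OF Y dg_module_zero dg_module_zero _ quasi_iso_id[OF dg_module_zero]])
  show "quasi_iso zero_dgm Y (\<lambda>i x. 0)"
    unfolding quasi_iso_def
  proof (intro conjI allI ballI impI dg_hom_zero[OF Y])
    show "x \<in> coboundaries zero_dgm i" if "x \<in> cocycles zero_dgm i" for x :: "('a, 'b) vec" and i
      using that by (auto simp: cocycles_def coboundaries_def zero_dgm_sel)
    show "\<exists>x\<in>cocycles zero_dgm i. 0 - y \<in> coboundaries Y i" if "y \<in> cocycles Y i" for y i
    proof (rule bexI)
      show "0 - y \<in> coboundaries Y i"
        using cob_simps(3)[OF Y cob_simps(1)[OF Y]] that ac by blast
      show "0 \<in> cocycles zero_dgm i"
        by (simp add: cocycles_def zero_dgm_sel)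
    qed
  qed
qed

text \<open>A class \<open>x\<close> of top degree with \<open>x T\<^sup>l \<noteq> 0\<close> and \<open>x T\<^sup>l\<^sup>+\<^sup>1 = 0\<close> in cohomology splits off a copy of \<open>\<Sigma>\<^sup>a X\<^sub>l\<close>: a
  complement is cut out by a functional \<open>\<Lambda>\<close> on the degree of \<open>x T\<^sup>l\<close> with \<open>\<Lambda> (x T\<^sup>l) = 1\<close>, after truncating above
  the top degree.\<close>

lemma split_off:
  fixes Y :: "('k::field, 'u) dgm"
  assumes Y: "dg_module Y" and fin: "finite_total_cohomology Y" and nz: "\<not> cocycles Y i0 \<subseteq> coboundaries Y i0"
  obtains a l B g where "dg_module B" "dg_hom (Xsf a l) Y g"
    "quasi_iso (dsum (Xsf a l) B) Y (\<lambda>i v. g i (pfst v) + psnd v)"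
    "\<And>i. cocycles B i \<subseteq> cocycles Y i" "\<And>i. coboundaries B i \<subseteq> coboundaries Y i"
proof -
  define D where "D = {i. cocycles Y i \<noteq> coboundaries Y i}"
  have D: "finite D" "D \<noteq> {}"
    using fin nz by (auto simp: D_def finite_total_cohomology_def)
  have exact: "cocycles Y i \<subseteq> coboundaries Y i" if "i \<notin> D" for i
    using that by (simp add: D_def)
  define t where "t = Max D"
  have top: "cocycles Y i \<subseteq> coboundaries Y i" if "t < i" for i
    using Max_ge[OF D(1), of i] that exact by (auto simp: t_def)
  have tD: "t \<in> D"
    using Max_in[OF D] by (simp add: t_def)
  then obtain x where x: "x \<in> cocycles Y t" "x \<notin> coboundaries Y t"
    using coboundaries_cocycles[OF Y] unfolding D_def by blast
  define T where "T i m y = act Y i y (monom 1 m)" for i m y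
  have T_in: "T i m y \<in> gr Y (i - int m)" if "y \<in> gr Y i" for i m y
    unfolding T_def by (rule act_in'[OF Y that monom_in_Rgr]) simp
  have T_lin: "T i m (y + y') = T i m y + T i m y'" "T i m (y - y') = T i m y - T i m y'"
    "T i m (vscale c y) = vscale c (T i m y)" if "y \<in> gr Y i" "y' \<in> gr Y i" for i m y y' c
    unfolding T_def using that by (simp_all only: act_simps[OF Y monom_in_Rgr Y])
  have T_0: "T i m 0 = 0" for i m
    unfolding T_def by (rule act_simps(3)[OF Y monom_in_Rgr Y])
  have T_T: "T (i - int m) m' (T i m y) = T i (m + m') y" if "y \<in> gr Y i" for i m m' y
    using act_mult[OF Y that monom_in_Rgr[of 1 m] monom_in_Rgr[of 1 m']] by (simp add: T_def mult_monom)
  have T_dif: "dif Y (i - int m) (T i m y) = T (i + 1) m (dif Y i y)" if "y \<in> gr Y i" for i m y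
    using dif_act[OF Y that monom_in_Rgr[of 1 m]] by (simp add: T_def)
  have T0: "T i 0 y = y" if "y \<in> gr Y i" for i y
    using act_one[OF Y that] by (simp add: T_def monom_0 one_pCons)
  have T_coc: "T i m y \<in> cocycles Y (i - int m)" if "y \<in> cocycles Y i" for i m y
    using that T_in T_dif T_0 by (simp add: cocycles_def)
  have xg: "x \<in> gr Y t"
    by (rule coc_in_gr[OF x(1)])
  define Q where "Q m \<longleftrightarrow> T t m x \<in> coboundaries Y (t - int m)" for m
  \<comment> \<open>Cohomology lives in finitely many degrees, so some power of \<open>T\<close>
    moves the class of \<open>x\<close> into a degree where it vanishes.\<close>
  have "\<exists>m. t - int m \<notin> D"
  proof (rule ccontr)
    assume "\<nexists>m. t - int m \<notin> D"
    then have "range (\<lambda>m. t - int m) \<subseteq> D"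
      by blast
    then have "finite (range (\<lambda>m. t - int m))"
      using D(1) finite_subset by blast
    then have "finite (UNIV :: nat set)"
      by (rule finite_imageD) (simp add: inj_def)
    then show False
      by simp
  qed
  then have ex: "\<exists>m. Q m"
    using exact T_coc[OF x(1)] unfolding Q_def by blast
  have "\<not> Q 0"
    using x(2) T0[OF xg] by (simp add: Q_def)
  have "\<exists>l. \<not> Q l \<and> Q (Suc l)"
  proof (rule ccontr)
    assume no: "\<nexists>l. \<not> Q l \<and> Q (Suc l)"
    have "\<not> Q m" for m
      by (induction m) (use \<open>\<not> Q 0\<close> no in blast)+
    then show False
      using ex by blast
  qed
  then obtain l where l: "\<not> Q l" "Q (Suc l)"
    by blast
  define p where "p = t - int l"
  obtain \<Lambda> where \<Lambda>: "\<And>u v. \<Lambda> (u + v) = \<Lambda> u + \<Lambda> v" "\<And>c u. \<Lambda> (vscale c u) = c * \<Lambda> u"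
    "\<And>u. u \<in> coboundaries Y p \<Longrightarrow> \<Lambda> u = 0" "\<Lambda> (T t l x) = 1"
    using separating_functional[OF subspace_coboundaries[OF Y], of "T t l x" p] l(1) unfolding Q_def p_def by blast
  have \<Lambda>0: "\<Lambda> 0 = 0"
    using \<Lambda>(2)[of 0 0] by simp
  \<comment> \<open>The functional in degree \<open>i\<close> is \<Lambda> after multiplication by
    \<open>T\<close> down to degree \<open>p\<close>; it is therefore compatible with the action and
    kills coboundaries.\<close>
  define L where "L i y = \<Lambda> (T i (nat (i - p)) y)" for i y
  have L_lin: "L i (y + y') = L i y + L i y'" "L i (vscale c y) = c * L i y" if "y \<in> gr Y i" "y' \<in> gr Y i" for i y y' c
    unfolding L_def T_lin[OF that] \<Lambda> by (rule refl)+
  have L_0: "L i 0 = 0" for i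
    unfolding L_def T_0 by (rule \<Lambda>0)
  have L_diff: "L i (y - y') = L i y - L i y'" if "y \<in> gr Y i" "y' \<in> gr Y i" for i y y'
    using L_lin(1)[OF gr_closed(3)[OF Y that] that(2)] by simp
  have L_dif: "L (i + 1) (dif Y i y) = 0" if "y \<in> gr Y i" "p \<le> i + 1" for i y
    unfolding L_def
  proof (rule \<Lambda>(3))
    have "i - int (nat (i + 1 - p)) = p - 1"
      using that(2) by simp
    then show "T (i + 1) (nat (i + 1 - p)) (dif Y i y) \<in> coboundaries Y p"
      using T_in[OF that(1), of "nat (i + 1 - p)"] T_dif[OF that(1), of "nat (i + 1 - p)"]
      by (metis coboundariesI)
  qed
  have L_x: "L i (T t (nat (t - i)) x) = 1" if "p \<le> i" "i \<le> t" for i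
  proof -
    have "t - int (nat (t - i)) = i" "nat (t - i) + nat (i - p) = l"
      using that by (simp_all add: p_def)
    then show ?thesis
      using T_T[OF xg, of "nat (t - i)" "nat (i - p)"] \<Lambda>(4) by (simp add: L_def)
  qed
  \<comment> \<open>Nothing above \<open>t\<close>, only cocycles in degree \<open>t\<close>, the
    kernel of \<open>L\<close> between \<open>p\<close> and \<open>t\<close>, and everything below
    \<open>p\<close>. The truncation is what makes the family closed under the differential at the
    top.\<close>
  define G where "G i = {y \<in> gr Y i. (t < i \<longrightarrow> y = 0) \<and> (i = t \<longrightarrow> dif Y i y = 0) \<and> (p \<le> i \<longrightarrow> L i y = 0)}" for i
  define B where "B = \<lparr> gr = G, dif = dif Y, act = act Y \<rparr>"
  have pt: "p \<le> t"
    by (simp add: p_def)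
  have GY: "y \<in> gr Y i" if "y \<in> G i" for y i
    using that by (simp add: G_def)
  have G0: "0 \<in> G i" for i
    unfolding G_def by (simp add: gr_closed(1)[OF Y] dif_simps(3)[OF Y Y] L_0)
  have B: "dg_module B"
    unfolding B_def
  proof (rule dg_module_sub[OF Y])
    show "vec.subspace (G i)" for i
    proof (rule vec.subspaceI[OF G0])
      show "y + y' \<in> G i" if "y \<in> G i" "y' \<in> G i" for y y'
        using that unfolding G_def by (auto simp: L_lin(1) dif_simps[OF Y Y] gr_closed[OF Y])
      show "vscale c y \<in> G i" if "y \<in> G i" for c y
        using that unfolding G_def by (auto simp: L_lin(2) dif_simps[OF Y Y] gr_closed[OF Y])
    qed
    show "G i \<subseteq> gr Y i" for i
      using GY by blast
    show "dif Y i y \<in> G (i + 1)" if y: "y \<in> G i" for i y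
    proof -
      have yg: "y \<in> gr Y i"
        by (rule GY[OF y])
      have "dif Y i y = 0" if "t \<le> i"
        using that y dif_simps(3)[OF Y Y] unfolding G_def by (cases "i = t") auto
      then show ?thesis
        unfolding G_def using dif_in[OF Y yg] dif_dif[OF Y yg] L_dif[OF yg] by auto
    qed
    show "act Y i y r \<in> G (i + j)" if y: "y \<in> G i" and r: "r \<in> Rgr j" for i j y r
      using r
    proof (cases rule: RgrE)
      case (1 c m)
      have yg: "y \<in> gr Y i"
        by (rule GY[OF y])
      have e: "act Y i y r = vscale c (T i m y)" and ij: "i + j = i - int m"
        unfolding 1 T_def by (rule act_monom[OF Y yg]) simp
      have "T i m y \<in> G (i - int m)"
      proof (cases "t < i")
        case True
        then have "y = 0"
          using y by (simp add: G_def)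
        then show ?thesis
          using G0 T_0 by simp
      next
        case False
        \<comment> \<open>\<open>T\<close> lowers the degree and the pieces above \<open>t\<close>
          are zero, so degree \<open>t\<close> is reached only from itself with
          \<open>m = 0\<close>.\<close>
        have "dif Y (i - int m) (T i m y) = 0" if "i - int m = t"
        proof -
          have "i = t"
            using that False by simp
          then have "dif Y i y = 0"
            using y by (simp add: G_def)
          then show ?thesis
            unfolding T_dif[OF yg] using T_0 by simp
        qed
        moreover have "L (i - int m) (T i m y) = 0" if "p \<le> i - int m"
        proof -
          have "m + nat (i - int m - p) = nat (i - p)"
            using that by simp
          then have "L (i - int m) (T i m y) = L i y"
            unfolding L_def T_T[OF yg] by simp
          then show ?thesis
            using y that by (simp add: G_def)
        qed
        ultimately show ?thesis
          unfolding G_def using T_in[OF yg] False by auto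
      qed
      then show ?thesis
        unfolding e ij G_def by (auto simp: L_lin(2) dif_simps[OF Y Y] gr_closed[OF Y])
    next
      case 2
      then show ?thesis
        unfolding 2 act_zero[OF Y GY[OF y]] by (intro G0)
    qed
  qed
  have B_sel: "gr B i = G i" "dif B i y = dif Y i y" "act B i y r = act Y i y r" for i y r
    by (simp_all add: B_def)
  let ?A = "Xsf (- t) l :: ('k, 'u) dgm"
  have A: "dg_module ?A"
    by (rule dg_module_Xsf)
  \<comment> \<open>The image of \<open>Xr\<close> under the map to \<open>Y\<close> is an element
    that bounds \<open>x\<close> times the power l+1 of \<open>T\<close>.\<close>
  obtain w where w: "w \<in> gr Y (t - int (Suc l) - 1)" "T t (Suc l) x = dif Y (t - int (Suc l) - 1) w"
    using l(2) unfolding Q_def coboundaries_def by blast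
  define y where "y b = (case b of Xe \<Rightarrow> x | Xr \<Rightarrow> w)" for b
  let ?g = "sf_ext 0 Y (xdeg (- t) l) y"
  have wdeg: "t - int (Suc l) - 1 = t - int l - 2"
    by simp
  have y_in: "y b \<in> gr Y (xdeg (- t) l b)" for b
    using xg w(1) unfolding wdeg by (cases b) (simp_all add: y_def xdeg_def)
  have y_in0: "y b \<in> gr Y (xdeg (- t) l b + 0)" for b
    using y_in[of b] by simp
  have gh: "ghom 0 ?A Y ?g"
    unfolding Xsf_def by (rule sf_ext_ghom[OF sf_dif_X Y y_in0])
  have g_e: "?g i (gen Xe) = T t (nat (t - i)) x" if "i \<le> t" for i
    unfolding T_def by (subst sf_ext_superset[of "{Xe}"]) (auto simp: y_def xdeg_def)
  have g: "dg_hom ?A Y ?g"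
    unfolding Xsf_def
  proof (rule SF_dg_homI[OF sf_dif_X Y y_in])
    fix b
    show "?g (xdeg (- t) l b + 1) (dif (SF (xdeg (- t) l) xdif :: ('k, 'u) dgm) (xdeg (- t) l b) (gen b)) = dif Y (xdeg (- t) l b) (y b)"
    proof (cases b)
      case Xe
      have "dif Y t x = 0"
        using x(1) by (simp add: cocycles_def)
      then have "dif Y (xdeg (- t) l b) (y b) = 0"
        by (simp add: Xe xdeg_def y_def)
      then show ?thesis
        unfolding Xsf_def[symmetric] Xe Xsf_sel(3) by (simp only: ghom_simps(3)[OF gh A])
    next
      case Xr
      have "?g (xdeg (- t) l Xr + 1) (gen Xe) = T t (Suc l) x"
        by (subst g_e) (auto simp: xdeg_def nat_eq_iff intro!: arg_cong2[where f = "T t"])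
      also have "\<dots> = dif Y (xdeg (- t) l Xr) (y Xr)"
        unfolding w(2) wdeg by (simp add: xdeg_def y_def)
      finally show ?thesis
        unfolding Xsf_def[symmetric] Xr Xsf_sel(4) .
    qed
  qed
  have A_coc: "\<exists>c. z = vscale c (gen Xe) \<and> (c \<noteq> 0 \<longrightarrow> i \<le> t)" if z: "z \<in> cocycles ?A i" for z i
  proof -
    obtain c where c: "z = fv c" "xok (- t) l i (c Xe) (c Xr)"
      using coc_in_gr[OF z] by (auto simp: Xsf_gr)
    have "fv (xdif c) = (fv (\<lambda>b::xgen. 0) :: ('k, 'u) vec)"
      using z by (simp add: cocycles_def c(1) Xsf_def)
    then have "xdif c Xe = 0"
      unfolding fv_eq_iff by simp
    then have "c Xr = 0"
      by (simp add: xdif_def)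
    then show ?thesis
      using c xgen_gen_cases[of c] by (intro exI[of _ "c Xe"]) (auto simp: xok_def)
  qed
  have e_in: "gen Xe \<in> gr ?A i" if "i \<le> t" for i
    unfolding Xsf_def using that by (intro gen_in) (simp add: xdeg_def)
  have e_coc: "gen Xe \<in> cocycles ?A i" if "i \<le> t" for i
    using e_in[OF that] by (simp add: cocycles_def Xsf_sel)
  let ?S = "dsum ?A B"
  let ?F = "\<lambda>i v. ?g i (pfst v) + psnd v"
  have S: "dg_module ?S"
    by (rule dg_module_dsum[OF A B])
  have F: "dg_hom ?S Y ?F"
    unfolding dg_hom_def
  proof (intro conjI allI ballI)
    show "klinear_on (gr ?S i) (?F i)" for i
      unfolding klinear_on_def
    proof (intro conjI ballI allI)
      fix v v' assume v: "v \<in> gr ?S i" "v' \<in> gr ?S i"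
      show "?F i (v + v') = ?F i v + ?F i v'"
        using v unfolding proj_arith dsum_sel by (simp only: ghom_simps(1)[OF gh A] add.assoc add.left_commute)
      show "?F i (vscale c v) = vscale c (?F i v)" for c
        using v unfolding proj_arith dsum_sel by (simp only: ghom_simps(2)[OF gh A] vec.scale_right_distrib)
    qed
    fix i v assume "v \<in> gr ?S i"
    then have v: "pfst v \<in> gr ?A i" "psnd v \<in> gr Y i"
      using GY by (simp_all add: dsum_sel B_sel)
    have gv: "?g i (pfst v) \<in> gr Y i"
      by (rule dg_hom_in[OF g v(1)])
    show "?F i v \<in> gr Y i"
      by (rule gr_closed(2)[OF Y gv v(2)])
    show "?F (i + 1) (dif ?S i v) = dif Y i (?F i v)"
      unfolding dsum_sel pair_sel B_sel dg_hom_dif[OF g v(1)] dif_simps(1)[OF Y Y gv v(2)] ..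
    show "?F (i + j) (act ?S i v r) = act Y i (?F i v) r" if r: "r \<in> Rgr j" for j r
      unfolding dsum_sel pair_sel B_sel dg_hom_act[OF g v(1) r] act_simps(1)[OF Y r Y gv v(2)] ..
  qed
  have "quasi_iso ?S Y ?F"
    unfolding quasi_iso_def
  proof (intro conjI allI ballI impI F)
    fix i v assume v: "v \<in> cocycles ?S i" and Fv: "?F i v \<in> coboundaries Y i"
    define z b where "z = pfst v" and "b = psnd v"
    have "z \<in> cocycles ?A i" and bG: "b \<in> G i" and db: "dif Y i b = 0"
      using v unfolding cocycles_def z_def b_def by (simp_all add: dsum_sel B_sel)
    then obtain c where c: "z = vscale c (gen Xe)" "c \<noteq> 0 \<longrightarrow> i \<le> t"
      using A_coc by blast
    have bg: "b \<in> gr Y i"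
      by (rule GY[OF bG])
    obtain u where u: "u \<in> gr Y (i - 1)" "?g i z + b = dif Y (i - 1) u"
      using Fv unfolding coboundaries_def z_def[symmetric] b_def[symmetric] by blast
    have vzb: "v = pair z b"
      by (simp add: z_def b_def)
    \<comment> \<open>From the vanishing of the sum in cohomology both components have to be bounded
      separately. Between \<open>p\<close> and \<open>t\<close> the functional \<open>L\<close>
      shows that \<open>z\<close> is zero; below \<open>p\<close>, \<open>z\<close> is bounded by a
      multiple of \<open>Xr\<close>.\<close>
    have "\<exists>z'\<in>gr ?A (i - 1). \<exists>u'\<in>G (i - 1). z = dif ?A (i - 1) z' \<and> b = dif Y (i - 1) u'"
    proof (cases "t < i")
      case True
      then have "z = 0" "b = 0"
        using c bG by (auto simp: G_def)
      then show ?thesis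
        using gr_closed(1)[OF A] G0 dif_simps(3)[OF A A] dif_simps(3)[OF Y Y] by metis
    next
      case False
      then have it: "i \<le> t"
        by simp
      have gz: "?g i z = vscale c (T t (nat (t - i)) x)"
        unfolding c(1) ghom_simps(2)[OF gh A e_in[OF it]] g_e[OF it] ..
      have Tx: "T t (nat (t - i)) x \<in> gr Y i"
        using T_in[OF xg, of "nat (t - i)"] it by simp
      show ?thesis
      proof (cases "p \<le> i")
        case True
        have "L i (?g i z + b) = c"
          unfolding gz L_lin(1)[OF gr_closed(5)[OF Y Tx] bg] L_lin(2)[OF Tx Tx] L_x[OF True it]
          using bG True by (simp add: G_def)
        moreover have "L i (?g i z + b) = 0"
          using L_dif[OF u(1)] True unfolding u(2) by simp
        ultimately have "c = 0"
          by simp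
        then have z0: "z = 0" "?g i z = 0"
          unfolding gz by (simp_all add: c(1))
        have b: "b = dif Y (i - 1) u"
          using u(2) unfolding z0(2) by (simp only: add_0_left)
        have "\<exists>u'\<in>G (i - 1). b = dif Y (i - 1) u'"
        proof (cases "p \<le> i - 1")
          case True
          let ?q = "T t (nat (t - (i - 1))) x"
          have q: "?q \<in> cocycles Y (i - 1)"
            using T_coc[OF x(1), of "nat (t - (i - 1))"] it by simp
          note qg = coc_in_gr[OF q]
          \<comment> \<open>Subtracting a multiple of a cocycle generated by \<open>x\<close> brings
            the primitive into the kernel of \<open>L\<close> without changing its
            differential.\<close>
          let ?u = "u - vscale (L (i - 1) u) ?q"
          have ug: "?u \<in> gr Y (i - 1)"
            by (intro gr_closed(3,5)[OF Y] u(1) qg)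
          have "L (i - 1) ?u = 0"
            unfolding L_diff[OF u(1) gr_closed(5)[OF Y qg]] L_lin(2)[OF qg qg]
            using L_x[OF True] it by simp
          then have "?u \<in> G (i - 1)"
            using ug it by (simp add: G_def)
          moreover have "dif Y (i - 1) ?u = b"
            using q unfolding dif_simps(5)[OF Y Y u(1) gr_closed(5)[OF Y qg]] dif_simps(2)[OF Y Y qg] b
            by (simp add: cocycles_def)
          ultimately show ?thesis
            by blast
        next
          case False
          then have "u \<in> G (i - 1)"
            using u(1) it by (simp add: G_def)
          then show ?thesis
            using b by blast
        qed
        then show ?thesis
          using z0(1) gr_closed(1)[OF A] dif_simps(3)[OF A A] by metis
      next
        case False
        have r: "gen Xr \<in> gr ?A (i - 1)"
          unfolding Xsf_def using False by (intro gen_in) (simp add: xdeg_def p_def)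
        let ?z = "vscale c (gen Xr)"
        have z': "?z \<in> gr ?A (i - 1)"
          by (rule gr_closed(5)[OF A r])
        have dz: "z = dif ?A (i - 1) ?z"
          unfolding dif_simps(2)[OF A A r] Xsf_sel(4) c(1) ..
        have gz': "?g (i - 1) ?z \<in> gr Y (i - 1)"
          by (rule dg_hom_in[OF g z'])
        have "u - ?g (i - 1) ?z \<in> gr Y (i - 1)"
          by (rule gr_closed(3)[OF Y u(1) gz'])
        then have "u - ?g (i - 1) ?z \<in> G (i - 1)"
          using False it by (simp add: G_def)
        moreover have "b = dif Y (i - 1) (u - ?g (i - 1) ?z)"
          unfolding dif_simps(5)[OF Y Y u(1) gz'] u(2)[symmetric] dg_hom_dif_pred[OF g z', symmetric] dz[symmetric]
          by (simp only: add_diff_cancel_left')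
        ultimately show ?thesis
          using z' dz by blast
      qed
    qed
    then obtain z' u' where zu: "z' \<in> gr ?A (i - 1)" "u' \<in> G (i - 1)" "z = dif ?A (i - 1) z'" "b = dif Y (i - 1) u'"
      by blast
    show "v \<in> coboundaries ?S i"
    proof (rule coboundariesI)
      show "pair z' u' \<in> gr ?S (i - 1)"
        using zu by (simp only: dsum_sel pair_sel B_sel simp_thms)
      show "v = dif ?S (i - 1) (pair z' u')"
        unfolding vzb dsum_sel pair_sel B_sel using zu by (simp only:)
    qed
  next
    fix i y assume y: "y \<in> cocycles Y i"
    note yg = coc_in_gr[OF y]
    have dy: "dif Y i y = 0"
      using y by (simp add: cocycles_def)
    show "\<exists>v\<in>cocycles ?S i. ?F i v - y \<in> coboundaries Y i"
    proof (cases "t < i")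
      case True
      then have "y \<in> coboundaries Y i"
        using top y by blast
      then have "?F i 0 - y \<in> coboundaries Y i"
        unfolding proj_arith ghom_simps(3)[OF gh A] by (intro cob_simps(3)[OF Y]) (simp_all only: add_0_left cob_simps(1)[OF Y])
      then show ?thesis
        using coc_simps(1)[OF S] by blast
    next
      case False
      then have it: "i \<le> t"
        by simp
      \<comment> \<open>The coefficient that makes the rest of \<open>y\<close> lie in the kernel of
        \<open>L\<close>. Below \<open>p\<close> nothing has to be removed.\<close>
      define c where "c = (if p \<le> i then L i y else 0)"
      let ?q = "T t (nat (t - i)) x"
      have q: "?q \<in> cocycles Y i"
        using T_coc[OF x(1), of "nat (t - i)"] it by simp
      note qg = coc_in_gr[OF q]
      have dq: "dif Y i ?q = 0"
        using q by (simp add: cocycles_def)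
      let ?b = "y - vscale c ?q"
      have bg: "?b \<in> gr Y i"
        by (intro gr_closed(3,5)[OF Y] yg qg)
      have db: "dif Y i ?b = 0"
        unfolding dif_simps(5)[OF Y Y yg gr_closed(5)[OF Y qg]] dif_simps(2)[OF Y Y qg] dy dq by simp
      have Lb: "L i ?b = 0" if "p \<le> i"
        unfolding L_diff[OF yg gr_closed(5)[OF Y qg]] L_lin(2)[OF qg qg] using L_x[OF that it] that by (simp add: c_def)
      have bG: "?b \<in> G i"
        unfolding G_def
      proof (intro CollectI conjI impI)
        show "?b = 0" if "t < i"
          using it that by simp
      qed (rule bg db Lb, assumption?)+
      have "pair (vscale c (gen Xe)) ?b \<in> cocycles ?S i"
        using coc_simps(5)[OF A e_coc[OF it], of c] bG db unfolding cocycles_def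
        by (simp add: dsum_sel B_sel)
      moreover have "?F i (pair (vscale c (gen Xe)) ?b) - y = 0"
        unfolding pair_sel ghom_simps(2)[OF gh A e_in[OF it]] g_e[OF it] by (simp add: algebra_simps)
      ultimately show ?thesis
        using cob_simps(1)[OF Y] by metis
    qed
  qed
  moreover have "cocycles B i \<subseteq> cocycles Y i" "coboundaries B i \<subseteq> coboundaries Y i" for i
    using GY by (auto simp: cocycles_def coboundaries_def B_sel)
  ultimately show thesis
    using that B g by blast
qed

text \<open>The split summand has cohomology in degree -a and is not zero, so indecomposability
  makes the complement acyclic. The map from the summand to \<open>Y\<close> is then a
  quasi-isomorphism.\<close>

lemma indecomposable_Df:
  fixes Y :: "('k::field, 'u) dgm"
  assumes "indecomposable_in Df Y"
  obtains a l g where "dg_module Y" "quasi_iso (Xsf a l) Y g"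
proof -
  have Y: "dg_module Y" and fin: "finite_total_cohomology Y" and nz: "\<not> isomorphic_in Df Y zero_dgm"
    and ind: "\<And>A B. isomorphic_in Df Y (dsum A B) \<Longrightarrow> A \<in> Obj Df \<Longrightarrow> B \<in> Obj Df \<Longrightarrow>
      isomorphic_in Df A zero_dgm \<or> isomorphic_in Df B zero_dgm"
    using assms by (auto simp: indecomposable_in_def Df_def full_subcategory_def DR_def)
  have "\<exists>i. \<not> cocycles Y i \<subseteq> coboundaries Y i"
    using nz derived_iso_zero_if_acyclic[OF Y] Y fin dg_module_zero finite_total_zero
    unfolding isomorphic_in_Df_iff by blast
  then obtain i0 where i0: "\<not> cocycles Y i0 \<subseteq> coboundaries Y i0"
    by blast
  obtain a l B g where B: "dg_module B" and g: "dg_hom (Xsf a l) Y g"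
    and F: "quasi_iso (dsum (Xsf a l) B) Y (\<lambda>i v. g i (pfst v) + psnd v)"
    and BY: "\<And>i. cocycles B i \<subseteq> cocycles Y i" "\<And>i. coboundaries B i \<subseteq> coboundaries Y i"
    by (rule split_off[OF Y fin i0]) (rule that)
  let ?A = "Xsf a l :: ('k, 'u) dgm"
  let ?F = "\<lambda>i v. g i (pfst v) + psnd v"
  have A: "dg_module ?A"
    by (rule dg_module_Xsf)
  have S: "dg_module (dsum ?A B)"
    by (rule dg_module_dsum[OF A B])
  have finS: "finite_total_cohomology (dsum ?A B)"
    by (rule finite_total_quasi_iso[OF S Y F fin])
  note finAB = finite_total_dsum[OF A B finS]
  have "isomorphic_in Df Y (dsum ?A B)"
    unfolding isomorphic_in_Df_iff using Y fin S finS derived_iso_roof[OF Y S S F quasi_iso_id[OF S]] by blast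
  then have "derived_iso ?A zero_dgm \<or> derived_iso B zero_dgm"
    using ind[of ?A B] A B finAB unfolding isomorphic_in_Df_iff
    by (auto simp: Df_def full_subcategory_def DR_def)
  moreover have zero: "cocycles M i \<subseteq> coboundaries M i" if "derived_iso M zero_dgm" "dg_module M" for M :: "('k, 'u) dgm" and i
    by (rule derived_iso_exact[OF that(2) dg_module_zero that(1)])
      (auto simp: cocycles_def coboundaries_def zero_dgm_sel)
  moreover have "\<not> derived_iso ?A zero_dgm"
    using zero[of ?A "- a"] A Xsf_exact_iff[of a l "- a"] by auto
  ultimately have acB: "cocycles B i \<subseteq> coboundaries B i" for i
    using B by blast
  have "quasi_iso ?A Y g"
    unfolding quasi_iso_def
  proof (intro conjI allI ballI impI g)
    fix i v assume v: "v \<in> cocycles ?A i" "g i v \<in> coboundaries Y i"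
    have "pair v 0 \<in> cocycles (dsum ?A B) i"
      using dg_hom_cocycle[OF A S dsum_maps(1)[OF A B] v(1)] .
    moreover have "?F i (pair v 0) \<in> coboundaries Y i"
      using v(2) by simp
    ultimately have "pair v 0 \<in> coboundaries (dsum ?A B) i"
      by (rule quasi_iso_inj[OF F])
    from dg_hom_coboundary[OF dsum_maps(3)[OF A B] this] show "v \<in> coboundaries ?A i"
      by simp
  next
    fix i y assume "y \<in> cocycles Y i"
    then obtain v where v: "v \<in> cocycles (dsum ?A B) i" "?F i v - y \<in> coboundaries Y i"
      using quasi_iso_surj[OF F] by blast
    have 1: "pfst v \<in> cocycles ?A i"
      by (rule dg_hom_cocycle[OF S A dsum_maps(3)[OF A B] v(1)])
    have "psnd v \<in> cocycles B i"
      by (rule dg_hom_cocycle[OF S B dsum_maps(4)[OF A B] v(1)])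
    then have "psnd v \<in> coboundaries Y i"
      using acB BY by blast
    from cob_simps(3)[OF Y v(2) this] have "g i (pfst v) - y \<in> coboundaries Y i"
      by (simp add: algebra_simps)
    then show "\<exists>x\<in>cocycles ?A i. g i x - y \<in> coboundaries Y i"
      using 1 by blast
  qed
  then show thesis
    using that Y by blast
qed

text \<open>Every member of the wedge has cohomology in degree -m, a property invariant under
  isomorphism. Conversely \<open>j = m - a\<close> exhibits \<open>Y\<close> in the wedge.\<close>

lemma wedge_iff:
  fixes Y :: "('k::field, 'u) dgm"
  assumes Y: "dg_module Y" and g: "quasi_iso (Xsf a l) Y g"
  shows "Y \<in> wedge m \<longleftrightarrow> a \<le> m \<and> m \<le> a + int l"
proof
  assume "Y \<in> wedge m"
  then obtain j l' where j: "j \<le> l'" and iso: "derived_iso Y (susp (m - int j) (X l'))"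
    by (auto simp: wedge_def isomorphic_in_DR_iff)
  let ?N = "susp (m - int j) (X l') :: ('k, 'u) dgm"
  have "\<not> cocycles (Xsf (m - int j) l' :: ('k, 'u) dgm) (- m) \<subseteq> coboundaries (Xsf (m - int j) l') (- m)"
    unfolding Xsf_exact_iff using j by simp
  then have "\<not> cocycles ?N (- m) \<subseteq> coboundaries ?N (- m)"
    unfolding quasi_iso_exact_iff[OF dg_module_Xsf dg_module_susp_X quasi_iso_xmap] .
  then have "\<not> cocycles Y (- m) \<subseteq> coboundaries Y (- m)"
    using derived_iso_exact[OF dg_module_susp_X Y derived_iso_sym[OF iso]] by blast
  then show "a \<le> m \<and> m \<le> a + int l"
    unfolding quasi_iso_exact_iff[OF dg_module_Xsf Y g, symmetric] Xsf_exact_iff by linarith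
next
  assume m: "a \<le> m \<and> m \<le> a + int l"
  have "isomorphic_in DR Y (susp (m - int (nat (m - a))) (X l))"
    using m derived_iso_roof[OF Y dg_module_susp_X dg_module_Xsf g quasi_iso_xmap] Y dg_module_susp_X
    by (simp add: isomorphic_in_DR_iff)
  moreover have "nat (m - a) \<le> l"
    using m by linarith
  ultimately show "Y \<in> wedge m"
    unfolding wedge_def by blast
qed

theorem theorem2p7:
  fixes n :: int and E Y :: "('k::alg_closed_field, 'u) dgm"
  assumes "is_E n E"
    and "indecomposable_in Df Y"
  shows "kspace_iso (Hom Dbar Y (susp 1 E)) (if Y \<in> wedge (n + 1) then k_line else k_zero) \<and>
         kspace_iso (Hom Dbar E (susp 1 Y)) (if Y \<in> wedge (n + 1) then k_line else k_zero)"
proof -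
  obtain a l g where Y: "dg_module Y" and g: "quasi_iso (Xsf a l) Y g"
    using assms(2) by (rule indecomposable_Df)
  obtain \<beta> f where f: "dg_hom (Esf n \<beta>) E f" and bij: "\<And>i. bij_betw (f i) (gr (Esf n \<beta>) i) (gr E i)"
    using E_model[OF assms(1)] by blast
  let ?Z = "Xsf a l :: ('k, 'u) dgm" and ?M = "Esf n \<beta> :: ('k, 'u) dgm"
  have E: "dg_module E"
    by (rule dg_module_surj_image[OF dg_module_Esf f bij_betw_imp_surj_on[OF bij]])
  have fq: "quasi_iso ?M E f"
    by (rule quasi_isoI_bij[OF dg_module_Esf f bij E])
  have Hom: "Hom Dbar = DHom"
    by (simp add: Dbar_def full_subcategory_def DR_def)
  note ZM = dg_module_Xsf[of a l] and MM = dg_module_Esf[of n \<beta>]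
  have wedge: "Y \<in> wedge (n + 1) \<longleftrightarrow> a \<le> n + 1 \<and> n + 1 \<le> a + int l"
    by (rule wedge_iff[OF Y g])
  obtain h where h: "quasi_iso ?M (Kint (\<lambda>i. - n \<le> i)) h"
    by (rule Esf_Kint)
  have conv: "convex_pred (\<lambda>i. - n \<le> i)" "convex_pred (\<lambda>i. - a - int l \<le> i \<and> i \<le> - a)"
    by (auto simp: convex_pred_def)
  \<comment> \<open>Suspension lowers the interval by one.\<close>
  have "susp 1 (Kint (\<lambda>i. - n \<le> i)) = (Kint (\<lambda>i. - n - 1 \<le> i) :: ('k, 'u) dgm)"
    unfolding susp_Kint by (rule arg_cong[of _ _ Kint]) auto
  then have "hom_spanned ?Z (susp 1 (Kint (\<lambda>i. - n \<le> i))) (- n - 1 \<le> - a \<and> - a - int l - 1 < - n - 1)"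
    using hom_spanned_Xsf_Kint[of a l "- n - 1"] by simp
  also have "(- n - 1 \<le> - a \<and> - a - int l - 1 < - n - 1) \<longleftrightarrow> Y \<in> wedge (n + 1)"
    unfolding wedge by auto
  \<comment> \<open>The result for the interval module passes back to the model of \<open>E\<close>,
    along the map to the interval, and then forward to \<open>E\<close> itself.\<close>
  finally have "hom_spanned ?Z (susp 1 ?M) (Y \<in> wedge (n + 1))"
    by (rule hom_spanned_target[OF h_projective_Xsf dg_module_susp[OF MM] dg_module_susp[OF dg_module_Kint[OF conv(1)]]
          quasi_iso_susp[OF MM dg_module_Kint[OF conv(1)] h]])
  then have "hom_spanned ?Z (susp 1 E) (Y \<in> wedge (n + 1))"
    by (rule hom_spanned_source[OF h_projective_Xsf dg_module_susp[OF MM] dg_module_susp[OF E] quasi_iso_susp[OF MM E fq]])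
  then have 1: "kspace_iso (DHom Y (susp 1 E)) (if Y \<in> wedge (n + 1) then k_line else k_zero)"
    by (rule DHom_if_hom_spanned[OF h_projective_Xsf Y dg_module_susp[OF E] g])
  obtain h' where h': "quasi_iso ?Z (Kint (\<lambda>i. - a - int l \<le> i \<and> i \<le> - a)) h'"
    by (rule Xsf_Kint)
  \<comment> \<open>For the second space the roles change: the model of \<open>E\<close> is the
    h-projective source, and \<open>Y\<close> is replaced by its interval module.\<close>
  have "susp 1 (Kint (\<lambda>i. - a - int l \<le> i \<and> i \<le> - a)) =
      (Kint (\<lambda>i. - a - int l - 1 \<le> i \<and> i \<le> - a - 1) :: ('k, 'u) dgm)"
    unfolding susp_Kint by (rule arg_cong[of _ _ Kint]) auto
  then have "hom_spanned ?M (susp 1 (Kint (\<lambda>i. - a - int l \<le> i \<and> i \<le> - a)))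
      (- a - int l - 1 \<le> - n - 2 \<and> - n - 2 \<le> - a - 1)"
    using hom_spanned_Esf_Kint[of n \<beta> "- a - int l - 1" "- a - 1"] by simp
  also have "(- a - int l - 1 \<le> - n - 2 \<and> - n - 2 \<le> - a - 1) \<longleftrightarrow> Y \<in> wedge (n + 1)"
    unfolding wedge by auto
  finally have "hom_spanned ?M (susp 1 ?Z) (Y \<in> wedge (n + 1))"
    by (rule hom_spanned_target[OF h_projective_Esf dg_module_susp[OF ZM] dg_module_susp[OF dg_module_Kint[OF conv(2)]]
          quasi_iso_susp[OF ZM dg_module_Kint[OF conv(2)] h']])
  then have "hom_spanned ?M (susp 1 Y) (Y \<in> wedge (n + 1))"
    by (rule hom_spanned_source[OF h_projective_Esf dg_module_susp[OF ZM] dg_module_susp[OF Y] quasi_iso_susp[OF ZM Y g]])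
  then have 2: "kspace_iso (DHom E (susp 1 Y)) (if Y \<in> wedge (n + 1) then k_line else k_zero)"
    by (rule DHom_if_hom_spanned[OF h_projective_Esf E dg_module_susp[OF Y] fq])
  show ?thesis
    unfolding Hom using 1 2 by blast
qed

end
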